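(* Let $X$ and $Y$ be independent random variables valued in $\Omega_+$ having positive and continuous densities on $\Omega_+$. Assume that the random matrices $$U=\mathbb{P}\big((\mathbf{e}+X)^{-1/2}\big)Y\quad\text{and}\quad V=\mathbb{P}\big((\mathbf{e}+U)^{1/2}\big)X$$ are also independent. Then there exist $a>\frac{r-1}{2}$, $b>\frac{r-1}{2}-a$ and $\lambda>0$ such that $X\sim\mathcal{MK}(a,b,\lambda\mathbf{e})$ and $Y\sim\mathcal{W}(a+b,\lambda\mathbf{e})$.
   Context: Let $r\ge 1$ be an integer. $\Omega$ is the linear space of real symmetric $r\times r$ matrices with inner product $\langle x,y\rangle=\mathrm{tr}(xy)$, $\Omega_+\subset\Omega$ is the cone of positive definite matrices, and $\mathbf{e}$ is the $r\times r$ identity matrix. For $y\in\Omega_+$, $\mathbb{P}(y)$ is the endomorphism of $\Omega$ given by $\mathbb{P}(y)x=yxy$; $y^{1/2}\in\Omega_+$ is the positive definite square root and $y^{-1/2}=(y^{1/2})^{-1}$. Densities are with respect to Lebesgue measure on $\Omega$. For $b>\frac{r-1}{2}$ and $\Sigma\in\Omega_+$, the Wishart distribution $\mathcal{W}(b,\Sigma)$ is the probability law on $\Omega_+$ with density proportional to $(\det y)^{b-\frac{r+1}{2}}\exp(-\langle\Sigma,y\rangle)\,I_{\Omega_+}(y)$. For $a>\frac{r-1}{2}$, $b\in\mathbb{R}$ and $\Sigma\in\Omega_+$, the matrix-Kummer distribution $\mathcal{MK}(a,b,\Sigma)$ is the probability law on $\Omega_+$ with density proportional to $(\det x)^{a-\frac{r+1}{2}}(\det(\mathbf{e}+x))^{-(a+b)}\exp(-\langle\Sigma,x\rangle)\,I_{\Omega_+}(x)$.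 *)

theory Defs
  imports "HOL-Probability.Probability" "HOL-Library.Uprod"
begin

text \<open>The size \<open>r\<close> of the matrices is \<open>CARD('n)\<close>.\<close>

definition sym_matrices :: "(real^'n^'n) set" where
  "sym_matrices = {x. transpose x = x}"

definition pos_def_cone :: "(real^'n^'n) set" where
  "pos_def_cone = {x \<in> sym_matrices. \<forall>v. v \<noteq> 0 \<longrightarrow> 0 < v \<bullet> (x *v v)}"

definition mat_sqrt :: "real^'n^'n \<Rightarrow> real^'n^'n" where
  "mat_sqrt y = (THE s. s \<in> pos_def_cone \<and> s ** s = y)"

definition quad_rep :: "real^'n^'n \<Rightarrow> real^'n^'n \<Rightarrow> real^'n^'n" where
  "quad_rep y x = y ** x ** y"

instance uprod :: (finite) finite
  by standard simp

text \<open>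
  Coordinates of a symmetric matrix are indexed by unordered pairs of indices, so the
  coordinate space has dimension \<open>r (r + 1) / 2\<close>. The off-diagonal entries are scaled by
  \<open>1 / sqrt 2\<close> so that the coordinates are orthonormal for the inner product \<open>tr (x y)\<close>;
  this is what the two lemmas following the definition express. The measure below is thus the
  Lebesgue measure of the Euclidean space of symmetric matrices, viewed as a measure on all
  square matrices that is concentrated on the symmetric ones.
\<close>

definition sym_of_coords :: "real^('n::finite uprod) \<Rightarrow> real^'n^'n" where
  "sym_of_coords c = (\<chi> i j. (if i = j then 1 else 1 / sqrt 2) * c $ Upair i j)"

lemma trace_sym_of_coords:
  fixes c d :: "real^('n::finite uprod)"
  shows "trace (sym_of_coords c ** sym_of_coords d) = c \<bullet> d"
proof -
  define g :: "'n \<times> 'n \<Rightarrow> real" where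
    "g = (\<lambda>(i, j). (if i = j then 1 else 1 / 2) * (c $ Upair i j * d $ Upair i j))"
  have eq: "sym_of_coords c $ i $ j * sym_of_coords d $ j $ i = g (i, j)" for i j
  proof -
    have "d $ Upair j i = d $ Upair i j" by (rule arg_cong[of _ _ "($) d"]) (simp add: Upair_inject)
    thus ?thesis by (simp add: g_def sym_of_coords_def)
  qed
  have "trace (sym_of_coords c ** sym_of_coords d) = (\<Sum>i\<in>UNIV. \<Sum>j\<in>UNIV. g (i, j))"
    by (simp add: trace_def matrix_matrix_mult_def eq)
  also have "\<dots> = (\<Sum>p\<in>UNIV. g p)"
    by (simp add: sum.cartesian_product flip: UNIV_Times_UNIV)
  also have "\<dots> = (\<Sum>u\<in>UNIV. \<Sum>p | (case p of (i, j) \<Rightarrow> Upair i j) = u. g p)"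
    using sum.group[of "UNIV :: ('n \<times> 'n) set" "UNIV :: 'n uprod set"
        "\<lambda>(i, j). Upair i j" g] by simp
  also have "\<dots> = (\<Sum>u\<in>UNIV. c $ u * d $ u)"
  proof (rule sum.cong[OF refl])
    fix u :: "'n uprod"
    obtain i j where u: "u = Upair i j" by (cases u)
    have S: "{p. (case p of (i, j) \<Rightarrow> Upair i j) = u} = {(i, j), (j, i)}"
      by (auto simp: u Upair_inject)
    have ji: "Upair j i = Upair i j" by (simp add: Upair_inject)
    show "(\<Sum>p | (case p of (i, j) \<Rightarrow> Upair i j) = u. g p) = c $ u * d $ u"
      unfolding S by (cases "i = j") (simp_all add: g_def u ji)
  qed
  finally show ?thesis by (simp add: inner_vec_def)
qed

lemma range_sym_of_coords: "range sym_of_coords = sym_matrices"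
proof (intro equalityI subsetI)
  fix x :: "real^'n^'n" assume "x \<in> range sym_of_coords"
  thus "x \<in> sym_matrices"
    by (auto simp: sym_matrices_def sym_of_coords_def transpose_def vec_eq_iff Upair_inject
        intro!: arg_cong[where f = "\<lambda>u. _ $ u"])
next
  fix x :: "real^'n^'n" assume x: "x \<in> sym_matrices"
  have sym: "x $ j $ i = x $ i $ j" for i j
    using x by (metis (mono_tags) mem_Collect_eq sym_matrices_def transpose_def vec_lambda_beta)
  define h where "h = (\<lambda>i j. (if i = j then 1 else sqrt 2) * x $ i $ j)"
  have h_sym: "h i j = h j i" for i j
    by (simp add: h_def sym)
  have "\<exists>t. \<forall>i j. u = Upair i j \<longrightarrow> t = h i j" for u
  proof -
    obtain a b where u: "u = Upair a b" by (cases u)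
    have "\<forall>i j. u = Upair i j \<longrightarrow> h a b = h i j"
      by (auto simp: u Upair_inject intro: h_sym)
    thus ?thesis by blast
  qed
  then obtain t where t: "\<And>u i j. u = Upair i j \<Longrightarrow> t u = h i j" by metis
  have "x = sym_of_coords (\<chi> u. t u)"
    by (auto simp: vec_eq_iff sym_of_coords_def t[OF refl] h_def)
  thus "x \<in> range sym_of_coords" by blast
qed

definition sym_lborel :: "(real^'n^'n) measure" where
  "sym_lborel = distr lborel borel sym_of_coords"

text \<open>
  For measurable \<open>k \<ge> 0\<close>, a probability measure precisely when the integral of \<open>k\<close> is
  positive and finite.
\<close>

definition law_proportional_to :: "(real^'n^'n \<Rightarrow> real) \<Rightarrow> (real^'n^'n) measure" where
  "law_proportional_to k =
     density sym_lborel
       (\<lambda>x. ennreal (k x) / (\<integral>\<^sup>+z. ennreal (k z) \<partial>sym_lborel))"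

text \<open>The Wishart law, meant for \<open>b > (r - 1) / 2\<close> and \<open>S\<close> positive definite.\<close>

definition wishart :: "real \<Rightarrow> real^'n^'n \<Rightarrow> (real^'n^'n) measure" where
  "wishart b S = law_proportional_to
     (\<lambda>y. det y powr (b - (real CARD('n) + 1) / 2) * exp (- trace (S ** y)) *
          indicator pos_def_cone y)"

text \<open>
  The matrix-Kummer law, meant for \<open>a > (r - 1) / 2\<close>, arbitrary \<open>b\<close>, and \<open>S\<close> positive
  definite.
\<close>

definition matrix_kummer :: "real \<Rightarrow> real \<Rightarrow> real^'n^'n \<Rightarrow> (real^'n^'n) measure" where
  "matrix_kummer a b S = law_proportional_to
     (\<lambda>x. det x powr (a - (real CARD('n) + 1) / 2) * det (mat 1 + x) powr (- (a + b)) *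
          exp (- trace (S ** x)) * indicator pos_def_cone x)"

definition has_pos_cont_density :: "'a measure \<Rightarrow> ('a \<Rightarrow> real^'n^'n) \<Rightarrow> bool" where
  "has_pos_cont_density M X \<longleftrightarrow>
     (\<exists>f. (\<forall>x\<in>pos_def_cone. 0 < f x) \<and> continuous_on pos_def_cone f \<and>
          distributed M sym_lborel X (\<lambda>x. ennreal (f x * indicator pos_def_cone x)))"

end

theory Submission
  imports Defs
begin

text \<open>
  Write \<open>Q(x)u = (e + x)\<^sup>1\<^sup>/\<^sup>2 u (e + x)\<^sup>1\<^sup>/\<^sup>2\<close>. The map from \<open>(X, Y)\<close> to \<open>(U, V)\<close> is a bijection
  of the squared cone with inverse determined by \<open>Y = Q(X)U\<close>, \<open>V = Q(U)X\<close>. After a change of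
  variables independence says that the logarithms of the densities, corrected by Jacobians, satisfy
  \<open>F(x) + G(Q(x)u) = A(u) + D(Q(u)x)\<close> on the cone. Letting \<open>x\<close> tend to \<open>0\<close> in mixed differences shows
  that \<open>D(t w) - D(t e)\<close> has a limit \<open>l(w)\<close> as \<open>t\<close> decreases to \<open>0\<close>, with
  \<open>l(w\<^sup>1\<^sup>/\<^sup>2 x w\<^sup>1\<^sup>/\<^sup>2) = l(w) + l(x)\<close>; hence \<open>l\<close> is a multiple of \<open>ln det\<close>, and likewise for \<open>G\<close>.
  Once these logarithmic parts are subtracted, \<open>G(Q(x)u) - G(u) = D(Q(u)x) - D(x)\<close>. Taking one
  argument scalar makes \<open>G\<close> and \<open>D\<close> affine along rays with a common slope \<open>S\<close>. Rescaling the
  equation gives \<open>S(x\<^sup>1\<^sup>/\<^sup>2 u x\<^sup>1\<^sup>/\<^sup>2) = S(u\<^sup>1\<^sup>/\<^sup>2 x u\<^sup>1\<^sup>/\<^sup>2)\<close> and additivity of \<open>S\<close>, which force \<open>S\<close> to be a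
  multiple of the trace. Integrability of the resulting densities restricts the parameters.
\<close>

section \<open>Positive definite matrices and their square roots\<close>

text \<open>The densities are only continuous, so nothing is differentiated: derivatives give way to
  mixed differences, limits at the apex of the cone and additivity of continuous functions.
  Diagonalisation is avoided as well. Square roots exist because squaring has an open and closed
  image in the connected cone, and multiples of \<open>ln det\<close> are recognised by
  transvections and a minimisation of the trace. That characterisation serves twice, since it also
  yields the Jacobian of a congruence by a square root. Independence speaks about probabilities of
  sets; the equation on the whole cone is extracted from it on shrinking boxes, using that the joint
  density is continuous and positive. For the parameters two symmetries of Lebesgue measure suffice:
  translation along a diagonal direction, in which \<open>det\<close> is affine, forces exponents
  above -1, and dilation by 2 forces exponential decay.\<close>

lemma bounded_bilinear_matrix_mult:
  "bounded_bilinear ((**) :: real^'n^'m \<Rightarrow> real^'k^'n \<Rightarrow> real^'k^'m)"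
  unfolding bilinear_conv_bounded_bilinear[symmetric] bilinear_def
  by (auto intro!: linearI simp: matrix_matrix_mult_def vec_eq_iff sum.distrib algebra_simps
      sum_distrib_left)

interpretation matrix_mult: bounded_bilinear "(**) :: real^'n^'m \<Rightarrow> real^'k^'n \<Rightarrow> real^'k^'m"
  by (rule bounded_bilinear_matrix_mult)

lemmas matrix_ring_simps = matrix_mult.add_left matrix_mult.add_right matrix_mult.diff_left
  matrix_mult.diff_right matrix_mult.scaleR_left matrix_mult.scaleR_right

lemma transpose_add: "transpose (x + y) = transpose x + transpose (y :: real^'n^'m)"
  by (simp add: transpose_def vec_eq_iff)

lemma transpose_diff: "transpose (x - y) = transpose x - transpose (y :: real^'n^'m)"
  by (simp add: transpose_def vec_eq_iff)

lemma bounded_linear_transpose: "bounded_linear (transpose :: real^'n^'m \<Rightarrow> real^'m^'n)"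
  unfolding linear_conv_bounded_linear[symmetric]
  by (auto intro!: linearI simp: transpose_add transpose_scalar)

lemmas continuous_on_transpose [continuous_intros] =
  bounded_linear.continuous_on[OF bounded_linear_transpose]
lemmas continuous_on_matrix_mult [continuous_intros] = matrix_mult.continuous_on
lemmas tendsto_matrix_mult [tendsto_intros] = matrix_mult.tendsto

lemma bounded_linear_trace: "bounded_linear (trace :: real^'n^'n \<Rightarrow> real)"
  unfolding linear_conv_bounded_linear[symmetric]
  by (intro linearI) (simp_all add: trace_def sum.distrib sum_distrib_left)

lemmas continuous_on_trace [continuous_intros] =
  bounded_linear.continuous_on[OF bounded_linear_trace]
lemmas tendsto_trace [tendsto_intros] =
  bounded_linear.tendsto[OF bounded_linear_trace]

lemma trace_scaleR: "trace (c *\<^sub>R (x :: real^'n^'n)) = c * trace x"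
  by (simp add: trace_def sum_distrib_left)

lemma continuous_on_det [continuous_intros]:
  fixes f :: "'a::topological_space \<Rightarrow> real^'n^'n"
  assumes "continuous_on S f"
  shows "continuous_on S (\<lambda>x. det (f x))"
  unfolding det_def
  by (intro continuous_on_sum continuous_on_mult continuous_on_const continuous_on_prod
      continuous_on_component assms)

lemma tendsto_det [tendsto_intros]:
  fixes f :: "'a \<Rightarrow> real^'n^'n"
  assumes "(f \<longlongrightarrow> l) F"
  shows "((\<lambda>x. det (f x)) \<longlongrightarrow> det l) F"
  unfolding det_def
  by (intro tendsto_sum tendsto_mult tendsto_const tendsto_prod tendsto_vec_nth assms)

section \<open>Quadratic forms and the geometry of the cone\<close>

lemma inner_matrix_eq_trace: "(x :: real^'n^'m) \<bullet> y = trace (transpose x ** y)"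
  unfolding inner_vec_def trace_def matrix_matrix_mult_def transpose_def
  by (simp, subst sum.swap, simp)

lemma conj_entry: "(h ** s ** transpose h) $ i $ j = h $ i \<bullet> (s *v h $ j)"
  for h :: "real^'n^'m"
proof -
  have "(h ** s ** transpose h) $ i $ j = (\<Sum>k\<in>UNIV. \<Sum>l\<in>UNIV. h $ i $ l * s $ l $ k * h $ j $ k)"
    by (simp add: matrix_matrix_mult_def transpose_def sum_distrib_right)
  also have "\<dots> = h $ i \<bullet> (s *v h $ j)"
    by (subst sum.swap)
       (simp add: inner_vec_def matrix_vector_mult_def sum_distrib_left mult.assoc)
  finally show ?thesis .
qed

lemma conj_quadratic: "v \<bullet> ((g ** x ** transpose g) *v v) = (transpose g *v v) \<bullet> (x *v (transpose g *v v))"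
  for g :: "real^'n^'m"
proof -
  have "v \<bullet> (g *v w) = (transpose g *v v) \<bullet> w" for w :: "real^'n"
    by (simp add: dot_lmul_matrix)
  then show ?thesis
    by (simp only: matrix_vector_mul_assoc[symmetric])
qed

lemma norm_matrix_vector_le: "norm (x *v v) \<le> norm (x :: real^'n^'m) * norm v"
proof (rule power2_le_imp_le)
  have "(norm (x *v v))\<^sup>2 = (\<Sum>i\<in>UNIV. (x $ i \<bullet> v)\<^sup>2)"
    unfolding power2_norm_eq_inner inner_vec_def[of "x *v v"] matrix_vector_mul_component
    by (simp only: inner_real_def power2_eq_square)
  also have "\<dots> \<le> (\<Sum>i\<in>UNIV. (x $ i \<bullet> x $ i) * (v \<bullet> v))"
    by (intro sum_mono Cauchy_Schwarz_ineq)
  also have "\<dots> = (x \<bullet> x) * (v \<bullet> v)"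
    unfolding inner_vec_def[of x x] sum_distrib_right by (rule refl)
  also have "\<dots> = (norm x * norm v)\<^sup>2"
    unfolding power_mult_distrib power2_norm_eq_inner by (rule refl)
  finally show "(norm (x *v v))\<^sup>2 \<le> (norm x * norm v)\<^sup>2" .
qed simp

lemma quadratic_form_le: "\<bar>v \<bullet> (x *v v)\<bar> \<le> norm (x :: real^'n^'n) * (v \<bullet> v)"
proof -
  have "\<bar>v \<bullet> (x *v v)\<bar> \<le> norm v * norm (x *v v)" by (rule Cauchy_Schwarz_ineq2)
  also have "\<dots> \<le> norm v * (norm x * norm v)" by (intro mult_left_mono norm_matrix_vector_le norm_ge_zero)
  also have "\<dots> = norm x * (v \<bullet> v)" by (simp add: dot_square_norm power2_eq_square)
  finally show ?thesis .
qed

lemma subspace_sym_matrices: "subspace sym_matrices"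
  by (auto simp: subspace_def sym_matrices_def transpose_add transpose_scalar)
     (auto simp: transpose_def vec_eq_iff)

lemma sym_matricesD: "x \<in> sym_matrices \<Longrightarrow> transpose x = x"
  by (simp add: sym_matrices_def)

lemma closed_sym_matrices: "closed (sym_matrices :: (real^'n^'n) set)"
  by (rule closed_subspace[OF subspace_sym_matrices])

lemma pos_def_coneI:
  assumes "transpose x = x" "\<And>v. v \<noteq> 0 \<Longrightarrow> 0 < v \<bullet> (x *v v)"
  shows "x \<in> pos_def_cone"
  using assms by (simp add: pos_def_cone_def sym_matrices_def)

lemma pos_def_sym: "x \<in> pos_def_cone \<Longrightarrow> transpose x = x"
  by (simp add: pos_def_cone_def sym_matrices_def)

lemma pos_def_subset_sym: "pos_def_cone \<subseteq> sym_matrices"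
  by (auto simp: pos_def_cone_def)

lemma pos_defD: "x \<in> pos_def_cone \<Longrightarrow> v \<noteq> 0 \<Longrightarrow> 0 < v \<bullet> (x *v v)"
  by (simp add: pos_def_cone_def)

lemma pos_def_nonneg: "x \<in> pos_def_cone \<Longrightarrow> 0 \<le> v \<bullet> (x *v v)"
  by (cases "v = 0") (auto dest: pos_defD intro: less_imp_le)

lemma pos_def_mat_1 [simp]: "mat 1 \<in> pos_def_cone"
  by (rule pos_def_coneI) (auto)

lemma pos_def_add: "x \<in> pos_def_cone \<Longrightarrow> y \<in> pos_def_cone \<Longrightarrow> x + y \<in> pos_def_cone"
  by (auto intro!: pos_def_coneI add_pos_pos simp: pos_def_sym transpose_add
      matrix_vector_mult_add_rdistrib inner_add_right pos_defD)

lemma pos_def_scaleR: "x \<in> pos_def_cone \<Longrightarrow> 0 < c \<Longrightarrow> c *\<^sub>R x \<in> pos_def_cone"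
  by (auto intro!: pos_def_coneI simp: pos_def_sym transpose_scalar scaleR_matrix_vector_assoc[symmetric]
       pos_defD)

lemma convex_pos_def_cone: "convex pos_def_cone"
proof (rule convexI)
  fix x y :: "real^'n^'n" and u v :: real
  assume "x \<in> pos_def_cone" "y \<in> pos_def_cone" "0 \<le> u" "0 \<le> v" "u + v = 1"
  then show "u *\<^sub>R x + v *\<^sub>R y \<in> pos_def_cone"
    by (cases "u = 0"; cases "v = 0") (auto intro!: pos_def_add pos_def_scaleR)
qed

text \<open>The minimum of the quadratic form on the compact unit sphere serves as \<open>m\<close>;
  it plays the part of the smallest eigenvalue.\<close>

lemma pos_def_lower_bound:
  assumes x: "x \<in> pos_def_cone"
  shows "\<exists>m>0. \<forall>v. m * (v \<bullet> v) \<le> v \<bullet> (x *v v)"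
proof -
  have "continuous_on (sphere 0 1) (\<lambda>v. v \<bullet> (x *v v))" by (intro continuous_intros)
  moreover have "sphere (0::real^'a) 1 \<noteq> {}" by simp
  ultimately obtain w where w: "w \<in> sphere 0 1" "\<And>v. v \<in> sphere 0 1 \<Longrightarrow> w \<bullet> (x *v w) \<le> v \<bullet> (x *v v)"
    using continuous_attains_inf[of "sphere (0::real^'a) 1" "\<lambda>v. v \<bullet> (x *v v)"] by auto
  show ?thesis
  proof (intro exI conjI allI)
    show "0 < w \<bullet> (x *v w)" using w x by (intro pos_defD) auto
    fix v :: "real^'a"
    show "(w \<bullet> (x *v w)) * (v \<bullet> v) \<le> v \<bullet> (x *v v)"
    proof (cases "v = 0")
      case False
      define u where "u = (1 / norm v) *\<^sub>R v"
      have v: "v = norm v *\<^sub>R u" using False by (simp add: u_def)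
      have "w \<bullet> (x *v w) \<le> u \<bullet> (x *v u)" using False by (intro w) (simp add: u_def)
      then have "(w \<bullet> (x *v w)) * (norm v)\<^sup>2 \<le> (u \<bullet> (x *v u)) * (norm v)\<^sup>2"
        by (rule mult_right_mono) auto
      also have "\<dots> = v \<bullet> (x *v v)"
        by (simp add: u_def False matrix_vector_mult_scaleR power2_eq_square)
      finally show ?thesis by (simp add: power2_norm_eq_inner)
    qed auto
  qed
qed

lemma pos_def_perturb:
  assumes m: "\<And>v. m * (v \<bullet> v) \<le> v \<bullet> (x *v v)" and x: "transpose x = x"
    and z: "z \<in> sym_matrices" "norm (z - x) < m"
  shows "z \<in> pos_def_cone"
proof (rule pos_def_coneI)
  show "transpose z = z" using z by (simp add: sym_matrices_def)
  fix v :: "real^'a" assume v: "v \<noteq> 0"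
  have "v \<bullet> (z *v v) = v \<bullet> (x *v v) + v \<bullet> ((z - x) *v v)"
    by (simp add: matrix_vector_mult_diff_rdistrib inner_diff_right)
  moreover have "\<bar>v \<bullet> ((z - x) *v v)\<bar> \<le> norm (z - x) * (v \<bullet> v)"
    by (rule quadratic_form_le)
  moreover have "norm (z - x) * (v \<bullet> v) < m * (v \<bullet> v)"
    using z v by (intro mult_strict_right_mono) auto
  ultimately show "0 < v \<bullet> (z *v v)" using m[of v] by linarith
qed

text \<open>Carries linear identities from the cone to all symmetric matrices: a multiple of the
  identity that exceeds the norm moves any of them into the cone.\<close>

lemma pos_def_shift:
  assumes "z \<in> sym_matrices" "norm z < c"
  shows "z + c *\<^sub>R mat 1 \<in> pos_def_cone"
proof (rule pos_def_perturb[where m = c and x = "c *\<^sub>R mat 1"])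
  have "c *\<^sub>R mat 1 \<in> sym_matrices"
    using subspace_scale[OF subspace_sym_matrices, of "mat 1" c] by (simp add: sym_matrices_def)
  then show "z + c *\<^sub>R mat 1 \<in> sym_matrices"
    using assms subspace_add[OF subspace_sym_matrices] by blast
qed (use assms in \<open>auto simp: scaleR_matrix_vector_assoc[symmetric] transpose_scalar\<close>)

lemma openin_pos_def_cone: "openin (top_of_set sym_matrices) pos_def_cone"
  unfolding openin_euclidean_subtopology_iff
proof (intro conjI ballI pos_def_subset_sym)
  fix x :: "real^'n^'n" assume x: "x \<in> pos_def_cone"
  obtain m where m: "0 < m" "\<And>v. m * (v \<bullet> v) \<le> v \<bullet> (x *v v)" using pos_def_lower_bound[OF x] by blast
  show "\<exists>e>0. \<forall>x'\<in>sym_matrices. dist x' x < e \<longrightarrow> x' \<in> pos_def_cone"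
    using m pos_def_perturb[OF m(2) pos_def_sym[OF x]] by (auto simp: dist_norm)
qed

lemma invertible_mult_vector_nonzero:
  assumes g: "invertible (g :: real^'n^'n)" and v: "v \<noteq> 0" shows "g *v v \<noteq> 0"
proof
  assume "g *v v = 0"
  moreover obtain h where "h ** g = mat 1" using g unfolding invertible_def by blast
  ultimately have "mat 1 *v v = 0"
    using matrix_vector_mul_assoc[of h g v] by simp
  then show False using v by simp
qed

lemma pos_def_conj:
  fixes g x :: "real^'n^'n"
  assumes "invertible g" "x \<in> pos_def_cone"
  shows "g ** x ** transpose g \<in> pos_def_cone"
proof (rule pos_def_coneI)
  show "transpose (g ** x ** transpose g) = g ** x ** transpose g"
    by (simp only: matrix_transpose_mul pos_def_sym[OF assms(2)] transpose_transpose matrix_mul_assoc)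
  fix v :: "real^'n" assume "v \<noteq> 0"
  then have "transpose g *v v \<noteq> 0"
    by (intro invertible_mult_vector_nonzero transpose_invertible[OF assms(1)])
  from pos_defD[OF assms(2) this] show "0 < v \<bullet> ((g ** x ** transpose g) *v v)"
    by (simp only: conj_quadratic)
qed

text \<open>If the form vanished at some \<open>v\<close>, a short move from \<open>v\<close>
  against \<open>x *v v\<close>, which is nonzero by invertibility, would make it negative. This
  keeps limits with nonzero determinant inside the cone.\<close>

lemma psd_invertible_pos_def:
  fixes x :: "real^'n^'n"
  assumes sym: "transpose x = x" and nn: "\<And>v. 0 \<le> v \<bullet> (x *v v)" and inv: "invertible x"
  shows "x \<in> pos_def_cone"
proof (rule pos_def_coneI[OF sym])
  fix v :: "real^'n" assume v: "v \<noteq> 0"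
  show "0 < v \<bullet> (x *v v)"
  proof (rule ccontr)
    assume "\<not> ?thesis"
    then have 0: "v \<bullet> (x *v v) = 0" using nn[of v] by linarith
    define w B where "w = x *v v" and "B = w \<bullet> (x *v w)"
    have "w \<noteq> 0" using invertible_mult_vector_nonzero[OF inv v] by (simp add: w_def)
    then have ww: "w \<bullet> w > 0" by simp
    have B: "B \<ge> 0" unfolding B_def by (rule nn)
    \<comment> \<open>The added 1 avoids a division by zero and still gives
      \<open>t * B \<le> w \<bullet> w\<close>.\<close>
    define t where "t = (w \<bullet> w) / (B + 1)"
    have t: "t > 0" "t * B \<le> w \<bullet> w"
      using B ww by (auto simp: t_def field_simps)
    have "v \<bullet> (x *v w) = w \<bullet> w"
      using dot_lmul_matrix[of v x w] sym transpose_matrix_vector[of x v] by (simp add: w_def)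
    then have "(v - t *\<^sub>R w) \<bullet> (x *v (v - t *\<^sub>R w)) = t * (t * B - 2 * (w \<bullet> w))"
      using 0 by (simp add: matrix_vector_mult_diff_distrib matrix_vector_mult_scaleR inner_diff_left
          inner_diff_right w_def[symmetric] B_def[symmetric] algebra_simps inner_commute)
    also have "\<dots> < 0" using t(1) by (rule mult_pos_neg) (use t(2) ww in linarith)
    finally show False using nn[of "v - t *\<^sub>R w"] by simp
  qed
qed

lemma pos_def_invertible: "x \<in> pos_def_cone \<Longrightarrow> invertible x"
  unfolding invertible_left_inverse matrix_left_invertible_ker
  using pos_defD[of x] by force

lemma pos_def_square: "s \<in> pos_def_cone \<Longrightarrow> s ** s \<in> pos_def_cone"
  using pos_def_conj[of s "mat 1"] by (simp add: pos_def_sym pos_def_invertible)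

lemma trace_conj_ge:
  assumes "\<And>v. m * (v \<bullet> v) \<le> v \<bullet> (s *v v)"
  shows "m * (h \<bullet> h) \<le> trace (h ** s ** transpose h)"
  unfolding trace_def conj_entry inner_vec_def[of h h] sum_distrib_left
  by (intro sum_mono assms)

text \<open>With \<open>h = s - t\<close> the difference of squares is
  \<open>h ** s + t ** h\<close>. Pairing it with \<open>h\<close> under the trace gives two
  nonnegative terms, the first at least \<open>m\<close> times the squared norm of \<open>h\<close>.
  Both injectivity of squaring and continuity of the square root follow from this bound.\<close>

lemma square_diff_bound:
  assumes s: "transpose s = s" "\<And>v. m * (v \<bullet> v) \<le> v \<bullet> (s *v v)" and t: "t \<in> pos_def_cone"
  shows "m * norm (s - t) \<le> norm (s ** s - t ** t)"
proof -
  define h where "h = s - t"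
  have h: "transpose h = h" by (simp add: h_def transpose_diff s pos_def_sym[OF t])
  have "m * (h \<bullet> h) \<le> trace (h ** s ** transpose h)" by (rule trace_conj_ge[OF s(2)])
  moreover have "0 \<le> trace (h ** t ** transpose h)"
    using trace_conj_ge[of 0 t h] pos_def_nonneg[OF t] by simp
  moreover have "trace (h ** s ** h) + trace (h ** t ** h) = trace (h ** (s ** s - t ** t))"
  proof -
    have "trace (h ** s ** h) = trace (h ** (h ** s))" using trace_mul_sym[of "h ** s" h] by simp
    then have "trace (h ** s ** h) + trace (h ** t ** h) = trace (h ** (h ** s + t ** h))"
      by (simp add: matrix_ring_simps trace_add matrix_mul_assoc)
    also have "h ** s + t ** h = s ** s - t ** t" by (simp add: h_def matrix_ring_simps)
    finally show ?thesis .
  qed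
  moreover have "trace (h ** (s ** s - t ** t)) \<le> norm h * norm (s ** s - t ** t)"
    using norm_cauchy_schwarz[of h "s ** s - t ** t"] by (simp add: inner_matrix_eq_trace h)
  ultimately have "m * (norm h * norm h) \<le> norm h * norm (s ** s - t ** t)"
    by (simp add: h power2_norm_eq_inner[symmetric] power2_eq_square)
  then show ?thesis
    by (cases "norm h = 0") (auto simp: h_def[symmetric] mult.left_commute[of m])
qed

lemma pos_def_limit:
  fixes s :: "nat \<Rightarrow> real^'n^'n"
  assumes s: "\<And>n. s n \<in> pos_def_cone" and lim: "s \<longlonglongrightarrow> t" and inv: "invertible t"
  shows "t \<in> pos_def_cone"
proof (rule psd_invertible_pos_def[OF _ _ inv])
  have "t \<in> sym_matrices"
    using s pos_def_subset_sym by (intro closed_sequentially[OF closed_sym_matrices _ lim]) auto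
  then show "transpose t = t" by (rule sym_matricesD)
  show "0 \<le> v \<bullet> (t *v v)" for v
  proof (rule tendsto_lowerbound)
    show "((\<lambda>n. v \<bullet> (s n *v v)) \<longlongrightarrow> v \<bullet> (t *v v)) sequentially"
    proof (intro tendsto_inner tendsto_const)
      have "bounded_linear (\<lambda>x :: real^'n^'n. x *v v)"
        by (intro linear_conv_bounded_linear[THEN iffD1] linearI)
           (simp_all add: matrix_vector_mult_add_rdistrib scaleR_matrix_vector_assoc)
      then show "(\<lambda>n. s n *v v) \<longlonglongrightarrow> t *v v" by (rule bounded_linear.tendsto) (rule lim)
    qed
    show "\<forall>\<^sub>F n in sequentially. 0 \<le> v \<bullet> (s n *v v)" using pos_def_nonneg[OF s] by simp
  qed simp
qed

lemma square_inj_on_pos_def: "inj_on (\<lambda>s. s ** s) pos_def_cone"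
proof (rule inj_onI)
  fix s t :: "real^'n^'n" assume s: "s \<in> pos_def_cone" and t: "t \<in> pos_def_cone" and eq: "s ** s = t ** t"
  obtain m where m: "0 < m" "\<And>v. m * (v \<bullet> v) \<le> v \<bullet> (s *v v)" using pos_def_lower_bound[OF s] by blast
  have "m * norm (s - t) \<le> 0" using square_diff_bound[OF pos_def_sym[OF s] m(2) t] eq by simp
  then show "s = t" using m by (simp add: mult_le_0_iff)
qed

text \<open>The image is open by invariance of domain, closed by compactness and contains the
  identity, so connectedness of the cone makes it the whole cone.\<close>

lemma square_image_pos_def: "(\<lambda>s. s ** s) ` pos_def_cone = (pos_def_cone :: (real^'n^'n) set)"
proof -
  let ?T = "(\<lambda>s. s ** s) ` (pos_def_cone :: (real^'n^'n) set)"
  have sub: "?T \<subseteq> pos_def_cone" by (auto intro: pos_def_square)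
  have fim: "(\<lambda>s. s ** s) \<in> pos_def_cone \<rightarrow> (sym_matrices :: (real^'n^'n) set)"
    using sub pos_def_subset_sym by auto
  have cont: "continuous_on pos_def_cone (\<lambda>s :: real^'n^'n. s ** s)"
    by (intro matrix_mult.continuous_on continuous_on_id)
  have "openin (top_of_set sym_matrices) ?T"
    by (rule invariance_of_domain_subspaces[OF openin_pos_def_cone subspace_sym_matrices
        subspace_sym_matrices order_refl cont fim square_inj_on_pos_def])
  then have op: "openin (top_of_set pos_def_cone) ?T"
    by (rule openin_subset_trans[OF _ sub pos_def_subset_sym])
  have cl: "closedin (top_of_set pos_def_cone) ?T"
  proof -
    have "l \<in> ?T" if l: "l \<in> pos_def_cone" "l \<in> closure ?T" for l
    proof -
      obtain y where y: "\<And>n. y n \<in> ?T" "y \<longlonglongrightarrow> l" "l \<in> pos_def_cone"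
        using l(1) l(2)[unfolded closure_sequential] by auto
      from y(1) have "\<forall>n. \<exists>s. s \<in> pos_def_cone \<and> y n = s ** s" by auto
      from choice[OF this] obtain s where s: "\<And>n. s n \<in> pos_def_cone" "\<And>n. y n = s n ** s n" by blast
      \<comment> \<open>The roots of a convergent sequence are bounded because their squared norms
        are traces; a subsequence therefore converges.\<close>
      have "(norm (s n))\<^sup>2 = trace (y n)" for n
        by (simp add: power2_norm_eq_inner inner_matrix_eq_trace s pos_def_sym[OF s(1)])
      moreover have "Bseq (\<lambda>n. trace (y n))"
        using tendsto_trace[OF y(2)] by (intro convergent_imp_Bseq convergentI)
      ultimately obtain K where K: "\<And>n. \<bar>(norm (s n))\<^sup>2\<bar> \<le> K" by (auto simp: Bseq_def)
      have "norm (s n) \<le> sqrt K" for n using K[of n] by (intro real_le_rsqrt) simp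
      then have "bounded (range s)" by (auto intro: boundedI)
      then obtain t r where r: "strict_mono r" "(s \<circ> r) \<longlonglongrightarrow> t"
        using bounded_imp_convergent_subsequence by blast
      have "(\<lambda>n. (s \<circ> r) n ** (s \<circ> r) n) \<longlonglongrightarrow> t ** t" by (intro tendsto_intros r)
      moreover have "(\<lambda>n. (s \<circ> r) n ** (s \<circ> r) n) \<longlonglongrightarrow> l"
        using LIMSEQ_subseq_LIMSEQ[OF y(2) r(1)] by (simp add: o_def s(2))
      ultimately have tt: "t ** t = l" using LIMSEQ_unique by blast
      have "det t * det t \<noteq> 0"
        using pos_def_invertible[OF l(1)] by (simp add: tt[symmetric] invertible_det_nz det_mul)
      then have "t \<in> pos_def_cone"
        using pos_def_limit[OF _ r(2)] s(1) by (auto simp: invertible_det_nz)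
      then show "l \<in> ?T" using tt by auto
    qed
    then have "?T = pos_def_cone \<inter> closure ?T" using sub closure_subset[of ?T] by auto
    then show ?thesis using closedin_closed_Int[of "closure ?T" pos_def_cone] by simp
  qed
  have "connected (pos_def_cone :: (real^'n^'n) set)" by (rule convex_connected[OF convex_pos_def_cone])
  then have "?T = {} \<or> ?T = pos_def_cone" using op cl unfolding connected_clopen by (elim allE) auto
  moreover have "mat 1 \<in> ?T" by (rule image_eqI[of _ _ "mat 1"]) auto
  ultimately show ?thesis by blast
qed

lemma
  assumes y: "y \<in> pos_def_cone"
  shows mat_sqrt_pos_def: "mat_sqrt y \<in> pos_def_cone"
    and mat_sqrt_square: "mat_sqrt y ** mat_sqrt y = y"
proof -
  have "y \<in> (\<lambda>s. s ** s) ` pos_def_cone" using y by (simp only: square_image_pos_def)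
  then obtain s where s: "s \<in> pos_def_cone" "s ** s = y" by auto
  have "\<exists>!s. s \<in> pos_def_cone \<and> s ** s = y"
  proof (rule ex1I)
    show "s \<in> pos_def_cone \<and> s ** s = y" using s by simp
    fix t assume "t \<in> pos_def_cone \<and> t ** t = y"
    then show "t = s" using s by - (rule inj_onD[OF square_inj_on_pos_def], simp_all)
  qed
  from theI'[OF this] show "mat_sqrt y \<in> pos_def_cone" "mat_sqrt y ** mat_sqrt y = y"
    unfolding mat_sqrt_def by (rule conjunct1, rule conjunct2)
qed

lemma mat_sqrt_unique: "s \<in> pos_def_cone \<Longrightarrow> mat_sqrt (s ** s) = s"
  by (rule inj_onD[OF square_inj_on_pos_def])
     (simp_all add: mat_sqrt_pos_def mat_sqrt_square pos_def_square)

lemma continuous_on_mat_sqrt: "continuous_on pos_def_cone (mat_sqrt :: real^'n^'n \<Rightarrow> _)"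
  unfolding continuous_on_iff
proof (intro ballI allI impI)
  fix y :: "real^'n^'n" and e :: real assume y: "y \<in> pos_def_cone" and e: "0 < e"
  note s = mat_sqrt_pos_def[OF y]
  obtain m where m: "0 < m" "\<And>v. m * (v \<bullet> v) \<le> v \<bullet> (mat_sqrt y *v v)" using pos_def_lower_bound[OF s] by blast
  have "dist (mat_sqrt x) (mat_sqrt y) < e" if x: "x \<in> pos_def_cone" "dist x y < m * e" for x
  proof -
    have "m * norm (mat_sqrt y - mat_sqrt x) \<le> norm (y - x)"
      using square_diff_bound[OF pos_def_sym[OF s] m(2) mat_sqrt_pos_def[OF x(1)]]
      by (simp add: mat_sqrt_square x y)
    also have "\<dots> < m * e" using x by (simp add: dist_norm norm_minus_commute)
    finally show ?thesis using m by (simp add: dist_norm norm_minus_commute)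
  qed
  then show "\<exists>d>0. \<forall>x'\<in>pos_def_cone. dist x' y < d \<longrightarrow> dist (mat_sqrt x') (mat_sqrt y) < e"
    using m e by (intro exI[of _ "m * e"]) auto
qed

lemma det_pos_def:
  assumes "x \<in> pos_def_cone" shows "0 < det x"
proof -
  have "det x = (det (mat_sqrt x))\<^sup>2"
    using mat_sqrt_square[OF assms] det_mul[of "mat_sqrt x" "mat_sqrt x"] by (simp add: power2_eq_square)
  then show ?thesis using pos_def_invertible[OF assms] by (simp add: invertible_det_nz)
qed

lemma mat_sqrt_scaleR:
  assumes "y \<in> pos_def_cone" "0 < c"
  shows "mat_sqrt (c *\<^sub>R y) = sqrt c *\<^sub>R mat_sqrt y"
proof -
  have "c *\<^sub>R y = (sqrt c *\<^sub>R mat_sqrt y) ** (sqrt c *\<^sub>R mat_sqrt y)"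
    using assms by (simp add: matrix_ring_simps mat_sqrt_square)
  moreover have "sqrt c *\<^sub>R mat_sqrt y \<in> pos_def_cone"
    using assms by (intro pos_def_scaleR mat_sqrt_pos_def) auto
  ultimately show ?thesis by (simp add: mat_sqrt_unique)
qed

lemma mat_sqrt_mat_1 [simp]: "mat_sqrt (mat 1) = mat 1"
  using mat_sqrt_unique[OF pos_def_mat_1] by simp

section \<open>Logarithmic Cauchy functions on the cone\<close>

lemma additive_continuous_pos_real:
  fixes f :: "real \<Rightarrow> real"
  assumes add: "\<And>a b. 0 < a \<Longrightarrow> 0 < b \<Longrightarrow> f (a + b) = f a + f b"
    and cont: "continuous_on {0<..} f" and t: "0 < t"
  shows "f t = f 1 * t"
proof -
  have mult: "f (real (Suc n) * a) = real (Suc n) * f a" if "0 < a" for n a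
    using that
  proof (induction n)
    case (Suc n)
    have "f (real (Suc (Suc n)) * a) = f (real (Suc n) * a + a)" by (simp add: algebra_simps)
    also have "\<dots> = f (real (Suc n) * a) + f a" using Suc by (intro add) auto
    finally show ?case using Suc by (simp add: algebra_simps)
  qed simp
  have rat: "f (real (Suc k) / real (Suc n)) = f 1 * (real (Suc k) / real (Suc n))" for k n
  proof -
    have "f 1 = real (Suc n) * f (1 / real (Suc n))" using mult[of "1 / real (Suc n)" n] by simp
    moreover have "f (real (Suc k) / real (Suc n)) = real (Suc k) * f (1 / real (Suc n))"
      using mult[of "1 / real (Suc n)" k] by simp
    ultimately show ?thesis by simp
  qed
  define k where "k n = nat \<lfloor>real (Suc n) * t\<rfloor>" for n
  \<comment> \<open>The 1 added in the numerator keeps the approximation positive, since additivity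
    is assumed for positive arguments only.\<close>
  define r where "r n = real (Suc (k n)) / real (Suc n)" for n
  have bound: "\<bar>r n - t\<bar> \<le> 1 / real (Suc n)" for n
  proof -
    have "real (k n) = of_int \<lfloor>real (Suc n) * t\<rfloor>" using t by (simp add: k_def)
    then have "real (Suc n) * t \<le> real (Suc (k n))" "real (Suc (k n)) \<le> real (Suc n) * t + 1"
      by linarith+
    then have "\<bar>real (Suc (k n)) - real (Suc n) * t\<bar> \<le> 1" by linarith
    moreover have "r n - t = (real (Suc (k n)) - real (Suc n) * t) / real (Suc n)"
      by (simp add: r_def field_simps)
    ultimately show ?thesis by (simp add: abs_divide divide_right_mono del: of_nat_Suc)
  qed
  have "(\<lambda>n. r n - t) \<longlonglongrightarrow> 0"
    by (rule Lim_null_comparison[OF _ LIMSEQ_Suc[OF lim_inverse_n']])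
       (use bound in \<open>auto simp del: of_nat_Suc\<close>)
  then have r: "r \<longlonglongrightarrow> t" by (simp add: LIM_zero_iff)
  have "(\<lambda>n. f (r n)) \<longlonglongrightarrow> f t"
    using cont r t by (rule_tac continuous_on_tendsto_compose[OF cont r]) (auto simp: r_def)
  moreover have "(\<lambda>n. f (r n)) \<longlonglongrightarrow> f 1 * t"
    unfolding r_def rat unfolding r_def[symmetric] by (intro tendsto_intros r)
  ultimately show ?thesis by (rule LIMSEQ_unique)
qed

section \<open>Matrix units, transvections and diagonal matrices\<close>

definition matrix_unit :: "'n \<Rightarrow> 'n \<Rightarrow> real^'n^'n" where
  "matrix_unit i j = (\<chi> k l. if k = i \<and> l = j then 1 else 0)"

lemma matrix_unit_mult:
  "matrix_unit i j ** matrix_unit k l = (if j = k then matrix_unit i l else 0)"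
proof -
  have "(\<Sum>m\<in>UNIV. (if a = i \<and> m = j then 1 else 0) * (if m = k \<and> b = l then 1 else 0 :: real)) =
      (\<Sum>m\<in>UNIV. if m = j then (if a = i \<and> j = k \<and> b = l then 1 else 0) else 0)" for a b
    by (intro sum.cong) auto
  then show ?thesis by (auto simp: matrix_unit_def matrix_matrix_mult_def vec_eq_iff)
qed

lemma transpose_matrix_unit: "transpose (matrix_unit i j) = matrix_unit j i"
  by (auto simp: matrix_unit_def transpose_def vec_eq_iff)

lemma trace_matrix_unit_mult: "trace (matrix_unit i j ** y) = y $ j $ i"
proof -
  have "(\<Sum>m\<in>UNIV. (if a = i \<and> m = j then 1 else 0) * y $ m $ a) =
      (\<Sum>m\<in>UNIV. if m = j then (if a = i then y $ j $ i else 0) else 0)" for a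
    by (intro sum.cong) auto
  then show ?thesis by (simp add: trace_def matrix_unit_def matrix_matrix_mult_def)
qed

definition transvection :: "'n \<Rightarrow> 'n \<Rightarrow> real \<Rightarrow> real^'n^'n" where
  "transvection i j t = mat 1 + t *\<^sub>R matrix_unit i j"

lemma transpose_transvection: "transpose (transvection i j t) = transvection j i t"
  by (simp add: transvection_def transpose_add transpose_scalar transpose_matrix_unit)

lemma transvection_add:
  "i \<noteq> j \<Longrightarrow> transvection i j s ** transvection i j t = transvection i j (s + t)"
  by (simp add: transvection_def matrix_ring_simps matrix_unit_mult algebra_simps)

lemma transvection_0 [simp]: "transvection i j 0 = mat 1"
  by (simp add: transvection_def)

lemma invertible_transvection: "i \<noteq> j \<Longrightarrow> invertible (transvection i j t)"
  unfolding invertible_def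
  by (intro exI[of _ "transvection i j (- t)"]) (simp add: transvection_add)

lemma det_transvection: "i \<noteq> j \<Longrightarrow> det (transvection i j t) = 1"
proof -
  assume ij: "i \<noteq> j"
  have "transvection i j t = (\<chi> k. if k = i then row i (mat 1) + t *s row j (mat 1) else row k (mat 1))"
    using ij by (auto simp: transvection_def matrix_unit_def vec_eq_iff row_def mat_def)
  then show ?thesis using det_row_operation[OF ij, of "mat 1" t] by simp
qed

definition diag_matrix :: "('n \<Rightarrow> real) \<Rightarrow> real^'n^'n" where
  "diag_matrix d = (\<chi> i j. if i = j then d i else 0)"

lemma diag_matrix_mult: "diag_matrix d ** diag_matrix e = diag_matrix (\<lambda>i. d i * e i)"
proof -
  have "(\<Sum>k\<in>UNIV. (if a = k then d a else 0) * (if k = b then e k else 0)) =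
      (\<Sum>k\<in>UNIV. if k = a then (if a = b then d a * e a else 0) else 0)" for a b
    by (intro sum.cong) auto
  then show ?thesis by (simp add: diag_matrix_def matrix_matrix_mult_def vec_eq_iff)
qed

lemma diag_matrix_1 [simp]: "diag_matrix (\<lambda>_. 1) = mat 1"
  by (simp add: diag_matrix_def mat_def)

lemma det_diag_matrix: "det (diag_matrix d) = (\<Prod>i\<in>UNIV. d i)"
  by (subst det_diagonal) (simp_all add: diag_matrix_def)

lemma det_scaleR: "det (c *\<^sub>R x) = c ^ CARD('n) * det (x :: real^'n^'n)"
proof -
  have "c *\<^sub>R (mat 1 :: real^'n^'n) = diag_matrix (\<lambda>_. c)"
    by (auto simp: diag_matrix_def vec_eq_iff mat_def)
  then have "det (c *\<^sub>R (mat 1 :: real^'n^'n)) = c ^ CARD('n)" by (simp add: det_diag_matrix)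
  moreover have "c *\<^sub>R x = (c *\<^sub>R mat 1) ** x" by (simp add: matrix_mult.scaleR_left)
  ultimately show ?thesis by (simp only: det_mul)
qed

lemma diag_matrix_pos_def:
  fixes d :: "'n::finite \<Rightarrow> real"
  assumes "\<And>i. 0 < d i" shows "diag_matrix d \<in> pos_def_cone"
proof (rule pos_def_coneI)
  show "transpose (diag_matrix d) = diag_matrix d"
    by (auto simp: diag_matrix_def transpose_def vec_eq_iff)
  fix v :: "real^'n" assume "v \<noteq> 0"
  then obtain i where i: "v $ i \<noteq> 0" by (auto simp: vec_eq_iff)
  have eq: "v \<bullet> (diag_matrix d *v v) = (\<Sum>i\<in>UNIV. d i * (v $ i)\<^sup>2)"
  proof -
    have "(\<Sum>j\<in>UNIV. (if i = j then d i else 0) * v $ j) = (\<Sum>j\<in>UNIV. if j = i then d i * v $ i else 0)" for i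
      by (intro sum.cong) auto
    then show ?thesis
      by (simp add: inner_vec_def matrix_vector_mult_def diag_matrix_def power2_eq_square mult_ac)
  qed
  show "0 < v \<bullet> (diag_matrix d *v v)"
    unfolding eq using assms i
    by (intro sum_pos2[of _ i] mult_nonneg_nonneg zero_le_power2 mult_pos_pos less_imp_le[OF assms]) auto
qed

lemma mat_sqrt_diag_matrix:
  assumes "\<And>i. 0 < d i"
  shows "mat_sqrt (diag_matrix d) = diag_matrix (\<lambda>i. sqrt (d i))"
proof -
  have "diag_matrix d = diag_matrix (\<lambda>i. sqrt (d i)) ** diag_matrix (\<lambda>i. sqrt (d i))"
    using assms by (simp add: diag_matrix_mult less_imp_le)
  then show ?thesis using assms by (simp add: mat_sqrt_unique diag_matrix_pos_def)
qed

text \<open>Since \<open>y\<close> is the square of its root, its norm is at most a multiple of the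
  squared norm of the root, which is \<open>trace y\<close>. Sets of positive definite matrices with
  bounded trace are thus bounded.\<close>

lemma pos_def_norm_le_trace:
  "\<exists>K\<ge>0. \<forall>y\<in>(pos_def_cone :: (real^'n^'n) set). norm y \<le> K * trace y"
proof -
  have "\<exists>K\<ge>0. \<forall>(a :: real^'n^'n) (b :: real^'n^'n). norm (a ** b) \<le> norm a * norm b * K"
    by (rule bounded_bilinear.nonneg_bounded[OF bounded_bilinear_matrix_mult])
  then obtain K where K: "0 \<le> K" "\<And>(a :: real^'n^'n) (b :: real^'n^'n). norm (a ** b) \<le> norm a * norm b * K"
    by auto
  have "norm y \<le> K * trace y" if y: "y \<in> pos_def_cone" for y :: "real^'n^'n"
  proof -
    have "trace y = norm (mat_sqrt y) * norm (mat_sqrt y)"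
      using mat_sqrt_square[OF y] pos_def_sym[OF mat_sqrt_pos_def[OF y]]
        inner_matrix_eq_trace[of "mat_sqrt y" "mat_sqrt y"]
      by (simp add: dot_square_norm power2_eq_square)
    then show ?thesis using K(2)[of "mat_sqrt y" "mat_sqrt y"] mat_sqrt_square[OF y] by (simp add: mult_ac)
  qed
  then show ?thesis using K(1) by blast
qed

locale log_cauchy =
  fixes l :: "real^'n^'n \<Rightarrow> real"
  assumes cont: "continuous_on pos_def_cone l"
    and cauchy: "\<And>x y. x \<in> pos_def_cone \<Longrightarrow> y \<in> pos_def_cone \<Longrightarrow>
      l (mat_sqrt y ** x ** mat_sqrt y) = l x + l y"
begin

text \<open>The assumption \<open>cauchy\<close> concerns congruences by positive definite matrices
  only. The matrices whose congruence preserves the cone and changes \<open>l\<close> by a constant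
  are closed under products and inverses, which brings in non-symmetric matrices such as
  transvections.\<close>

definition conj_shift :: "real^'n^'n \<Rightarrow> real \<Rightarrow> bool" where
  "conj_shift g c \<longleftrightarrow> (\<forall>x\<in>pos_def_cone. g ** x ** transpose g \<in> pos_def_cone \<and>
     l (g ** x ** transpose g) = l x + c)"

lemma l_mat_1: "l (mat 1) = 0"
  using cauchy[of "mat 1" "mat 1"] by simp

lemma conj_shift_unique: "conj_shift g c \<Longrightarrow> conj_shift g d \<Longrightarrow> c = d"
  using pos_def_mat_1 unfolding conj_shift_def by fastforce

lemma conj_shift_mult:
  assumes g: "conj_shift g c" and h: "conj_shift h d"
  shows "conj_shift (g ** h) (c + d)"
  unfolding conj_shift_def
proof
  fix x :: "real^'n^'n" assume x: "x \<in> pos_def_cone"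
  have eq: "(g ** h) ** x ** transpose (g ** h) = g ** (h ** x ** transpose h) ** transpose g"
    by (simp only: matrix_transpose_mul matrix_mul_assoc)
  show "(g ** h) ** x ** transpose (g ** h) \<in> pos_def_cone \<and>
      l ((g ** h) ** x ** transpose (g ** h)) = l x + (c + d)"
    unfolding eq using g h x by (simp add: conj_shift_def)
qed

lemma conj_shift_pos_def:
  assumes a: "a \<in> pos_def_cone"
  shows "conj_shift a (l (a ** a))"
  unfolding conj_shift_def
proof
  fix x :: "real^'n^'n" assume x: "x \<in> pos_def_cone"
  show "a ** x ** transpose a \<in> pos_def_cone \<and> l (a ** x ** transpose a) = l x + l (a ** a)"
    using pos_def_conj[OF pos_def_invertible[OF a] x] cauchy[OF x pos_def_square[OF a]]
    by (simp add: mat_sqrt_unique[OF a] pos_def_sym[OF a])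
qed

lemma conj_shift_inverse:
  assumes g: "conj_shift g c" and h: "g ** h = mat 1"
  shows "conj_shift h (- c)"
  unfolding conj_shift_def
proof
  fix x :: "real^'n^'n" assume x: "x \<in> pos_def_cone"
  have inv: "invertible h" unfolding invertible_left_inverse using h by blast
  have y: "h ** x ** transpose h \<in> pos_def_cone" by (rule pos_def_conj[OF inv x])
  have "g ** (h ** x ** transpose h) ** transpose g = (g ** h) ** x ** transpose (g ** h)"
    by (simp only: matrix_transpose_mul matrix_mul_assoc)
  also have "\<dots> = x" by (simp add: h)
  finally have "l x = l (h ** x ** transpose h) + c" using g y by (auto simp: conj_shift_def)
  then show "h ** x ** transpose h \<in> pos_def_cone \<and> l (h ** x ** transpose h) = l x + - c"
    using y by simp
qed

text \<open>
  A transvection is, up to a diagonal factor, conjugate to a positive definite matrix, hence a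
  product of positive definite ones. The invariance of \<open>l\<close> follows because a diagonal conjugation
  turns the parameter \<open>t\<close> into \<open>2 * t\<close>.
\<close>

lemma conj_shift_transvection:
  assumes ij: "i \<noteq> j"
  shows "conj_shift (transvection i j t) 0"
proof -
  define d :: "real^'n^'n" where "d = mat 1 + matrix_unit i i"
  define d' :: "real^'n^'n" where "d' = mat 1 - (1/2) *\<^sub>R matrix_unit i i"
  have "d = diag_matrix (\<lambda>k. if k = i then 2 else 1)"
    by (auto simp: d_def diag_matrix_def vec_eq_iff matrix_unit_def mat_def)
  then have d: "d \<in> pos_def_cone" by (simp add: diag_matrix_pos_def)
  have dd': "d ** d' = mat 1"
    by (simp add: d_def d'_def matrix_ring_simps matrix_unit_mult)
  have scale: "d ** transvection i j s ** d' = transvection i j (2 * s)" for s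
    by (simp only: d_def d'_def transvection_def matrix_ring_simps matrix_unit_mult matrix_mul_lid
          matrix_mul_rid ij ij[symmetric] simp_thms if_True if_False matrix_mult.zero_left)
       (simp add: vec_eq_iff field_simps)
  have d_shift: "conj_shift d (l (d ** d))" by (rule conj_shift_pos_def[OF d])
  have d'_shift: "conj_shift d' (- l (d ** d))" by (rule conj_shift_inverse[OF d_shift dd'])
  have ex: "\<exists>c. conj_shift (transvection i j s) c" for s
  proof -
    \<comment> \<open>In \<open>a ** b\<close> the inner transvections cancel and leave
      \<open>transvection i j (- s) ** d ** transvection i j s\<close>. Multiplication by
      \<open>d'\<close>, the inverse of \<open>d\<close>, doubles the last parameter, so the total
      is \<open>- s + 2 * s = s\<close>.\<close>
    define a where "a = transvection i j (- s) ** mat 1 ** transpose (transvection i j (- s))"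
    define b where "b = transvection j i s ** d ** transpose (transvection j i s)"
    have "a \<in> pos_def_cone" "b \<in> pos_def_cone"
      unfolding a_def b_def using ij d
      by (metis pos_def_conj invertible_transvection pos_def_mat_1)+
    then have "conj_shift (a ** b ** d') (l (a ** a) + l (b ** b) + - l (d ** d))"
      by (intro conj_shift_mult conj_shift_pos_def d'_shift)
    moreover have "a ** b ** d' = transvection i j s"
    proof -
      have "a ** b = transvection i j (- s) ** (transvection j i (- s) ** transvection j i s) ** d ** transvection i j s"
        by (simp add: a_def b_def transpose_transvection matrix_mul_assoc)
      then have "a ** b ** d' = transvection i j (- s) ** (d ** transvection i j s ** d')"
        using ij by (simp add: transvection_add matrix_mul_assoc)
      then show ?thesis using ij by (simp add: scale transvection_add)
    qed
    ultimately show ?thesis by auto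
  qed
  then obtain c where c: "conj_shift (transvection i j t) c" by blast
  have "conj_shift (transvection i j (2 * t)) (c + c)"
    using conj_shift_mult[OF c c] ij by (simp add: transvection_add)
  moreover have "conj_shift (transvection i j (2 * t)) (l (d ** d) + c + - l (d ** d))"
    using conj_shift_mult[OF conj_shift_mult[OF d_shift c] d'_shift] by (simp add: scale)
  ultimately have "c = 0" using conj_shift_unique by fastforce
  then show ?thesis using c by simp
qed

lemma l_diag_mult:
  assumes "\<And>i. 0 < d i" "\<And>i. 0 < e i"
  shows "l (diag_matrix (\<lambda>i. d i * e i)) = l (diag_matrix d) + l (diag_matrix e)"
proof -
  have "mat_sqrt (diag_matrix e) ** diag_matrix d ** mat_sqrt (diag_matrix e) =
      diag_matrix (\<lambda>i. sqrt (e i) * d i * sqrt (e i))"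
    using assms by (simp add: mat_sqrt_diag_matrix diag_matrix_mult)
  also have "(\<lambda>i. sqrt (e i) * d i * sqrt (e i)) = (\<lambda>i. d i * e i)"
  proof
    fix i show "sqrt (e i) * d i * sqrt (e i) = d i * e i"
      using assms(2)[of i] by (metis mult.assoc mult.commute real_sqrt_mult_self abs_of_pos)
  qed
  finally show ?thesis using cauchy[of "diag_matrix d" "diag_matrix e"] assms
    by (simp add: diag_matrix_pos_def)
qed

definition single :: "'n \<Rightarrow> real \<Rightarrow> real^'n^'n" where
  "single i u = diag_matrix (\<lambda>k. if k = i then u else 1)"

text \<open>In the variable \<open>ln u\<close> the restriction of \<open>l\<close> to one diagonal
  direction is additive and continuous, hence linear.\<close>

lemma l_single:
  obtains p where "\<And>i u. 0 < u \<Longrightarrow> l (single i u) = p i * ln u"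
proof
  fix i :: 'n and u :: real assume u: "0 < u"
  define f where "f t = l (single i (exp t))" for t
  have add: "f (s + t) = f s + f t" for s t
    using l_diag_mult[of "\<lambda>k. if k = i then exp s else 1" "\<lambda>k. if k = i then exp t else 1"]
    by (simp add: f_def single_def exp_add if_distrib if_distribR cong: if_cong)
  have "continuous_on UNIV (\<lambda>t. single i (exp t))"
    unfolding single_def diag_matrix_def
  proof (intro continuous_on_vec_lambda)
    fix a b show "continuous_on UNIV (\<lambda>t :: real. if a = b then if a = i then exp t else 1 else 0)"
      by (cases "a = b"; cases "a = i") (auto intro!: continuous_intros)
  qed
  then have "continuous_on UNIV f"
    unfolding f_def by (rule continuous_on_compose2[OF cont]) (auto simp: single_def intro!: diag_matrix_pos_def)
  then have pos: "f t = f 1 * t" if "0 < t" for t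
    using additive_continuous_pos_real[of f t] that add continuous_on_subset by blast
  have f0: "f 0 = 0" using add[of 0 0] by simp
  have "f t = f 1 * t" for t
  proof (cases "0 < t")
    case False
    have "f (- t) + f t = 0" using add[of "- t" t] f0 by simp
    then show ?thesis using pos[of "- t"] f0 False by (cases "t = 0") auto
  qed (rule pos)
  from this[of "ln u"] show "l (single i u) = l (single i (exp 1)) * ln u"
    using u by (simp add: f_def)
qed

text \<open>The point is that all directions share one exponent. The identity with entries 1/2 added
  at \<open>(i, j)\<close> and \<open>(j, i)\<close> is symmetric in the two indices. Transvections
  reduce it to \<open>single j (3/4)\<close> and equally to \<open>single i (3/4)\<close>, where 3/4
  is the Schur complement \<open>1 - (1/2)\<^sup>2\<close>.\<close>

lemma l_diag:
  obtains p where "\<And>d. (\<And>i. 0 < d i) \<Longrightarrow> l (diag_matrix d) = p * ln (det (diag_matrix d))"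
proof -
  obtain p where p: "\<And>i u. 0 < u \<Longrightarrow> l (single i u) = p i * ln u" using l_single by blast
  have p_eq: "p i = p j" for i j
  proof (cases "i = j")
    case ij: False
    have half: "l (mat 1 + (1/2) *\<^sub>R (matrix_unit i j + matrix_unit j i)) = p j * ln (3/4)"
      if ij: "i \<noteq> j" for i j
    proof -
      have s: "single j (3/4) = mat 1 - (1/4) *\<^sub>R matrix_unit j j"
        by (auto simp: single_def diag_matrix_def vec_eq_iff matrix_unit_def mat_def)
      have "transvection j i (1/2) ** single j (3/4) ** transpose (transvection j i (1/2)) =
          mat 1 + (1/2) *\<^sub>R (matrix_unit i j + matrix_unit j i)"
        unfolding transpose_transvection s using ij
        by (simp add: transvection_def matrix_ring_simps matrix_unit_mult)
           (simp add: vec_eq_iff field_simps)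
      moreover have "single j (3/4) \<in> pos_def_cone" by (simp add: single_def diag_matrix_pos_def)
      ultimately show ?thesis
        using conj_shift_transvection[of j i "1/2"] ij p[of "3/4" j] by (auto simp: conj_shift_def)
    qed
    have "p j * ln (3/4) = p i * ln (3/4)"
      using half[of i j] half[of j i] ij by (simp add: add.commute)
    then show ?thesis by simp
  qed simp
  define i0 :: 'n where "i0 = undefined"
  show thesis
  proof (rule that[of "p i0"])
    fix d :: "'n \<Rightarrow> real" assume d: "\<And>i. 0 < d i"
    have "l (diag_matrix (\<lambda>k. if k \<in> A then d k else 1)) = (\<Sum>i\<in>A. p i0 * ln (d i))" if "finite A" for A
      using that
    proof induction
      case (insert a A)
      have "l (diag_matrix (\<lambda>k. (if k = a then d a else 1) * (if k \<in> A then d k else 1))) =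
          l (single a (d a)) + l (diag_matrix (\<lambda>k. if k \<in> A then d k else 1))"
        unfolding single_def using d by (intro l_diag_mult) auto
      moreover have "(\<lambda>k. (if k = a then d a else 1) * (if k \<in> A then d k else 1)) =
          (\<lambda>k. if k \<in> insert a A then d k else 1)" using insert by auto
      ultimately show ?case using insert p[OF d, of a a] p_eq[of a i0] by simp
    qed (simp add: l_mat_1)
    from this[of UNIV] show "l (diag_matrix d) = p i0 * ln (det (diag_matrix d))"
      using d by (simp add: det_diag_matrix ln_prod less_imp_neq[THEN not_sym] sum_distrib_left)
  qed
qed

text \<open>
  Among the positive definite matrices with the same \<open>det\<close> and \<open>l\<close>, one of minimal trace is
  diagonal, since otherwise a transvection decreases the trace.
\<close>

theorem l_eq_ln_det:
  obtains p where "\<And>x. x \<in> pos_def_cone \<Longrightarrow> l x = p * ln (det x)"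
proof -
  obtain p where p: "\<And>d. (\<And>i. 0 < d i) \<Longrightarrow> l (diag_matrix d) = p * ln (det (diag_matrix d))"
    using l_diag by blast
  obtain K where K: "0 \<le> K" "\<And>y :: real^'n^'n. y \<in> pos_def_cone \<Longrightarrow> norm y \<le> K * trace y"
    using pos_def_norm_le_trace by blast
  have "l x = p * ln (det x)" if x: "x \<in> pos_def_cone" for x
  proof -
    \<comment> \<open>Bounded because the trace controls the norm; closed because limits keep the
      nonzero determinant \<open>det x\<close> and so remain in the cone.\<close>
    define S where "S = {y \<in> pos_def_cone. trace y \<le> trace x \<and> det y = det x \<and> l y = l x}"
    have "bounded S"
      unfolding bounded_iff
    proof (intro exI ballI)
      fix y assume "y \<in> S"
      then have "norm y \<le> K * trace y" "trace y \<le> trace x" using K by (auto simp: S_def)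
      then show "norm y \<le> K * trace x" using K(1) by (meson mult_left_mono order_trans)
    qed
    moreover have "closed S"
      unfolding closed_sequential_limits
    proof (intro allI impI, elim conjE)
      fix y z assume y: "\<forall>n. y n \<in> S" and lim: "y \<longlonglongrightarrow> z"
      have yp: "\<And>n. y n \<in> pos_def_cone" and yt: "\<And>n. trace (y n) \<le> trace x"
        and yd: "\<And>n. det (y n) = det x" and yl: "\<And>n. l (y n) = l x" using y by (auto simp: S_def)
      have dz: "det z = det x"
        using tendsto_det[OF lim] unfolding yd by (simp add: LIMSEQ_const_iff)
      have z: "z \<in> pos_def_cone"
        using pos_def_limit[OF yp lim] det_pos_def[OF x] dz by (simp add: invertible_det_nz)
      have "(\<lambda>n. l (y n)) \<longlonglongrightarrow> l z"
        using continuous_on_tendsto_compose[OF cont lim z] yp by simp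
      then have "l z = l x" unfolding yl by (simp add: LIMSEQ_const_iff)
      moreover have "trace z \<le> trace x"
        using LIMSEQ_le_const2[OF tendsto_trace[OF lim]] yt by blast
      ultimately show "z \<in> S" using z dz by (simp add: S_def)
    qed
    ultimately have "compact S" by (simp add: compact_eq_bounded_closed)
    moreover have "S \<noteq> {}" using x by (auto simp: S_def)
    ultimately obtain y where y: "y \<in> S" and min: "\<And>z. z \<in> S \<Longrightarrow> trace y \<le> trace z"
      using continuous_attains_inf[of S trace] continuous_on_trace[OF continuous_on_id] by blast
    have yp: "y \<in> pos_def_cone" using y by (simp add: S_def)
    have diag_pos: "0 < y $ i $ i" for i
      using pos_defD[OF yp, of "axis i 1"]
      by (simp add: matrix_vector_mult_basis inner_axis' column_def)
    have off: "y $ i $ j = 0" if ij: "i \<noteq> j" for i j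
    proof (rule ccontr)
      assume nz: "y $ i $ j \<noteq> 0"
      \<comment> \<open>This value minimises the trace after the transvection, which is the
        quadratic \<open>trace y + 2 * s * y $ i $ j + s * s * y $ j $ j\<close>.\<close>
      define s where "s = - (y $ i $ j) / y $ j $ j"
      define z where "z = transvection i j s ** y ** transpose (transvection i j s)"
      have "z \<in> pos_def_cone" "l z = l y"
        using conj_shift_transvection[OF ij] yp by (auto simp: conj_shift_def z_def)
      moreover have "det z = det y"
        using ij by (simp add: z_def det_mul det_transvection)
      moreover have "trace z < trace y"
      proof -
        have yji: "y $ j $ i = y $ i $ j"
          using pos_def_sym[OF yp] by (metis transpose_def vec_lambda_beta)
        have "trace z = trace (transvection j i s ** transvection i j s ** y)"
          unfolding z_def transpose_transvection
          by (subst trace_mul_sym) (simp add: matrix_mul_assoc)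
        also have "\<dots> = trace y + 2 * s * y $ i $ j + s * s * y $ j $ j"
          by (simp add: transvection_def matrix_ring_simps matrix_unit_mult trace_add trace_scaleR
              trace_matrix_unit_mult yji distrib_left mult.assoc)
        also have "\<dots> = trace y - (y $ i $ j)\<^sup>2 / y $ j $ j"
          using diag_pos[of j] by (simp add: s_def power2_eq_square field_simps)
        also have "\<dots> < trace y" using nz diag_pos[of j] by simp
        finally show ?thesis .
      qed
      ultimately show False using min[of z] y by (force simp: S_def)
    qed
    have "y = diag_matrix (\<lambda>i. y $ i $ i)"
      using off by (auto simp: diag_matrix_def vec_eq_iff)
    then have "l y = p * ln (det y)" using p[of "\<lambda>i. y $ i $ i"] diag_pos by simp
    moreover have "l x = l y" "det x = det y" using y by (simp_all add: S_def)
    ultimately show ?thesis by simp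
  qed
  then show thesis by (rule that)
qed

end

section \<open>The functional equation: slow variation at the origin\<close>

lemma matrix_inv_pos_def:
  assumes "y \<in> pos_def_cone"
  shows matrix_inv_right_pos_def: "y ** matrix_inv y = mat 1"
    and matrix_inv_left_pos_def: "matrix_inv y ** y = mat 1"
    and "matrix_inv y \<in> pos_def_cone"
proof -
  have "\<exists>z. y ** z = mat 1 \<and> z ** y = mat 1"
    using pos_def_invertible[OF assms] by (simp add: invertible_def)
  from someI_ex[OF this] show right: "y ** matrix_inv y = mat 1" and left: "matrix_inv y ** y = mat 1"
    unfolding matrix_inv_def by (rule conjunct1, rule conjunct2)
  have "transpose (matrix_inv y) ** y = mat 1"
    using arg_cong[OF right, of transpose] by (simp add: matrix_transpose_mul pos_def_sym[OF assms])
  then have "transpose (matrix_inv y) ** (y ** matrix_inv y) = matrix_inv y"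
    by (simp only: matrix_mul_assoc matrix_mul_lid)
  then have sym: "transpose (matrix_inv y) = matrix_inv y" by (simp add: right)
  have inv: "invertible (matrix_inv y)" unfolding invertible_def using left right by blast
  have "matrix_inv y ** y ** transpose (matrix_inv y) \<in> pos_def_cone"
    by (rule pos_def_conj[OF inv assms])
  then show "matrix_inv y \<in> pos_def_cone" by (simp add: left sym)
qed

lemma pos_def_conj_sqrt:
  "x \<in> pos_def_cone \<Longrightarrow> u \<in> pos_def_cone \<Longrightarrow> mat_sqrt x ** u ** mat_sqrt x \<in> pos_def_cone"
  using pos_def_conj[of "mat_sqrt x" u] pos_def_invertible[OF mat_sqrt_pos_def] pos_def_sym[OF mat_sqrt_pos_def]
  by metis

lemma mat_sqrt_conj_surj:
  assumes u: "u \<in> pos_def_cone" and w: "w \<in> pos_def_cone"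
  obtains x where "x \<in> pos_def_cone" "mat_sqrt u ** x ** mat_sqrt u = w"
proof
  note s = mat_sqrt_pos_def[OF u]
  let ?i = "matrix_inv (mat_sqrt u)"
  show "?i ** w ** ?i \<in> pos_def_cone"
    using pos_def_conj[OF pos_def_invertible[OF matrix_inv_pos_def(3)[OF s]] w]
    by (simp add: pos_def_sym[OF matrix_inv_pos_def(3)[OF s]])
  have "mat_sqrt u ** (?i ** w ** ?i) ** mat_sqrt u = (mat_sqrt u ** ?i) ** w ** (?i ** mat_sqrt u)"
    by (simp only: matrix_mul_assoc)
  then show "mat_sqrt u ** (?i ** w ** ?i) ** mat_sqrt u = w"
    by (simp add: matrix_inv_pos_def[OF s])
qed

lemma tendsto_mat_sqrt:
  assumes "(f \<longlongrightarrow> y) F" "y \<in> pos_def_cone" "eventually (\<lambda>t. f t \<in> pos_def_cone) F"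
  shows "((\<lambda>t. mat_sqrt (f t)) \<longlongrightarrow> mat_sqrt y) F"
  by (rule continuous_on_tendsto_compose[OF continuous_on_mat_sqrt assms])

definition kummer_map :: "real^'n^'n \<Rightarrow> real^'n^'n \<Rightarrow> real^'n^'n" where
  "kummer_map x u = mat_sqrt (mat 1 + x) ** u ** mat_sqrt (mat 1 + x)"

lemma pos_def_1_add [simp]: "x \<in> pos_def_cone \<Longrightarrow> mat 1 + x \<in> pos_def_cone"
  by (simp add: pos_def_add)

lemma kummer_map_pos_def [simp]:
  "x \<in> pos_def_cone \<Longrightarrow> u \<in> pos_def_cone \<Longrightarrow> kummer_map x u \<in> pos_def_cone"
  by (simp add: kummer_map_def pos_def_conj_sqrt)

lemma det_conj_sqrt: "y \<in> pos_def_cone \<Longrightarrow> det (mat_sqrt y ** u ** mat_sqrt y) = det y * det u"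
  using arg_cong[OF mat_sqrt_square[of y], of det] by (simp add: det_mul)

lemma det_kummer_map: "x \<in> pos_def_cone \<Longrightarrow> det (kummer_map x u) = det (mat 1 + x) * det u"
  by (simp add: kummer_map_def det_conj_sqrt)

lemma kummer_map_scaleR: "kummer_map x (c *\<^sub>R u) = c *\<^sub>R kummer_map x u"
  by (simp add: kummer_map_def matrix_ring_simps)

lemma kummer_map_mat_1: "x \<in> pos_def_cone \<Longrightarrow> kummer_map x (mat 1) = mat 1 + x"
  by (simp add: kummer_map_def mat_sqrt_square)

lemma kummer_map_scalar:
  fixes u :: "real^'n^'n"
  assumes "0 < c" shows "kummer_map (c *\<^sub>R mat 1) u = (1 + c) *\<^sub>R u"
proof -
  have eq: "mat 1 + c *\<^sub>R mat 1 = (1 + c) *\<^sub>R (mat 1 :: real^'n^'n)" by (simp add: scaleR_add_left)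
  have "mat_sqrt (mat 1 + c *\<^sub>R mat 1 :: real^'n^'n) = sqrt (1 + c) *\<^sub>R mat 1"
    unfolding eq using assms by (simp add: mat_sqrt_scaleR)
  then show ?thesis using assms by (simp add: kummer_map_def matrix_ring_simps)
qed

text \<open>Makes \<open>(1 / c) *\<^sub>R w\<close> of the form \<open>mat 1 + u\<close> with
  \<open>u\<close> positive definite; \<open>c < 1\<close> does the same for the identity in place
  of \<open>w\<close>.\<close>

lemma pos_def_minus_scalar:
  assumes "w \<in> pos_def_cone"
  obtains c where "0 < c" "c < 1" "w - c *\<^sub>R mat 1 \<in> pos_def_cone"
proof -
  obtain m where m: "0 < m" "\<And>v. m * (v \<bullet> v) \<le> v \<bullet> (w *v v)"
    using pos_def_lower_bound[OF assms] by blast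
  define c where "c = min m 1 / 2"
  have c: "0 < c" "c < 1" "c < m" using m(1) by (auto simp: c_def)
  have "w - c *\<^sub>R mat 1 \<in> pos_def_cone"
  proof (rule pos_def_coneI)
    fix v :: "real^'a" assume "v \<noteq> 0"
    then have "c * (v \<bullet> v) < m * (v \<bullet> v)" using c by simp
    also have "\<dots> \<le> v \<bullet> (w *v v)" by (rule m)
    finally show "0 < v \<bullet> ((w - c *\<^sub>R mat 1) *v v)"
      by (simp add: matrix_vector_mult_diff_rdistrib scaleR_matrix_vector_assoc[symmetric] inner_diff_right)
  qed (simp add: transpose_diff transpose_scalar pos_def_sym[OF assms])
  with c show thesis by (intro that)
qed

lemma eventually_pos_def:
  assumes lim: "(f \<longlongrightarrow> y) F" and y: "y \<in> pos_def_cone" and sym: "eventually (\<lambda>t. f t \<in> sym_matrices) F"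
  shows "eventually (\<lambda>t. f t \<in> pos_def_cone) F"
proof -
  obtain e where e: "0 < e" "\<And>z. z \<in> sym_matrices \<Longrightarrow> dist z y < e \<Longrightarrow> z \<in> pos_def_cone"
    using openin_pos_def_cone y unfolding openin_euclidean_subtopology_iff by blast
  from tendstoD[OF lim e(1)] sym show ?thesis
    by eventually_elim (rule e(2))
qed

locale kummer_equation =
  fixes F G A D :: "real^'n^'n \<Rightarrow> real"
  assumes cont_G: "continuous_on pos_def_cone G" and cont_D: "continuous_on pos_def_cone D"
    and eq: "\<And>x u. x \<in> pos_def_cone \<Longrightarrow> u \<in> pos_def_cone \<Longrightarrow>
      F x + G (kummer_map x u) = A u + D (kummer_map u x)"
begin

text \<open>Exchanging \<open>x\<close> and \<open>u\<close> is a symmetry of the equation, so what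
  is shown for \<open>D\<close> also holds for \<open>G\<close>.\<close>

lemma swap: "kummer_equation A D F G"
  using cont_G cont_D eq by unfold_locales auto

lemma tendsto_G:
  "(f \<longlongrightarrow> y) H \<Longrightarrow> y \<in> pos_def_cone \<Longrightarrow> eventually (\<lambda>t. f t \<in> pos_def_cone) H \<Longrightarrow>
    ((\<lambda>t. G (f t)) \<longlongrightarrow> G y) H"
  by (rule continuous_on_tendsto_compose[OF cont_G])

lemma tendsto_D:
  "(f \<longlongrightarrow> y) H \<Longrightarrow> y \<in> pos_def_cone \<Longrightarrow> eventually (\<lambda>t. f t \<in> pos_def_cone) H \<Longrightarrow>
    ((\<lambda>t. D (f t)) \<longlongrightarrow> D y) H"
  by (rule continuous_on_tendsto_compose[OF cont_D])

text \<open>The equation at \<open>x\<close> and at \<open>t *\<^sub>R z\<close>, each with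
  \<open>u\<close> and with \<open>u'\<close>, eliminates \<open>F\<close> and \<open>A\<close>. As
  \<open>kummer_map (t *\<^sub>R z) u\<close> tends to \<open>u\<close>, continuity of
  \<open>G\<close> forces the difference of \<open>D\<close> near the apex to converge. It is
  essential that the limit does not contain \<open>z\<close>.\<close>

lemma mixed_limit:
  assumes x: "x \<in> pos_def_cone" and z: "z \<in> pos_def_cone" and u: "u \<in> pos_def_cone" and u': "u' \<in> pos_def_cone"
  shows "((\<lambda>t. D (t *\<^sub>R kummer_map u z) - D (t *\<^sub>R kummer_map u' z)) \<longlongrightarrow>
    D (kummer_map u x) - D (kummer_map u' x) - G (kummer_map x u) + G (kummer_map x u') + G u - G u')
    (at_right 0)"
proof -
  have lim: "((\<lambda>t. G (kummer_map (t *\<^sub>R z) w)) \<longlongrightarrow> G w) (at_right 0)" if w: "w \<in> pos_def_cone" for w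
  proof (rule tendsto_G[OF _ w])
    have "((\<lambda>t. mat 1 + t *\<^sub>R z) \<longlongrightarrow> mat 1 + 0 *\<^sub>R z) (at_right 0)" by (intro tendsto_intros)
    moreover have ev: "eventually (\<lambda>t. mat 1 + t *\<^sub>R z \<in> pos_def_cone) (at_right 0)"
      using eventually_at_right_less[of "0::real"]
      by eventually_elim (simp add: pos_def_add pos_def_scaleR z)
    ultimately have "((\<lambda>t. mat_sqrt (mat 1 + t *\<^sub>R z)) \<longlongrightarrow> mat_sqrt (mat 1)) (at_right 0)"
      by (intro tendsto_mat_sqrt) auto
    then have "((\<lambda>t. kummer_map (t *\<^sub>R z) w) \<longlongrightarrow> mat_sqrt (mat 1) ** w ** mat_sqrt (mat 1)) (at_right 0)"
      unfolding kummer_map_def by (intro tendsto_intros)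
    then show "((\<lambda>t. kummer_map (t *\<^sub>R z) w) \<longlongrightarrow> w) (at_right 0)" by simp
    show "eventually (\<lambda>t. kummer_map (t *\<^sub>R z) w \<in> pos_def_cone) (at_right 0)"
      using eventually_at_right_less[of "0::real"]
      by eventually_elim (simp add: pos_def_scaleR z w)
  qed
  have "((\<lambda>t. D (kummer_map u x) - D (kummer_map u' x) - G (kummer_map x u) + G (kummer_map x u')
      + G (kummer_map (t *\<^sub>R z) u) - G (kummer_map (t *\<^sub>R z) u')) \<longlongrightarrow>
    D (kummer_map u x) - D (kummer_map u' x) - G (kummer_map x u) + G (kummer_map x u') + G u - G u')
    (at_right 0)"
    by (intro tendsto_intros lim u u')
  then show ?thesis
  proof (rule Lim_transform_eventually)
    show "\<forall>\<^sub>F t in at_right 0. D (kummer_map u x) - D (kummer_map u' x) - G (kummer_map x u) + G (kummer_map x u')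
      + G (kummer_map (t *\<^sub>R z) u) - G (kummer_map (t *\<^sub>R z) u') =
       D (t *\<^sub>R kummer_map u z) - D (t *\<^sub>R kummer_map u' z)"
      using eventually_at_right_less[of "0::real"]
    proof eventually_elim
      case (elim t)
      then have tz: "t *\<^sub>R z \<in> pos_def_cone" by (intro pos_def_scaleR z)
      show ?case
        using eq[OF x u] eq[OF x u'] eq[OF tz u] eq[OF tz u'] unfolding kummer_map_scaleR by linarith
    qed
  qed
qed

definition log_part :: "real^'n^'n \<Rightarrow> real" where
  "log_part w = Lim (at_right 0) (\<lambda>t. D (t *\<^sub>R w) - D (t *\<^sub>R mat 1))"

text \<open>The limit of \<open>mixed_limit\<close> for \<open>x = z = mat 1\<close>,
  \<open>u = (1 / c) *\<^sub>R (w - c *\<^sub>R mat 1)\<close> and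
  \<open>u' = (1 / c - 1) *\<^sub>R mat 1\<close>. These are chosen so that \<open>mat 1 + u\<close>
  and \<open>mat 1 + u'\<close> are \<open>(1 / c) *\<^sub>R w\<close> and
  \<open>(1 / c) *\<^sub>R mat 1\<close>. For fixed \<open>c\<close> the formula is continuous in
  \<open>w\<close>.\<close>

definition log_part_shifted :: "real \<Rightarrow> real^'n^'n \<Rightarrow> real" where
  "log_part_shifted c w = D ((1 / c) *\<^sub>R w) - D ((1 / c) *\<^sub>R mat 1)
     - G (2 *\<^sub>R ((1 / c) *\<^sub>R (w - c *\<^sub>R mat 1))) + G (2 *\<^sub>R ((1 / c - 1) *\<^sub>R mat 1))
     + G ((1 / c) *\<^sub>R (w - c *\<^sub>R mat 1)) - G ((1 / c - 1) *\<^sub>R mat 1)"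

lemma filterlim_scale_at_right_0: "0 < c \<Longrightarrow> filterlim (\<lambda>t :: real. c * t) (at_right 0) (at_right 0)"
  unfolding filterlim_at
  by (auto intro!: tendsto_eq_intros eventually_at_right_less[THEN eventually_mono] simp: eventually_at_filter)

lemma log_part_shifted_limit:
  assumes w: "w - c *\<^sub>R mat 1 \<in> pos_def_cone" and c: "0 < c" "c < 1"
  shows "((\<lambda>t. D (t *\<^sub>R w) - D (t *\<^sub>R mat 1)) \<longlongrightarrow> log_part_shifted c w) (at_right 0)"
proof -
  define u where "u = (1 / c) *\<^sub>R (w - c *\<^sub>R mat 1)"
  define u' :: "real^'n^'n" where "u' = (1 / c - 1) *\<^sub>R mat 1"
  have u: "u \<in> pos_def_cone" using w c by (simp add: u_def pos_def_scaleR)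
  have u': "u' \<in> pos_def_cone" using c by (simp add: u'_def pos_def_scaleR)
  have 1: "mat 1 + u = (1 / c) *\<^sub>R w" using c by (simp add: u_def algebra_simps)
  have 2: "mat 1 + u' = (1 / c) *\<^sub>R mat 1" using c by (simp add: u'_def algebra_simps)
  have k: "kummer_map (mat 1) y = 2 *\<^sub>R y" for y :: "real^'n^'n"
    using kummer_map_scalar[of 1 y] by simp
  have "((\<lambda>t. D (t *\<^sub>R ((1 / c) *\<^sub>R w)) - D (t *\<^sub>R ((1 / c) *\<^sub>R mat 1))) \<longlongrightarrow> log_part_shifted c w) (at_right 0)"
    using mixed_limit[OF pos_def_mat_1 pos_def_mat_1 u u']
    unfolding kummer_map_mat_1[OF u] kummer_map_mat_1[OF u'] 1 2 k
    by (simp add: log_part_shifted_def u_def u'_def)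
  from filterlim_compose[OF this filterlim_scale_at_right_0[OF c(1)]] show ?thesis using c by simp
qed

lemma log_part_limit:
  assumes w: "w \<in> pos_def_cone"
  shows "((\<lambda>t. D (t *\<^sub>R w) - D (t *\<^sub>R mat 1)) \<longlongrightarrow> log_part w) (at_right 0)"
proof -
  obtain c where c: "0 < c" "c < 1" "w - c *\<^sub>R mat 1 \<in> pos_def_cone" by (rule pos_def_minus_scalar[OF w])
  note lim = log_part_shifted_limit[OF c(3,1,2)]
  have "log_part w = log_part_shifted c w"
    unfolding log_part_def by (rule tendsto_Lim[OF trivial_limit_at_right_real lim])
  with lim show ?thesis by (simp only:)
qed

lemma log_part_eqI:
  assumes w: "w \<in> pos_def_cone" and "((\<lambda>t. D (t *\<^sub>R w) - D (t *\<^sub>R mat 1)) \<longlongrightarrow> L) (at_right 0)"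
  shows "log_part w = L"
  using tendsto_unique[OF trivial_limit_at_right_real log_part_limit[OF w] assms(2)] .

text \<open>A single \<open>c\<close> works for all matrices near \<open>v\<close>, and there
  \<open>log_part\<close> equals the explicit expression \<open>log_part_shifted c\<close>.\<close>

lemma continuous_log_part: "continuous_on pos_def_cone log_part"
  unfolding continuous_on_sequentially
proof (intro allI ballI impI, elim conjE)
  fix w :: "nat \<Rightarrow> real^'n^'n" and v assume v: "v \<in> pos_def_cone" and w: "\<forall>n. w n \<in> pos_def_cone" and lim: "w \<longlonglongrightarrow> v"
  obtain c where c: "0 < c" "c < 1" "v - c *\<^sub>R mat 1 \<in> pos_def_cone" by (rule pos_def_minus_scalar[OF v])
  have lim': "(\<lambda>n. w n - c *\<^sub>R mat 1) \<longlonglongrightarrow> v - c *\<^sub>R mat 1" by (intro tendsto_intros lim)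
  have ev: "eventually (\<lambda>n. w n - c *\<^sub>R mat 1 \<in> pos_def_cone) sequentially"
    using w by (intro eventually_pos_def[OF lim' c(3)])
      (auto simp: sym_matrices_def transpose_diff transpose_scalar pos_def_sym)
  have "(\<lambda>n. log_part_shifted c (w n)) \<longlonglongrightarrow> log_part_shifted c v"
    unfolding log_part_shifted_def
    by (intro tendsto_add tendsto_diff tendsto_const tendsto_G tendsto_D tendsto_scaleR lim' lim pos_def_scaleR v c(3))
       (use c w in \<open>auto intro!: pos_def_scaleR eventually_mono[OF ev]\<close>)
  moreover have "eventually (\<lambda>n. log_part_shifted c (w n) = log_part (w n)) sequentially"
    using ev by eventually_elim (use w in \<open>simp add: log_part_eqI[OF _ log_part_shifted_limit[OF _ c(1,2)]]\<close>)
  ultimately have "(\<lambda>n. log_part (w n)) \<longlonglongrightarrow> log_part_shifted c v"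
    by (rule Lim_transform_eventually)
  moreover have "log_part v = log_part_shifted c v"
    by (rule log_part_eqI[OF v log_part_shifted_limit[OF c(3,1,2)]])
  ultimately show "(log_part \<circ> w) \<longlonglongrightarrow> log_part v" by (simp add: o_def)
qed

lemma log_part_scaleR:
  assumes z: "z \<in> pos_def_cone" and s: "0 < s"
  shows "log_part (s *\<^sub>R z) = log_part z + log_part (s *\<^sub>R mat 1)"
proof (rule log_part_eqI[OF pos_def_scaleR[OF z s]])
  have "((\<lambda>t. D ((s * t) *\<^sub>R z) - D ((s * t) *\<^sub>R mat 1)) \<longlongrightarrow> log_part z) (at_right 0)"
    by (rule filterlim_compose[OF log_part_limit[OF z] filterlim_scale_at_right_0[OF s]])
  from tendsto_add[OF this log_part_limit[OF pos_def_scaleR[OF pos_def_mat_1 s]]]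
  show "((\<lambda>t. D (t *\<^sub>R s *\<^sub>R z) - D (t *\<^sub>R mat 1)) \<longlongrightarrow> log_part z + log_part (s *\<^sub>R mat 1)) (at_right 0)"
    by (simp add: mult.commute)
qed

text \<open>The limit in \<open>mixed_limit\<close> is independent of the matrix that is shrunk to
  0. Hence \<open>log_part (kummer_map u y) - log_part (2 *\<^sub>R y)\<close> agrees for
  \<open>y = z\<close> and \<open>y = mat 1\<close>; the scaling by 2 is
  \<open>kummer_map (mat 1)\<close>.\<close>

lemma log_part_cauchy_1:
  assumes u: "u \<in> pos_def_cone" and z: "z \<in> pos_def_cone"
  shows "log_part (kummer_map u z) = log_part (mat 1 + u) + log_part z"
proof -
  have k: "kummer_map (mat 1) y = 2 *\<^sub>R y" for y :: "real^'n^'n"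
    using kummer_map_scalar[of 1 y] by simp
  have diff: "log_part (kummer_map u y) - log_part (2 *\<^sub>R y) =
      D (kummer_map u (mat 1)) - D (kummer_map (mat 1) (mat 1)) - G (kummer_map (mat 1) u)
       + G (kummer_map (mat 1) (mat 1)) + G u - G (mat 1)" if y: "y \<in> pos_def_cone" for y
  proof (rule tendsto_unique[OF trivial_limit_at_right_real _ mixed_limit[OF pos_def_mat_1 y u pos_def_mat_1]])
    have "2 *\<^sub>R y \<in> pos_def_cone" using y by (simp add: pos_def_scaleR)
    from tendsto_diff[OF log_part_limit[OF kummer_map_pos_def[OF u y]] log_part_limit[OF this]]
    show "((\<lambda>t. D (t *\<^sub>R kummer_map u y) - D (t *\<^sub>R kummer_map (mat 1) y)) \<longlongrightarrow>
        log_part (kummer_map u y) - log_part (2 *\<^sub>R y)) (at_right 0)"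
      unfolding k by (simp del: scaleR_scaleR)
  qed
  from diff[OF z] diff[OF pos_def_mat_1] show ?thesis
    using log_part_scaleR[OF z, of 2] log_part_scaleR[OF pos_def_mat_1, of 2]
    by (simp add: kummer_map_mat_1[OF u])
qed

text \<open>Every positive definite \<open>y\<close> is a multiple of some \<open>mat 1 + u\<close>,
  and the constant that scaling adds to \<open>log_part\<close> cancels.\<close>

lemma log_cauchy_log_part: "log_cauchy log_part"
proof (unfold_locales, rule continuous_log_part)
  fix x y :: "real^'n^'n" assume x: "x \<in> pos_def_cone" and y: "y \<in> pos_def_cone"
  obtain c where c: "0 < c" "c < 1" "y - c *\<^sub>R mat 1 \<in> pos_def_cone" by (rule pos_def_minus_scalar[OF y])
  define u where "u = (1 / c) *\<^sub>R (y - c *\<^sub>R mat 1)"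
  have u: "u \<in> pos_def_cone" using c by (simp add: u_def pos_def_scaleR)
  have 1: "mat 1 + u = (1 / c) *\<^sub>R y" using c by (simp add: u_def algebra_simps)
  have "kummer_map u x = (1 / c) *\<^sub>R (mat_sqrt y ** x ** mat_sqrt y)"
    using c y by (simp add: kummer_map_def 1 mat_sqrt_scaleR matrix_ring_simps)
  then show "log_part (mat_sqrt y ** x ** mat_sqrt y) = log_part x + log_part y"
    using log_part_cauchy_1[OF u x] c log_part_scaleR[OF y, of "1 / c"]
      log_part_scaleR[OF pos_def_conj_sqrt[OF y x], of "1 / c"]
    by (simp add: 1)
qed

lemma slow_variation:
  obtains q where "\<And>w. w \<in> pos_def_cone \<Longrightarrow>
    ((\<lambda>t. D (t *\<^sub>R w) - D (t *\<^sub>R mat 1)) \<longlongrightarrow> q * ln (det w)) (at_right 0)"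
proof -
  obtain q where q: "\<And>x. x \<in> pos_def_cone \<Longrightarrow> log_part x = q * ln (det x)"
    using log_cauchy.l_eq_ln_det[OF log_cauchy_log_part] by blast
  have "((\<lambda>t. D (t *\<^sub>R w) - D (t *\<^sub>R mat 1)) \<longlongrightarrow> q * ln (det w)) (at_right 0)"
    if "w \<in> pos_def_cone" for w
    using log_part_limit[OF that] by (simp only: q[OF that])
  then show thesis by (rule that)
qed

end

section \<open>The functional equation: slowly varying solutions\<close>

text \<open>The condition \<open>4 * B \<le> A\<close> makes the discriminant nonnegative, and the
  larger root is taken. It supplies the parameters with which \<open>ray\<close> reaches two
  prescribed points of a ray.\<close>

lemma quadratic_root_split:
  fixes A B :: real
  assumes "0 < B" "4 * B \<le> A"
  obtains s where "0 < s" "s < A" "s - s\<^sup>2 / A = B"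
proof -
  define d where "d = sqrt (A\<^sup>2 - 4 * A * B)"
  have A: "0 < A" using assms by simp
  have nn: "0 \<le> A\<^sup>2 - 4 * A * B"
  proof -
    have "A * (4 * B) \<le> A * A" using A assms by (intro mult_left_mono) auto
    then show ?thesis by (simp add: power2_eq_square)
  qed
  then have d2: "d\<^sup>2 = A\<^sup>2 - 4 * A * B" and d: "0 \<le> d" by (simp_all add: d_def)
  have "d\<^sup>2 < A\<^sup>2" using A assms d2 by simp
  then have dA: "d < A" using A by (simp add: power2_less_imp_less)
  define s where "s = (A + d) / 2"
  have "s\<^sup>2 = (A\<^sup>2 + 2 * A * d + d\<^sup>2) / 4" by (simp add: s_def power2_eq_square field_simps)
  also have "\<dots> = A * s - A * B" unfolding d2 by (simp add: s_def power2_eq_square field_simps)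
  finally have "s - s\<^sup>2 / A = B" using A by (simp add: field_simps power2_eq_square)
  moreover have "0 < s" "s < A" using A d dA by (auto simp: s_def)
  ultimately show thesis by (intro that)
qed

locale slow_kummer_equation = kummer_equation F G A D
  for F G A D :: "real^'n^'n \<Rightarrow> real" +
  assumes slow_G: "\<And>w. w \<in> pos_def_cone \<Longrightarrow>
      ((\<lambda>t. G (t *\<^sub>R w) - G (t *\<^sub>R mat 1)) \<longlongrightarrow> 0) (at_right 0)"
    and slow_D: "\<And>w. w \<in> pos_def_cone \<Longrightarrow>
      ((\<lambda>t. D (t *\<^sub>R w) - D (t *\<^sub>R mat 1)) \<longlongrightarrow> 0) (at_right 0)"
begin

lemma slow_G': "u \<in> pos_def_cone \<Longrightarrow> v \<in> pos_def_cone \<Longrightarrow>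
    ((\<lambda>t. G (t *\<^sub>R u) - G (t *\<^sub>R v)) \<longlongrightarrow> 0) (at_right 0)"
  using tendsto_diff[OF slow_G[of u] slow_G[of v]] by simp

lemma slow_D': "u \<in> pos_def_cone \<Longrightarrow> v \<in> pos_def_cone \<Longrightarrow>
    ((\<lambda>t. D (t *\<^sub>R u) - D (t *\<^sub>R v)) \<longlongrightarrow> 0) (at_right 0)"
  using tendsto_diff[OF slow_D[of u] slow_D[of v]] by simp

text \<open>Slow variation of \<open>D\<close> makes the limit in \<open>mixed_limit\<close> equal
  to 0. With \<open>u' = t *\<^sub>R mat 1\<close> and \<open>t\<close> tending to 0, the term
  \<open>D (kummer_map u' x)\<close> becomes \<open>D x\<close>, while the two remaining terms in
  \<open>u'\<close> cancel by slow variation of \<open>G\<close>.\<close>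

lemma difference_equation:
  assumes x: "x \<in> pos_def_cone" and u: "u \<in> pos_def_cone"
  shows "G (kummer_map x u) - G u = D (kummer_map u x) - D x"
proof -
  have "D (kummer_map u x) - D ((1 + t) *\<^sub>R x) = G (kummer_map x u) - G u
      - (G (t *\<^sub>R (mat 1 + x)) - G (t *\<^sub>R mat 1))" if t: "0 < t" for t
  proof -
    have u': "t *\<^sub>R mat 1 \<in> pos_def_cone" using t by (simp add: pos_def_scaleR)
    have "D (kummer_map u x) - D (kummer_map (t *\<^sub>R mat 1) x) - G (kummer_map x u)
        + G (kummer_map x (t *\<^sub>R mat 1)) + G u - G (t *\<^sub>R mat 1) = 0"
      using tendsto_unique[OF trivial_limit_at_right_real mixed_limit[OF x x u u']
        slow_D'[OF kummer_map_pos_def[OF u x] kummer_map_pos_def[OF u' x]]] .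
    then show ?thesis
      unfolding kummer_map_scalar[OF t] kummer_map_scaleR kummer_map_mat_1[OF x] by linarith
  qed
  then have ev: "eventually (\<lambda>t. D (kummer_map u x) - D ((1 + t) *\<^sub>R x) = G (kummer_map x u) - G u
      - (G (t *\<^sub>R (mat 1 + x)) - G (t *\<^sub>R mat 1))) (at_right 0)"
    using eventually_at_right_less[of "0::real"] by (rule eventually_mono[rotated])
  have "((\<lambda>t. (1 + t) *\<^sub>R x) \<longlongrightarrow> (1 + 0) *\<^sub>R x) (at_right 0)" by (intro tendsto_intros)
  then have "((\<lambda>t. D ((1 + t) *\<^sub>R x)) \<longlongrightarrow> D x) (at_right 0)"
    using eventually_at_right_less[of "0::real"] x
    by (intro tendsto_D) (auto elim!: eventually_mono intro!: pos_def_scaleR)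
  then have "((\<lambda>t. D (kummer_map u x) - D ((1 + t) *\<^sub>R x)) \<longlongrightarrow> D (kummer_map u x) - D x) (at_right 0)"
    by (intro tendsto_intros)
  from Lim_transform_eventually[OF this ev]
  have "((\<lambda>t. G (kummer_map x u) - G u - (G (t *\<^sub>R (mat 1 + x)) - G (t *\<^sub>R mat 1)))
      \<longlongrightarrow> D (kummer_map u x) - D x) (at_right 0)" .
  moreover have "((\<lambda>t. G (kummer_map x u) - G u - (G (t *\<^sub>R (mat 1 + x)) - G (t *\<^sub>R mat 1)))
      \<longlongrightarrow> G (kummer_map x u) - G u - 0) (at_right 0)"
    using x by (intro tendsto_intros slow_G) simp
  ultimately show ?thesis using tendsto_unique[OF trivial_limit_at_right_real] by fastforce
qed

lemma scalar_x:
  assumes "0 < c" "u \<in> pos_def_cone"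
  shows "G ((1 + c) *\<^sub>R u) - G u = D (c *\<^sub>R (mat 1 + u)) - D (c *\<^sub>R mat 1)"
  using difference_equation[OF pos_def_scaleR[OF pos_def_mat_1 assms(1)] assms(2)]
  unfolding kummer_map_scalar[OF assms(1)] kummer_map_scaleR kummer_map_mat_1[OF assms(2)] .

lemma scalar_u:
  assumes "0 < c" "x \<in> pos_def_cone"
  shows "D ((1 + c) *\<^sub>R x) - D x = G (c *\<^sub>R (mat 1 + x)) - G (c *\<^sub>R mat 1)"
  using difference_equation[OF assms(2) pos_def_scaleR[OF pos_def_mat_1 assms(1)]]
  unfolding kummer_map_scalar[OF assms(1)] kummer_map_scaleR kummer_map_mat_1[OF assms(2)] by linarith

text \<open>Uses \<open>scalar_u\<close> and \<open>scalar_x\<close> twice each. The factor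
  \<open>k / (1 + k)\<close> is the one for which
  \<open>(c + c * k) *\<^sub>R (mat 1 + (k / (1 + k)) *\<^sub>R u)\<close> equals
  \<open>c *\<^sub>R (mat 1 + k *\<^sub>R (mat 1 + u))\<close>, so that the value of
  \<open>G\<close> there cancels. What matters is that the right-hand side does not contain
  \<open>u\<close>.\<close>

lemma ray_aux:
  assumes c: "0 < c" and k: "0 < k" and u: "u \<in> pos_def_cone"
  shows "G ((1 + k + c * k) *\<^sub>R u) - G ((1 + k) *\<^sub>R u)
      - (D ((k / (1 + k) + c * k) *\<^sub>R u) - D ((k / (1 + k)) *\<^sub>R u)) =
    G ((c + c * k) *\<^sub>R mat 1) - G (c *\<^sub>R mat 1) - D ((k + c * k) *\<^sub>R mat 1) + D (k *\<^sub>R mat 1)"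
proof -
  let ?y = "k *\<^sub>R (mat 1 + u)" and ?r = "k / (1 + k)"
  have y: "?y \<in> pos_def_cone" using k u by (simp add: pos_def_scaleR)
  have ru: "?r *\<^sub>R u \<in> pos_def_cone" using k u by (simp add: pos_def_scaleR)
  have ck: "0 < c * k" "0 < k + c * k" "0 < c + c * k" using c k by (auto intro: add_pos_pos)
  have 1: "D ((k + c * k) *\<^sub>R (mat 1 + u)) - D ?y = G (c *\<^sub>R (mat 1 + ?y)) - G (c *\<^sub>R mat 1)"
    using scalar_u[OF c y] by (simp add: algebra_simps)
  have 2: "G ((1 + k + c * k) *\<^sub>R u) - G u = D ((k + c * k) *\<^sub>R (mat 1 + u)) - D ((k + c * k) *\<^sub>R mat 1)"
    using scalar_x[OF ck(2) u] by (simp add: add.assoc)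
  have 3: "G ((1 + k) *\<^sub>R u) - G u = D ?y - D (k *\<^sub>R mat 1)" by (rule scalar_x[OF k u])
  have r: "(c + c * k) * ?r = c * k" using k by (simp add: field_simps)
  have 4: "D ((?r + c * k) *\<^sub>R u) - D (?r *\<^sub>R u) = G (c *\<^sub>R (mat 1 + ?y)) - G ((c + c * k) *\<^sub>R mat 1)"
  proof -
    have e1: "(1 + (c + c * k)) *\<^sub>R (?r *\<^sub>R u) = (?r + c * k) *\<^sub>R u"
    proof -
      have "(1 + (c + c * k)) * ?r = ?r + c * k" unfolding distrib_right[of 1] r by simp
      then show ?thesis by (simp only: scaleR_scaleR)
    qed
    have e2: "(c + c * k) *\<^sub>R (mat 1 + ?r *\<^sub>R u) = c *\<^sub>R (mat 1 + ?y)"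
      unfolding scaleR_add_right scaleR_scaleR r by (simp add: scaleR_add_left)
    from scalar_u[OF ck(3) ru] show ?thesis unfolding e1 e2 .
  qed
  from 1 2 3 4 show ?thesis by linarith
qed

text \<open>Replacing \<open>u\<close> by \<open>t *\<^sub>R u\<close> does not affect the constant
  in \<open>ray_aux\<close>, but slow variation sends the left-hand side to 0, so the constant is
  0.\<close>

lemma ray:
  assumes c: "0 < c" and k: "0 < k" and u: "u \<in> pos_def_cone"
  shows "G ((1 + k + c * k) *\<^sub>R u) - G ((1 + k) *\<^sub>R u) =
    D ((k / (1 + k) + c * k) *\<^sub>R u) - D ((k / (1 + k)) *\<^sub>R u)"
proof -
  let ?C = "G ((c + c * k) *\<^sub>R mat 1) - G (c *\<^sub>R mat 1) - D ((k + c * k) *\<^sub>R mat 1) + D (k *\<^sub>R mat 1)"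
  have pos: "0 < 1 + k + c * k" "0 < 1 + k" "0 < k / (1 + k) + c * k" "0 < k / (1 + k)"
    using c k by (auto intro!: add_pos_pos)
  let ?f = "\<lambda>t. G (t *\<^sub>R (1 + k + c * k) *\<^sub>R u) - G (t *\<^sub>R (1 + k) *\<^sub>R u)
      - (D (t *\<^sub>R (k / (1 + k) + c * k) *\<^sub>R u) - D (t *\<^sub>R (k / (1 + k)) *\<^sub>R u))"
  have "(?f \<longlongrightarrow> 0 - 0) (at_right 0)"
    by (intro tendsto_diff slow_G' slow_D' pos_def_scaleR u pos)
  moreover have "eventually (\<lambda>t. ?f t = ?C) (at_right 0)"
    using eventually_at_right_less[of "0::real"]
  proof eventually_elim
    case (elim t)
    have sc: "t *\<^sub>R a *\<^sub>R u = a *\<^sub>R t *\<^sub>R u" for a by (simp add: mult.commute)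
    show ?case unfolding sc by (rule ray_aux[OF c k pos_def_scaleR[OF u elim]])
  qed
  ultimately have "((\<lambda>_. ?C) \<longlongrightarrow> 0 - 0) (at_right (0::real))"
    by (rule Lim_transform_eventually)
  then have "?C = 0" by (simp add: tendsto_const_iff)
  then show ?thesis using ray_aux[OF c k u] by linarith
qed

lemma ray_increment:
  assumes B: "0 < B" and AB: "4 * B \<le> B'" and H: "0 < H" and u: "u \<in> pos_def_cone"
  shows "G ((B' + H) *\<^sub>R u) - G (B' *\<^sub>R u) = D ((B + H) *\<^sub>R u) - D (B *\<^sub>R u)"
proof -
  obtain s where s: "0 < s" "s < B'" "s - s\<^sup>2 / B' = B" by (rule quadratic_root_split[OF B AB])
  have B': "0 < B'" using s by linarith
  \<comment> \<open>Solves \<open>(1 + k) * s = B'\<close>, \<open>k / (1 + k) * s = B\<close> and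
    \<open>c * k * s = H\<close>; eliminating \<open>k\<close> from the first two leaves the
    quadratic condition on \<open>s\<close>.\<close>
  define k c where "k = B' / s - 1" and "c = H / (s * k)"
  have k: "0 < k" using s by (simp add: k_def field_simps)
  have c: "0 < c" using s k H by (simp add: c_def)
  have 1: "(1 + k) * s = B'" using s by (simp add: k_def field_simps)
  have 2: "c * k * s = H" using s k by (simp add: c_def)
  have rk: "k / (1 + k) = 1 - s / B'"
  proof -
    have "1 + k \<noteq> 0" using k by simp
    then have "k / (1 + k) = 1 - 1 / (1 + k)" by (simp add: field_simps)
    also have "1 / (1 + k) = s / B'" using 1 s B' k by (simp add: field_simps)
    finally show ?thesis .
  qed
  then have 3: "k / (1 + k) * s = B"
    using s(3) unfolding rk by (simp add: left_diff_distrib power2_eq_square)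
  have "(1 + k + c * k) * s = B' + H" "(k / (1 + k) + c * k) * s = B + H"
    using 1 2 3 by (simp_all only: distrib_right)
  then show ?thesis
    using ray[OF c k pos_def_scaleR[OF u s(1)]] unfolding scaleR_scaleR 1 3 by simp
qed

definition slope :: "real^'n^'n \<Rightarrow> real" where
  "slope u = D (2 *\<^sub>R u) - D u"

lemma D_increment:
  assumes B: "0 < B" and H: "0 < H" and u: "u \<in> pos_def_cone"
  shows "D ((B + H) *\<^sub>R u) - D (B *\<^sub>R u) = slope u * H"
proof -
  define f where "f h = D ((1 + h) *\<^sub>R u) - D u" for h
  \<comment> \<open>The point \<open>4 * b + 4\<close> is at least four times both \<open>b\<close>
    and 1, so one increment of \<open>G\<close> there equals the increments of \<open>D\<close> from
    \<open>b\<close> and from 1. The increment is thus independent of the starting point, hence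
    additive.\<close>
  have f: "D ((b + h) *\<^sub>R u) - D (b *\<^sub>R u) = f h" if "0 < b" "0 < h" for b h
    using ray_increment[of b "4 * b + 4" h u] ray_increment[of 1 "4 * b + 4" h u] that u
    by (simp add: f_def)
  have "f (a + b) = f a + f b" if "0 < a" "0 < b" for a b
    using f[of "1 + a" b] that by (simp add: f_def add.assoc)
  moreover have "continuous_on {0<..} f"
    unfolding f_def using u
    by (intro continuous_intros continuous_on_compose2[OF cont_D]) (auto intro!: pos_def_scaleR)
  ultimately have "f H = f 1 * H" using additive_continuous_pos_real[of f H] H by blast
  then show ?thesis using f[OF B H] by (simp add: f_def slope_def)
qed

lemma G_increment:
  assumes B: "0 < B" and H: "0 < H" and u: "u \<in> pos_def_cone"
  shows "G ((B + H) *\<^sub>R u) - G (B *\<^sub>R u) = slope u * H"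
  using ray_increment[of "B / 4" B H u] D_increment[of "B / 4" H u] assms by simp

text \<open>Serves both \<open>G\<close> and \<open>D\<close>. Being affine on rays leaves one free
  constant for each ray; slow variation at the apex makes all these constants equal.\<close>

lemma eq_slopeI:
  assumes u: "u \<in> pos_def_cone"
    and inc: "\<And>t w. 0 < t \<Longrightarrow> t < 1 \<Longrightarrow> w \<in> pos_def_cone \<Longrightarrow> f w - f (t *\<^sub>R w) = slope w * (1 - t)"
    and slow: "((\<lambda>t. f (t *\<^sub>R u) - f (t *\<^sub>R mat 1)) \<longlongrightarrow> 0) (at_right 0)"
  shows "f u = f (mat 1) - slope (mat 1) + slope u"
proof -
  let ?h = "\<lambda>t. f u - f (mat 1) - (slope u - slope (mat 1)) * (1 - t)"
  have "eventually (\<lambda>t. f (t *\<^sub>R u) - f (t *\<^sub>R mat 1) = ?h t) (at_right 0)"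
    using eventually_at_right_real[of 0 1, simplified]
  proof eventually_elim
    case (elim t)
    then show ?case using inc[of t u] inc[of t "mat 1"] u by (simp add: algebra_simps)
  qed
  from Lim_transform_eventually[OF slow this] have "(?h \<longlongrightarrow> 0) (at_right 0)" .
  moreover have "(?h \<longlongrightarrow> f u - f (mat 1) - (slope u - slope (mat 1)) * (1 - 0)) (at_right 0)"
    by (intro tendsto_intros)
  ultimately have "0 = f u - f (mat 1) - (slope u - slope (mat 1)) * (1 - 0)"
    by (rule tendsto_unique[OF trivial_limit_at_right_real])
  then show ?thesis by simp
qed

lemma D_eq: "u \<in> pos_def_cone \<Longrightarrow> D u = D (mat 1) - slope (mat 1) + slope u"
  by (rule eq_slopeI[OF _ _ slow_D]) (use D_increment[of t "1 - t" for t] in auto)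

lemma G_eq: "u \<in> pos_def_cone \<Longrightarrow> G u = G (mat 1) - slope (mat 1) + slope u"
  by (rule eq_slopeI[OF _ _ slow_G]) (use G_increment[of t "1 - t" for t] in auto)

lemma slope_scaleR:
  assumes "0 < t" "u \<in> pos_def_cone" shows "slope (t *\<^sub>R u) = t * slope u"
  using D_increment[OF assms(1) assms(1,2)] by (simp add: slope_def mult.commute)

lemma continuous_slope: "continuous_on pos_def_cone slope"
  unfolding slope_def
  by (intro continuous_intros cont_D continuous_on_compose2[OF cont_D]) (auto intro!: pos_def_scaleR)

lemma tendsto_slope:
  "(f \<longlongrightarrow> y) H \<Longrightarrow> y \<in> pos_def_cone \<Longrightarrow> eventually (\<lambda>t. f t \<in> pos_def_cone) H \<Longrightarrow>
    ((\<lambda>t. slope (f t)) \<longlongrightarrow> slope y) H"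
  by (rule continuous_on_tendsto_compose[OF continuous_slope])

lemma slope_difference:
  assumes x: "x \<in> pos_def_cone" and u: "u \<in> pos_def_cone"
  shows "slope (kummer_map x u) - slope u = slope (kummer_map u x) - slope x"
  using difference_equation[OF x u] G_eq[OF u] D_eq[OF x] G_eq[OF kummer_map_pos_def[OF x u]]
    D_eq[OF kummer_map_pos_def[OF u x]] by linarith

text \<open>By homogeneity the argument of \<open>slope\<close> is the congruence of
  \<open>x\<close> by the root of \<open>t *\<^sub>R mat 1 + u\<close>, so the limit removes the
  identity that \<open>kummer_map\<close> adds.\<close>

lemma slope_conj_limit:
  assumes x: "x \<in> pos_def_cone" and u: "u \<in> pos_def_cone"
  shows "((\<lambda>t. slope (t *\<^sub>R kummer_map ((1 / t) *\<^sub>R u) x)) \<longlongrightarrow>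
      slope (mat_sqrt u ** x ** mat_sqrt u)) (at_right 0)"
proof -
  have eq: "t *\<^sub>R kummer_map ((1 / t) *\<^sub>R u) x = mat_sqrt (t *\<^sub>R mat 1 + u) ** x ** mat_sqrt (t *\<^sub>R mat 1 + u)"
    if t: "0 < t" for t
  proof -
    have "mat 1 + (1 / t) *\<^sub>R u = (1 / t) *\<^sub>R (t *\<^sub>R mat 1 + u)" using t by (simp add: scaleR_add_right)
    moreover have "t *\<^sub>R mat 1 + u \<in> pos_def_cone" using t u by (simp add: pos_def_add pos_def_scaleR)
    ultimately show ?thesis using t by (simp add: kummer_map_def mat_sqrt_scaleR matrix_ring_simps)
  qed
  have ev: "eventually (\<lambda>t. t *\<^sub>R mat 1 + u \<in> pos_def_cone) (at_right 0)"
    using eventually_at_right_less[of "0::real"] by eventually_elim (simp add: pos_def_add pos_def_scaleR u)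
  have "((\<lambda>t. t *\<^sub>R mat 1 + u) \<longlongrightarrow> 0 *\<^sub>R mat 1 + u) (at_right 0)" by (intro tendsto_intros)
  then have "((\<lambda>t. mat_sqrt (t *\<^sub>R mat 1 + u)) \<longlongrightarrow> mat_sqrt u) (at_right 0)"
    by (intro tendsto_mat_sqrt ev) (auto simp: u)
  then have "((\<lambda>t. mat_sqrt (t *\<^sub>R mat 1 + u) ** x ** mat_sqrt (t *\<^sub>R mat 1 + u)) \<longlongrightarrow>
      mat_sqrt u ** x ** mat_sqrt u) (at_right 0)" by (intro tendsto_intros)
  then have "((\<lambda>t. slope (mat_sqrt (t *\<^sub>R mat 1 + u) ** x ** mat_sqrt (t *\<^sub>R mat 1 + u))) \<longlongrightarrow>
      slope (mat_sqrt u ** x ** mat_sqrt u)) (at_right 0)"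
    by (rule tendsto_slope) (use ev x u in \<open>auto intro: pos_def_conj_sqrt elim!: eventually_mono\<close>)
  then show ?thesis
    by (rule Lim_transform_eventually)
       (use eventually_at_right_less[of "0::real"] eq in \<open>auto elim!: eventually_mono\<close>)
qed

lemma slope_conj_eqI:
  assumes x: "x \<in> pos_def_cone" and u: "u \<in> pos_def_cone"
    and eq: "\<And>t. 0 < t \<Longrightarrow> t * (slope (kummer_map ((1 / t) *\<^sub>R u) x) - slope x) = C"
  shows "slope (mat_sqrt u ** x ** mat_sqrt u) = C"
proof -
  have "((\<lambda>t. slope (t *\<^sub>R kummer_map ((1 / t) *\<^sub>R u) x) - t * slope x) \<longlongrightarrow>
      slope (mat_sqrt u ** x ** mat_sqrt u) - 0 * slope x) (at_right 0)"
    by (intro tendsto_intros slope_conj_limit x u)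
  moreover have "eventually (\<lambda>t. slope (t *\<^sub>R kummer_map ((1 / t) *\<^sub>R u) x) - t * slope x = C) (at_right 0)"
    using eventually_at_right_less[of "0::real"]
    by eventually_elim (simp add: slope_scaleR x u pos_def_scaleR eq[symmetric] right_diff_distrib)
  ultimately have "((\<lambda>_. C) \<longlongrightarrow> slope (mat_sqrt u ** x ** mat_sqrt u) - 0 * slope x) (at_right (0::real))"
    by (rule Lim_transform_eventually)
  then show ?thesis by (simp add: tendsto_const_iff)
qed

text \<open>In \<open>slope_difference\<close> replace \<open>u\<close> by
  \<open>(1 / t) *\<^sub>R u\<close> and multiply by \<open>t\<close>. Homogeneity makes one side
  independent of \<open>t\<close>, and the other tends to the slope of the plain congruence.\<close>

lemma slope_kummer_map:
  assumes x: "x \<in> pos_def_cone" and u: "u \<in> pos_def_cone"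
  shows "slope (kummer_map x u) - slope u = slope (mat_sqrt u ** x ** mat_sqrt u)"
proof (rule slope_conj_eqI[OF x u, symmetric])
  fix t :: real assume t: "0 < t"
  then have tu: "(1 / t) *\<^sub>R u \<in> pos_def_cone" using u by (simp add: pos_def_scaleR)
  show "t * (slope (kummer_map ((1 / t) *\<^sub>R u) x) - slope x) = slope (kummer_map x u) - slope u"
    unfolding slope_difference[OF x tu, symmetric] kummer_map_scaleR
    using t by (simp add: slope_scaleR x u right_diff_distrib)
qed

text \<open>The same rescaling as for \<open>slope_kummer_map\<close>, applied to that identity
  itself with \<open>x\<close> made large.\<close>

lemma slope_conj_commute:
  assumes x: "x \<in> pos_def_cone" and u: "u \<in> pos_def_cone"
  shows "slope (mat_sqrt x ** u ** mat_sqrt x) = slope (mat_sqrt u ** x ** mat_sqrt u)"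
proof (rule slope_conj_eqI[OF u x])
  fix t :: real assume t: "0 < t"
  then have tx: "(1 / t) *\<^sub>R x \<in> pos_def_cone" using x by (simp add: pos_def_scaleR)
  have "mat_sqrt u ** ((1 / t) *\<^sub>R x) ** mat_sqrt u = (1 / t) *\<^sub>R (mat_sqrt u ** x ** mat_sqrt u)"
    by (simp only: matrix_ring_simps)
  then show "t * (slope (kummer_map ((1 / t) *\<^sub>R x) u) - slope u) = slope (mat_sqrt u ** x ** mat_sqrt u)"
    unfolding slope_kummer_map[OF tx u] using t by (simp add: slope_scaleR x u pos_def_conj_sqrt)
qed

text \<open>Write \<open>w\<close> as the congruence of some \<open>x\<close> by the root of
  \<open>u\<close>. Then \<open>u + w\<close> is the congruence of \<open>mat 1 + x\<close>;
  \<open>slope_conj_commute\<close> turns it into \<open>kummer_map x u\<close>, whose slope splits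
  by \<open>slope_kummer_map\<close>.\<close>

lemma slope_add:
  assumes u: "u \<in> pos_def_cone" and w: "w \<in> pos_def_cone"
  shows "slope (u + w) = slope u + slope w"
proof -
  obtain x where x: "x \<in> pos_def_cone" "mat_sqrt u ** x ** mat_sqrt u = w"
    by (rule mat_sqrt_conj_surj[OF u w])
  have "mat_sqrt u ** (mat 1 + x) ** mat_sqrt u = u + w"
    using x(2) by (simp add: matrix_ring_simps mat_sqrt_square[OF u])
  then have "slope (u + w) = slope (kummer_map x u)"
    using slope_conj_commute[OF pos_def_1_add[OF x(1)] u] by (simp add: kummer_map_def)
  then show ?thesis using slope_kummer_map[OF x(1) u] x(2) by simp
qed

text \<open>The linear extension of \<open>slope\<close> to symmetric matrices. By
  \<open>slope_ext_eq\<close> every shift into the cone gives the same value, and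
  \<open>norm z + 1\<close> is a shift that always works.\<close>

definition slope_ext :: "real^'n^'n \<Rightarrow> real" where
  "slope_ext z = slope (z + (norm z + 1) *\<^sub>R mat 1) - (norm z + 1) * slope (mat 1)"

lemma slope_ext_eq:
  assumes z: "z \<in> sym_matrices" and c: "0 < c" and zc: "z + c *\<^sub>R mat 1 \<in> pos_def_cone"
  shows "slope (z + c *\<^sub>R mat 1) = slope_ext z + c * slope (mat 1)"
proof -
  let ?b = "norm z + 1"
  have zb: "z + ?b *\<^sub>R mat 1 \<in> pos_def_cone" by (rule pos_def_shift[OF z]) simp
  have pos: "0 < ?b" by (simp add: add_nonneg_pos)
  have "slope ((z + c *\<^sub>R mat 1) + ?b *\<^sub>R mat 1) = slope (z + c *\<^sub>R mat 1) + ?b * slope (mat 1)"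
    using zc pos by (simp only: slope_add slope_scaleR pos_def_scaleR pos_def_mat_1)
  moreover have "slope ((z + ?b *\<^sub>R mat 1) + c *\<^sub>R mat 1) = slope (z + ?b *\<^sub>R mat 1) + c * slope (mat 1)"
    using zb c by (simp only: slope_add slope_scaleR pos_def_scaleR pos_def_mat_1)
  moreover have "slope ((z + c *\<^sub>R mat 1) + ?b *\<^sub>R mat 1) = slope ((z + ?b *\<^sub>R mat 1) + c *\<^sub>R mat 1)"
    by (simp only: add_ac)
  ultimately show ?thesis unfolding slope_ext_def by (simp add: algebra_simps)
qed

lemma slope_ext_add:
  assumes z: "z \<in> sym_matrices" and w: "w \<in> sym_matrices"
  shows "slope_ext (z + w) = slope_ext z + slope_ext w"
proof -
  let ?b = "norm z + 1" and ?c = "norm w + 1"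
  have p: "z + ?b *\<^sub>R mat 1 \<in> pos_def_cone" "w + ?c *\<^sub>R mat 1 \<in> pos_def_cone"
    using z w by (auto intro!: pos_def_shift)
  have pos: "0 < ?b" "0 < ?c" "0 < ?b + ?c"
    using norm_ge_zero[of z] norm_ge_zero[of w] by linarith+
  have eq: "(z + ?b *\<^sub>R mat 1) + (w + ?c *\<^sub>R mat 1) = (z + w) + (?b + ?c) *\<^sub>R mat 1"
    by (simp only: scaleR_add_left add_ac)
  have "slope ((z + w) + (?b + ?c) *\<^sub>R mat 1) = slope_ext (z + w) + (?b + ?c) * slope (mat 1)"
    using pos_def_add[OF p] unfolding eq
    by (intro slope_ext_eq subspace_add[OF subspace_sym_matrices] z w pos)
  moreover have "slope ((z + w) + (?b + ?c) *\<^sub>R mat 1) =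
      slope_ext z + ?b * slope (mat 1) + (slope_ext w + ?c * slope (mat 1))"
    unfolding eq[symmetric] slope_add[OF p] slope_ext_eq[OF z pos(1) p(1)] slope_ext_eq[OF w pos(2) p(2)] ..
  ultimately show ?thesis by (simp add: distrib_right)
qed

lemma slope_ext_scale_pos:
  assumes z: "z \<in> sym_matrices" and t: "0 < t"
  shows "slope_ext (t *\<^sub>R z) = t * slope_ext z"
proof -
  let ?b = "norm z + 1"
  have p: "z + ?b *\<^sub>R mat 1 \<in> pos_def_cone" using z by (auto intro!: pos_def_shift)
  have pos: "0 < ?b" "0 < t * ?b" using t by (simp_all add: add_nonneg_pos)
  have eq: "t *\<^sub>R (z + ?b *\<^sub>R mat 1) = t *\<^sub>R z + (t * ?b) *\<^sub>R mat 1"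
    by (simp only: scaleR_add_right scaleR_scaleR)
  have "slope (t *\<^sub>R z + (t * ?b) *\<^sub>R mat 1) = slope_ext (t *\<^sub>R z) + t * ?b * slope (mat 1)"
    using pos_def_scaleR[OF p t] unfolding eq
    by (intro slope_ext_eq subspace_scale[OF subspace_sym_matrices] z pos)
  moreover have "slope (t *\<^sub>R z + (t * ?b) *\<^sub>R mat 1) = t * (slope_ext z + ?b * slope (mat 1))"
    unfolding eq[symmetric] slope_scaleR[OF t p] slope_ext_eq[OF z pos(1) p] ..
  ultimately show ?thesis by (simp add: algebra_simps)
qed

lemma slope_ext_pos_def:
  assumes "u \<in> pos_def_cone" shows "slope_ext u = slope u"
proof -
  have "u + 1 *\<^sub>R mat 1 \<in> pos_def_cone" using assms by (simp add: pos_def_add)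
  from slope_ext_eq[OF _ _ this] assms pos_def_subset_sym slope_add[OF assms pos_def_mat_1]
  show ?thesis by auto
qed

lemma slope_ext_scale:
  assumes z: "z \<in> sym_matrices" shows "slope_ext (t *\<^sub>R z) = t * slope_ext z"
proof -
  have 0: "slope_ext 0 = 0"
    using slope_ext_add[of 0 0] subspace_0[OF subspace_sym_matrices] by simp
  have neg: "slope_ext (- w) = - slope_ext w" if "w \<in> sym_matrices" for w
    using slope_ext_add[OF that subspace_neg[OF subspace_sym_matrices that]] 0 by simp
  consider "0 < t" | "t = 0" | "t < 0" by linarith
  then show ?thesis
  proof cases
    case 3
    have "slope_ext (t *\<^sub>R z) = - slope_ext ((- t) *\<^sub>R z)"
      using neg[OF subspace_scale[OF subspace_sym_matrices z, of "- t"]] by simp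
    then show ?thesis using slope_ext_scale_pos[OF z, of "- t"] 3 by simp
  qed (use 0 slope_ext_scale_pos[OF z] in auto)
qed

lemma slope_representation:
  obtains s where "transpose s = s" "\<And>u. u \<in> pos_def_cone \<Longrightarrow> slope u = s \<bullet> u"
proof -
  \<comment> \<open>Symmetrising the argument gives a linear functional on all square matrices,
    represented through its adjoint. It ignores transposition, so the representing matrix is
    symmetric.\<close>
  define f where "f z = slope_ext ((1/2) *\<^sub>R (z + transpose z))" for z :: "real^'n^'n"
  have sym: "z + transpose z \<in> sym_matrices" for z :: "real^'n^'n"
    by (simp add: sym_matrices_def transpose_add add.commute)
  have f: "f z = (1/2) * slope_ext (z + transpose z)" for z
    unfolding f_def by (rule slope_ext_scale[OF sym])
  have lin: "linear f"
  proof (rule linearI)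
    fix z w :: "real^'n^'n" and t :: real
    have eq: "(z + w) + transpose (z + w) = (z + transpose z) + (w + transpose w)" by (simp add: transpose_add)
    show "f (z + w) = f z + f w" unfolding f eq slope_ext_add[OF sym sym] by (simp add: distrib_left)
    have eq: "t *\<^sub>R z + transpose (t *\<^sub>R z) = t *\<^sub>R (z + transpose z)" by (simp add: transpose_scalar scaleR_add_right)
    show "f (t *\<^sub>R z) = t *\<^sub>R f z" unfolding f eq slope_ext_scale[OF sym] by simp
  qed
  define s where "s = adjoint f 1"
  have s: "s \<bullet> z = f z" for z
    using adjoint_works[OF lin, of z 1] by (simp add: s_def inner_commute)
  have "transpose s \<bullet> z = s \<bullet> z" for z
  proof -
    have "transpose s \<bullet> z = s \<bullet> transpose z"
      unfolding inner_vec_def transpose_def by (simp, subst sum.swap) (rule refl)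
    then show ?thesis unfolding s f by (simp add: add.commute)
  qed
  then have "transpose s = s" by (metis inner_eq_zero_iff inner_diff_left right_minus_eq)
  moreover have "slope u = s \<bullet> u" if "u \<in> pos_def_cone" for u
  proof -
    have "(1/2) *\<^sub>R (u + transpose u) = u"
      unfolding pos_def_sym[OF that] by (simp flip: scaleR_2)
    then show ?thesis unfolding s f_def using slope_ext_pos_def[OF that] by simp
  qed
  ultimately show thesis by (rule that)
qed

end

section \<open>The functional equation: general solution\<close>

lemma mult_matrix_unit_entry: "(x ** matrix_unit a b) $ k $ l = (if l = b then x $ k $ a else 0)"
  for x :: "real^'n^'n"
proof -
  have "(\<Sum>m\<in>UNIV. x $ k $ m * (if m = a \<and> l = b then 1 else 0)) =
      (\<Sum>m\<in>UNIV. if m = a then (if l = b then x $ k $ a else 0) else 0)"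
    by (intro sum.cong) auto
  then show ?thesis by (simp add: matrix_matrix_mult_def matrix_unit_def)
qed

lemma matrix_unit_mult_entry: "(matrix_unit a b ** x) $ k $ l = (if k = a then x $ b $ l else 0)"
  for x :: "real^'n^'n"
proof -
  have "(\<Sum>m\<in>UNIV. (if k = a \<and> m = b then 1 else 0) * x $ m $ l) =
      (\<Sum>m\<in>UNIV. if m = b then (if k = a then x $ b $ l else 0) else 0)"
    by (intro sum.cong) auto
  then show ?thesis by (simp add: matrix_matrix_mult_def matrix_unit_def)
qed

text \<open>Shifting into the cone extends commutation to all symmetric matrices. Diagonal matrix
  units then kill the off-diagonal entries of \<open>s\<close>, and symmetrised off-diagonal units
  equate its diagonal entries.\<close>

lemma commute_pos_def_imp_scalar:
  fixes s :: "real^'n^'n"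
  assumes comm: "\<And>v. v \<in> pos_def_cone \<Longrightarrow> s ** v = v ** s"
  obtains c where "s = c *\<^sub>R mat 1"
proof -
  have sym: "s ** z = z ** s" if "z \<in> sym_matrices" for z
    using comm[OF pos_def_shift[OF that, of "norm z + 1"]] by (simp add: matrix_ring_simps)
  have u: "matrix_unit i j + matrix_unit j i \<in> sym_matrices" for i j :: 'n
    by (simp add: sym_matrices_def transpose_add transpose_matrix_unit add.commute)
  have e: "(s ** matrix_unit i j) $ k $ l + (s ** matrix_unit j i) $ k $ l =
      (matrix_unit i j ** s) $ k $ l + (matrix_unit j i ** s) $ k $ l" for i j k l
    using arg_cong[OF sym[OF u[of i j]], of "\<lambda>x. x $ k $ l"] by (simp add: matrix_ring_simps)
  have off: "s $ i $ j = 0" if "i \<noteq> j" for i j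
    using e[of j j i j] that by (simp add: mult_matrix_unit_entry matrix_unit_mult_entry)
  have diag: "s $ i $ i = s $ j $ j" for i j
    using e[of i j i j] off by (cases "i = j") (simp_all add: mult_matrix_unit_entry matrix_unit_mult_entry)
  have "s = (s $ undefined $ undefined) *\<^sub>R mat 1"
    using off diag[of _ undefined] by (auto simp: vec_eq_iff mat_def)
  then show thesis by (rule that)
qed

context slow_kummer_equation begin

text \<open>
  Polarising the commutation identity at the identity matrix shows that the representing matrix
  \<open>s\<close> satisfies \<open>tr (s [v, [v, s]]) = 0\<close>, that is \<open>[s, v] = 0\<close>, for all positive definite \<open>v\<close>.
\<close>

lemma slope_trace:
  obtains c where "\<And>u. u \<in> pos_def_cone \<Longrightarrow> slope u = c * trace u"
proof -
  obtain s where s: "transpose s = s" "\<And>u. u \<in> pos_def_cone \<Longrightarrow> slope u = s \<bullet> u"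
    by (rule slope_representation) blast
  have s_sym: "s \<in> sym_matrices" using s(1) by (simp add: sym_matrices_def)
  have conj: "s \<bullet> (a ** (v ** v) ** a) = s \<bullet> (v ** (a ** a) ** v)"
    if a: "a \<in> pos_def_cone" and v: "v \<in> pos_def_cone" for a v
    using slope_conj_commute[OF pos_def_square[OF a] pos_def_square[OF v]]
      s(2)[OF pos_def_conj_sqrt[OF pos_def_square[OF a] pos_def_square[OF v]]]
      s(2)[OF pos_def_conj_sqrt[OF pos_def_square[OF v] pos_def_square[OF a]]]
    by (simp only: mat_sqrt_unique a v)
  \<comment> \<open>Put \<open>mat 1 + h\<close> for \<open>a\<close> in \<open>conj\<close>. The
    constant terms cancel, the quadratic ones cancel by \<open>conj\<close> for \<open>h\<close>
    itself, and the part linear in \<open>h\<close> remains.\<close>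
  have comm_pd: "s \<bullet> (h ** (v ** v)) + s \<bullet> ((v ** v) ** h) = 2 * (s \<bullet> (v ** h ** v))"
    if h: "h \<in> pos_def_cone" and v: "v \<in> pos_def_cone" for h v
  proof -
    have "(mat 1 + h) ** (v ** v) ** (mat 1 + h) =
        v ** v + h ** (v ** v) + (v ** v) ** h + h ** (v ** v) ** h"
      by (simp add: matrix_ring_simps)
    moreover have "v ** ((mat 1 + h) ** (mat 1 + h)) ** v = v ** v + v ** h ** v + v ** h ** v + v ** (h ** h) ** v"
      by (simp only: matrix_ring_simps matrix_mul_lid matrix_mul_rid matrix_mul_assoc add_ac)
    ultimately show ?thesis
      using conj[OF pos_def_1_add[OF h] v] conj[OF h v] by (simp only: inner_add_right)
  qed
  \<comment> \<open>Being linear in \<open>h\<close>, the identity extends to \<open>h = s\<close>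
    by a shift into the cone; the scalar part contributes equally to both sides.\<close>
  have comm: "s \<bullet> (s ** (v ** v)) + s \<bullet> ((v ** v) ** s) = 2 * (s \<bullet> (v ** s ** v))"
    if v: "v \<in> pos_def_cone" for v
  proof -
    let ?c = "norm s + 1"
    have "s + ?c *\<^sub>R mat 1 \<in> pos_def_cone" by (rule pos_def_shift[OF s_sym]) simp
    from comm_pd[OF this v] show ?thesis
      by (simp add: matrix_ring_simps inner_add_right inner_scaleR_right algebra_simps)
  qed
  have "s ** v = v ** s" if v: "v \<in> pos_def_cone" for v
  proof -
    note vs = pos_def_sym[OF v]
    have t1: "(s ** v) \<bullet> (s ** v) = s \<bullet> (s ** (v ** v))"
      using trace_mul_sym[of v "s ** s ** v"]
      by (simp add: inner_matrix_eq_trace matrix_transpose_mul s(1) vs matrix_mul_assoc)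
    have t2: "(v ** s) \<bullet> (v ** s) = s \<bullet> ((v ** v) ** s)"
      by (simp add: inner_matrix_eq_trace matrix_transpose_mul s(1) vs matrix_mul_assoc)
    have t3: "(v ** s) \<bullet> (s ** v) = s \<bullet> (v ** s ** v)"
      by (simp add: inner_matrix_eq_trace matrix_transpose_mul s(1) vs matrix_mul_assoc)
    have "(s ** v - v ** s) \<bullet> (s ** v - v ** s) = 0"
      using comm[OF v] t1 t2 t3 by (simp add: inner_diff_left inner_diff_right inner_commute)
    then show ?thesis by simp
  qed
  then obtain c where c: "s = c *\<^sub>R mat 1" by (rule commute_pos_def_imp_scalar)
  have "slope u = c * trace u" if "u \<in> pos_def_cone" for u
    using s(2)[OF that] by (simp add: c inner_matrix_eq_trace transpose_scalar matrix_ring_simps trace_scaleR)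
  then show thesis by (rule that)
qed

end

lemma continuous_on_ln_det: "continuous_on pos_def_cone (\<lambda>x. ln (det x))"
  by (intro continuous_on_ln continuous_on_det continuous_on_id) (auto dest: det_pos_def)

lemma ln_det_scaleR_diff:
  fixes w :: "real^'n^'n"
  assumes "w \<in> pos_def_cone" "0 < t"
  shows "ln (det (t *\<^sub>R w)) - ln (det (t *\<^sub>R mat 1 :: real^'n^'n)) = ln (det w)"
  using assms det_pos_def[of w] by (simp add: det_scaleR ln_mult_pos)

text \<open>The term \<open>- p * ln (det (mat 1 + x))\<close> compensates the logarithmic part of
  \<open>G\<close>, because \<open>det (kummer_map x u) = det (mat 1 + x) * det u\<close>. The
  function \<open>F\<close> is read off at \<open>u = mat 1\<close>.\<close>

theorem (in kummer_equation) solution: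
  obtains p q c cF cG where
    "\<And>x. x \<in> pos_def_cone \<Longrightarrow> G x = cG + p * ln (det x) + c * trace x"
    "\<And>x. x \<in> pos_def_cone \<Longrightarrow> F x = cF + q * ln (det x) - p * ln (det (mat 1 + x)) + c * trace x"
proof -
  obtain q where q: "\<And>w. w \<in> pos_def_cone \<Longrightarrow>
    ((\<lambda>t. D (t *\<^sub>R w) - D (t *\<^sub>R mat 1)) \<longlongrightarrow> q * ln (det w)) (at_right 0)"
    by (rule slow_variation) blast
  obtain p where p: "\<And>w. w \<in> pos_def_cone \<Longrightarrow>
    ((\<lambda>t. G (t *\<^sub>R w) - G (t *\<^sub>R mat 1)) \<longlongrightarrow> p * ln (det w)) (at_right 0)"
    by (rule kummer_equation.slow_variation[OF swap]) blast
  define G' where "G' x = G x - p * ln (det x)" for x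
  define D' where "D' x = D x - q * ln (det x)" for x
  define F' where "F' x = F x - q * ln (det x) + p * ln (det (mat 1 + x))" for x
  define A' where "A' x = A x - p * ln (det x) + q * ln (det (mat 1 + x))" for x
  have slow: "((\<lambda>t. (f (t *\<^sub>R w) - r * ln (det (t *\<^sub>R w))) - (f (t *\<^sub>R mat 1) - r * ln (det (t *\<^sub>R mat 1 :: real^'n^'n)))) \<longlongrightarrow> 0) (at_right 0)"
    if w: "w \<in> pos_def_cone" and f: "((\<lambda>t. f (t *\<^sub>R w) - f (t *\<^sub>R mat 1)) \<longlongrightarrow> r * ln (det w)) (at_right 0)"
    for f :: "real^'n^'n \<Rightarrow> real" and r w
  proof (rule Lim_transform_eventually)
    show "((\<lambda>t. (f (t *\<^sub>R w) - f (t *\<^sub>R mat 1)) - r * ln (det w)) \<longlongrightarrow> 0) (at_right 0)"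
      using f by (simp add: LIM_zero)
    show "eventually (\<lambda>t. (f (t *\<^sub>R w) - f (t *\<^sub>R mat 1)) - r * ln (det w) =
        (f (t *\<^sub>R w) - r * ln (det (t *\<^sub>R w))) - (f (t *\<^sub>R mat 1) - r * ln (det (t *\<^sub>R mat 1 :: real^'n^'n)))) (at_right 0)"
      using eventually_at_right_less[of "0::real"]
    proof eventually_elim
      case (elim t)
      show ?case unfolding ln_det_scaleR_diff[OF w elim, symmetric] by (simp add: right_diff_distrib)
    qed
  qed
  interpret K: slow_kummer_equation F' G' A' D'
  proof
    show "continuous_on pos_def_cone G'" "continuous_on pos_def_cone D'"
      unfolding G'_def D'_def by (intro continuous_intros cont_G cont_D continuous_on_ln_det)+
    show "F' x + G' (kummer_map x u) = A' u + D' (kummer_map u x)"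
      if x: "x \<in> pos_def_cone" and u: "u \<in> pos_def_cone" for x u
    proof -
      have "ln (det (kummer_map x u)) = ln (det (mat 1 + x)) + ln (det u)"
        "ln (det (kummer_map u x)) = ln (det (mat 1 + u)) + ln (det x)"
        using x u by (auto simp: det_kummer_map intro!: ln_mult_pos det_pos_def)
      then show ?thesis using eq[OF x u] by (simp add: F'_def G'_def A'_def D'_def algebra_simps)
    qed
  qed (unfold G'_def D'_def, auto intro!: slow p q)
  obtain c where c: "\<And>u. u \<in> pos_def_cone \<Longrightarrow> K.slope u = c * trace u" by (rule K.slope_trace) blast
  define g d where "g = G' (mat 1) - K.slope (mat 1)" and "d = D' (mat 1) - K.slope (mat 1)"
  have G': "G' x = g + c * trace x" if "x \<in> pos_def_cone" for x
    using K.G_eq[OF that] by (simp add: c[OF that] g_def)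
  have D': "D' x = d + c * trace x" if "x \<in> pos_def_cone" for x
    using K.D_eq[OF that] by (simp add: c[OF that] d_def)
  have F': "F' x = (A' (mat 1) + d - g - c * trace (mat 1 :: real^'n^'n)) + c * trace x"
    if x: "x \<in> pos_def_cone" for x
  proof -
    have "kummer_map (mat 1) x = 2 *\<^sub>R x" using kummer_map_scalar[of 1 x] by simp
    then have "F' x + (g + c * (trace (mat 1 :: real^'n^'n) + trace x)) = A' (mat 1) + (d + c * (2 * trace x))"
      using K.eq[OF x pos_def_mat_1] G'[OF kummer_map_pos_def[OF x pos_def_mat_1]]
        D'[OF kummer_map_pos_def[OF pos_def_mat_1 x]]
      by (simp add: kummer_map_mat_1[OF x] trace_add trace_scaleR)
    then show ?thesis by (simp add: algebra_simps)
  qed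
  show thesis
  proof (rule that[of g p c "A' (mat 1) + d - g - c * trace (mat 1 :: real^'n^'n)" q])
    fix x :: "real^'n^'n" assume x: "x \<in> pos_def_cone"
    show "G x = g + p * ln (det x) + c * trace x" using G'[OF x] by (simp add: G'_def)
    show "F x = (A' (mat 1) + d - g - c * trace (mat 1 :: real^'n^'n)) + q * ln (det x)
        - p * ln (det (mat 1 + x)) + c * trace x"
      using F'[OF x] by (simp add: F'_def)
  qed
qed

section \<open>Lebesgue measure on symmetric matrices\<close>

text \<open>
  The change of variables formula of the library for linear maps requires a well-ordered index
  type, so the unordered pairs are replaced by a copy with an arbitrary well-order.
\<close>

typedef 'a ordered_copy = "UNIV :: 'a set" by simp

instance ordered_copy :: (finite) finite
proof
  have "(UNIV :: 'a ordered_copy set) = range Abs_ordered_copy"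
    by (metis Rep_ordered_copy_inverse UNIV_eq_I rangeI)
  then show "finite (UNIV :: 'a ordered_copy set)" by (metis finite finite_imageI)
qed

instantiation ordered_copy :: (finite) wellorder
begin

definition less_eq_ordered_copy :: "'a ordered_copy \<Rightarrow> 'a ordered_copy \<Rightarrow> bool" where
  "x \<le> y \<longleftrightarrow> to_nat_on (UNIV :: 'a set) (Rep_ordered_copy x) \<le> to_nat_on (UNIV :: 'a set) (Rep_ordered_copy y)"

definition less_ordered_copy :: "'a ordered_copy \<Rightarrow> 'a ordered_copy \<Rightarrow> bool" where
  "x < y \<longleftrightarrow> to_nat_on (UNIV :: 'a set) (Rep_ordered_copy x) < to_nat_on (UNIV :: 'a set) (Rep_ordered_copy y)"

instance
proof
  fix x y :: "'a ordered_copy"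
  have inj: "inj (to_nat_on (UNIV :: 'a set))" by (rule inj_on_to_nat_on) (simp add: countable_finite)
  show "x \<le> y \<Longrightarrow> y \<le> x \<Longrightarrow> x = y"
    unfolding less_eq_ordered_copy_def using injD[OF inj] by (simp add: Rep_ordered_copy_inject[symmetric])
  fix P :: "'a ordered_copy \<Rightarrow> bool" and a
  assume step: "\<And>x. (\<And>y. y < x \<Longrightarrow> P y) \<Longrightarrow> P x"
  show "P a"
    by (induction a rule: measure_induct_rule[where f = "\<lambda>x. to_nat_on (UNIV :: 'a set) (Rep_ordered_copy x)"])
       (use step in \<open>simp add: less_ordered_copy_def\<close>)
qed (auto simp: less_eq_ordered_copy_def less_ordered_copy_def)

end

lemma bij_Abs_ordered_copy: "bij Abs_ordered_copy"
  by (intro bijI' ) (auto simp: Abs_ordered_copy_inject intro: Rep_ordered_copy_inverse[symmetric])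

definition relabel :: "real^('k::finite ordered_copy) \<Rightarrow> real^'k" where
  "relabel c = (\<chi> u. c $ Abs_ordered_copy u)"

definition unlabel :: "real^'k \<Rightarrow> real^('k::finite ordered_copy)" where
  "unlabel c = (\<chi> u. c $ Rep_ordered_copy u)"

lemma relabel_unlabel [simp]: "relabel (unlabel c) = c"
  by (simp add: relabel_def unlabel_def Abs_ordered_copy_inverse vec_eq_iff)

lemma unlabel_relabel [simp]: "unlabel (relabel c) = c"
  by (simp add: relabel_def unlabel_def Rep_ordered_copy_inverse vec_eq_iff)

lemma linear_relabel: "linear relabel"
  by (rule linearI) (simp_all add: relabel_def vec_eq_iff)

lemma inner_relabel: "relabel c \<bullet> relabel d = c \<bullet> d"
  unfolding inner_vec_def relabel_def
  using sum.reindex_bij_betw[OF bij_Abs_ordered_copy, of "\<lambda>i. c $ i \<bullet> d $ i"] by simp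

lemma prod_Basis_cart: "(\<Prod>b\<in>Basis. (x :: real^'k) \<bullet> b) = (\<Prod>i\<in>UNIV. x $ i)"
  by (simp add: Basis_vec_def cart_eq_inner_axis axis_eq_axis prod.UNION_disjoint)

lemma lborel_relabel: "(lborel :: (real^'k::finite) measure) = distr lborel borel relabel"
proof (rule lborel_eqI)
  have [measurable]: "relabel \<in> borel_measurable (borel :: (real^'k::finite ordered_copy) measure)"
    by (intro borel_measurable_continuous_onI linear_continuous_on)
       (simp add: linear_relabel linear_conv_bounded_linear[symmetric])
  fix l u :: "real^'k" assume le: "\<And>b. b \<in> Basis \<Longrightarrow> l \<bullet> b \<le> u \<bullet> b"
  then have le': "l $ i \<le> u $ i" for i
    using le[of "axis i 1"] by (simp add: axis_in_Basis_iff inner_axis)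
  have "relabel -` box l u = box (unlabel l) (unlabel u)"
  proof (intro equalityI subsetI)
    fix c assume "c \<in> box (unlabel l) (unlabel u)"
    then show "c \<in> relabel -` box l u"
      by (auto simp: mem_box_cart relabel_def unlabel_def)
         (metis Abs_ordered_copy_inverse UNIV_I)+
  next
    fix c assume "c \<in> relabel -` box l u"
    then show "c \<in> box (unlabel l) (unlabel u)"
      by (auto simp: mem_box_cart relabel_def unlabel_def)
         (metis Rep_ordered_copy_inverse)+
  qed
  moreover have "emeasure lborel (box (unlabel l) (unlabel u)) = (\<Prod>b\<in>Basis. (unlabel u - unlabel l) \<bullet> b)"
    by (rule emeasure_lborel_box) (auto simp: Basis_vec_def inner_axis unlabel_def le')
  moreover have "(\<Prod>i\<in>UNIV. (unlabel u - unlabel l) $ i) = (\<Prod>i\<in>UNIV. (u - l) $ i)"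
    using prod.reindex_bij_betw[OF bij_Abs_ordered_copy, of "\<lambda>i. (unlabel u - unlabel l) $ i"]
    by (simp add: unlabel_def Abs_ordered_copy_inverse)
  ultimately show "emeasure (distr lborel borel relabel) (box l u) = (\<Prod>b\<in>Basis. (u - l) \<bullet> b)"
    by (simp add: emeasure_distr prod_Basis_cart)
qed simp

section \<open>Isometric coordinates on symmetric matrices\<close>

definition sym_emb :: "real^('n::finite uprod ordered_copy) \<Rightarrow> real^'n^'n" where
  "sym_emb c = sym_of_coords (relabel c)"

lemma linear_sym_of_coords: "linear sym_of_coords"
  by (rule linearI) (simp_all add: sym_of_coords_def vec_eq_iff algebra_simps)

lemma linear_sym_emb: "linear sym_emb"
  using linear_compose[OF linear_relabel linear_sym_of_coords] by (simp add: sym_emb_def[abs_def] o_def)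

lemma continuous_on_sym_emb [continuous_intros]:
  "continuous_on S f \<Longrightarrow> continuous_on S (\<lambda>x. sym_emb (f x))"
  using linear_sym_emb bounded_linear.continuous_on linear_conv_bounded_linear by blast

lemma measurable_sym_emb [measurable]: "sym_emb \<in> borel_measurable borel"
  by (intro borel_measurable_continuous_onI continuous_intros)

lemma range_sym_emb: "range sym_emb = (sym_matrices :: (real^'n::finite^'n) set)"
proof -
  have "range (relabel :: real^('n::finite uprod ordered_copy) \<Rightarrow> _) = UNIV"
    by (rule surjI[of _ unlabel]) simp
  then show ?thesis unfolding sym_emb_def range_sym_of_coords[symmetric] by (simp only: image_image[symmetric])
qed

lemma sym_emb_sym [simp]: "sym_emb c \<in> sym_matrices"
  using range_sym_emb by blast

lemma inner_sym_emb: "sym_emb c \<bullet> sym_emb d = c \<bullet> d"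
proof -
  have "sym_emb c \<bullet> sym_emb d = trace (sym_emb c ** sym_emb d)"
    by (simp add: inner_matrix_eq_trace sym_matricesD)
  then show ?thesis by (simp add: sym_emb_def trace_sym_of_coords inner_relabel)
qed

text \<open>The adjoint of an isometry is a left inverse of it, and it is linear on all square
  matrices.\<close>

definition sym_coords :: "real^'n^'n \<Rightarrow> real^('n::finite uprod ordered_copy)" where
  "sym_coords = adjoint sym_emb"

lemma linear_sym_coords: "linear sym_coords"
  unfolding sym_coords_def by (rule adjoint_linear[OF linear_sym_emb])

lemma continuous_on_sym_coords [continuous_intros]:
  "continuous_on S f \<Longrightarrow> continuous_on S (\<lambda>x. sym_coords (f x))"
  using linear_sym_coords bounded_linear.continuous_on linear_conv_bounded_linear by blast

lemma sym_coords_emb [simp]: "sym_coords (sym_emb c) = c"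
proof -
  have "d \<bullet> sym_coords (sym_emb c) = d \<bullet> c" for d
    unfolding sym_coords_def adjoint_works[OF linear_sym_emb] inner_sym_emb ..
  then show ?thesis using vector_eq_ldot[of "sym_coords (sym_emb c)" c] by blast
qed

lemma sym_emb_coords:
  assumes "x \<in> sym_matrices" shows "sym_emb (sym_coords x) = x"
proof -
  have "x \<in> range sym_emb" using assms by (simp only: range_sym_emb)
  then show ?thesis by auto
qed

lemma norm_sym_emb: "norm (sym_emb c) = norm c"
  by (simp add: norm_eq_sqrt_inner inner_sym_emb)

lemma sym_lborel_eq: "sym_lborel = distr lborel borel sym_emb"
proof -
  have r: "relabel \<in> borel_measurable (borel :: (real^('n::finite uprod ordered_copy)) measure)"
    by (intro borel_measurable_continuous_onI linear_continuous_on)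
       (simp add: linear_relabel linear_conv_bounded_linear[symmetric])
  have s: "(sym_of_coords :: _ \<Rightarrow> real^'n^'n) \<in> borel_measurable borel"
    by (intro borel_measurable_continuous_onI linear_continuous_on)
       (simp add: linear_sym_of_coords linear_conv_bounded_linear[symmetric])
  have "(sym_lborel :: (real^'n^'n) measure) = distr (distr lborel borel relabel) borel sym_of_coords"
    unfolding sym_lborel_def lborel_relabel[symmetric] ..
  also have "\<dots> = distr lborel borel (sym_of_coords \<circ> relabel)"
    using r s by (intro distr_distr) auto
  also have "sym_of_coords \<circ> relabel = sym_emb" by (auto simp: sym_emb_def)
  finally show ?thesis .
qed

lemma sets_sym_lborel [simp, measurable_cong]: "sets sym_lborel = sets borel"
  by (simp add: sym_lborel_def)

lemma space_sym_lborel [simp]: "space sym_lborel = UNIV"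
  by (simp add: sym_lborel_def)

lemma nn_integral_sym_lborel:
  "h \<in> borel_measurable borel \<Longrightarrow> (\<integral>\<^sup>+x. h x \<partial>sym_lborel) = (\<integral>\<^sup>+c. h (sym_emb c) \<partial>lborel)"
  unfolding sym_lborel_eq by (rule nn_integral_distr) auto

lemma emeasure_sym_lborel:
  "A \<in> sets borel \<Longrightarrow> emeasure sym_lborel A = emeasure lborel (sym_emb -` A)"
  unfolding sym_lborel_eq by (subst emeasure_distr) auto

lemma bounded_vimage_sym_emb: "bounded A \<Longrightarrow> bounded (sym_emb -` A)"
  unfolding bounded_iff
  by (auto simp: norm_sym_emb[symmetric])

lemma emeasure_sym_lborel_finite:
  assumes "bounded A" "A \<in> sets borel" shows "emeasure sym_lborel A < \<infinity>"
  using emeasure_bounded_finite[OF bounded_vimage_sym_emb[OF assms(1)]] assms(2)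
  by (simp add: emeasure_sym_lborel)

lemma sigma_finite_sym_lborel: "sigma_finite_measure (sym_lborel :: (real^'n^'n) measure)"
proof
  let ?A = "range (\<lambda>n :: nat. cball (0 :: real^'n^'n) (real n))"
  have cover: "\<Union>?A = space sym_lborel"
    using real_arch_simple by (auto simp: dist_norm)
  have fin: "\<forall>a\<in>?A. emeasure sym_lborel a \<noteq> \<infinity>"
    using emeasure_sym_lborel_finite[OF bounded_cball] by (auto simp: less_top[symmetric])
  have sub: "countable ?A" "?A \<subseteq> sets sym_lborel" by auto
  show "\<exists>A. countable A \<and> A \<subseteq> sets (sym_lborel :: (real^'n^'n) measure) \<and>
      \<Union>A = space sym_lborel \<and> (\<forall>a\<in>A. emeasure sym_lborel a \<noteq> \<infinity>)"
    by (rule exI[of _ ?A], intro conjI sub cover fin)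
qed

lemma lborel_linear:
  fixes f :: "real^'k::{finite,wellorder} \<Rightarrow> real^'k::_"
  assumes f: "linear f" and g: "linear g" and fg: "f \<circ> g = id" "g \<circ> f = id"
  shows "lborel = density (distr lborel borel f) (\<lambda>_. ennreal \<bar>det (matrix f)\<bar>)"
proof (rule lborel_eqI)
  have [measurable]: "f \<in> borel_measurable borel"
    using f by (intro borel_measurable_continuous_onI linear_continuous_on)
      (simp add: linear_conv_bounded_linear[symmetric])
  fix l u :: "real^'k::_" assume le: "\<And>b. b \<in> Basis \<Longrightarrow> l \<bullet> b \<le> u \<bullet> b"
  have vim: "f -` box l u = g ` box l u"
    using fg by (auto simp: fun_eq_iff image_iff) metis
  have gm: "g ` box l u \<in> lmeasurable" by (rule measurable_linear_image[OF g]) simp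
  have sb: "g ` box l u \<in> sets borel"
    unfolding vim[symmetric] using measurable_sets[of f borel borel "box l u"] by simp
  have "matrix f ** matrix g = mat 1"
    using matrix_compose[OF g f] fg(1) by (simp add: matrix_id_mat_1)
  then have "det (matrix f) * det (matrix g) = 1" by (simp add: det_mul[symmetric])
  then have det: "\<bar>det (matrix f)\<bar> * \<bar>det (matrix g)\<bar> = 1" by (simp add: abs_mult[symmetric])
  have "emeasure lborel (g ` box l u) = emeasure lebesgue (g ` box l u)" using sb by simp
  also have "\<dots> = ennreal (measure lebesgue (g ` box l u))" by (rule emeasure_eq_measure2[OF gm])
  also have "\<dots> = ennreal (\<bar>det (matrix g)\<bar> * measure lebesgue (box l u))"
    by (subst measure_linear_image[OF g]) simp_all
  finally have "emeasure (density (distr lborel borel f) (\<lambda>_. ennreal \<bar>det (matrix f)\<bar>)) (box l u) =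
      ennreal (\<bar>det (matrix f)\<bar> * \<bar>det (matrix g)\<bar> * measure lebesgue (box l u))"
    by (simp add: emeasure_density_const emeasure_distr vim ennreal_mult[symmetric] mult.assoc)
  also have "\<dots> = (\<Prod>b\<in>Basis. (u - l) \<bullet> b)"
    using le by (simp add: det)
  finally show "emeasure (density (distr lborel borel f) (\<lambda>_. ennreal \<bar>det (matrix f)\<bar>)) (box l u) =
      (\<Prod>b\<in>Basis. (u - l) \<bullet> b)" .
qed simp

definition sym_conj :: "real^'n^'n \<Rightarrow> real^('n::finite uprod ordered_copy) \<Rightarrow> real^('n uprod ordered_copy)" where
  "sym_conj g c = sym_coords (g ** sym_emb c ** transpose g)"

text \<open>The factor by which congruence by \<open>g\<close> scales volume on symmetric matrices.
  The determinant is never expanded: multiplicativity, continuity, positivity and the value at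
  scalar matrices determine it on square roots.\<close>

definition conj_jacobian :: "real^'n^'n \<Rightarrow> real" where
  "conj_jacobian g = \<bar>det (matrix (sym_conj g))\<bar>"

lemma conj_sym: "x \<in> sym_matrices \<Longrightarrow> g ** x ** transpose g \<in> sym_matrices"
  by (simp add: sym_matrices_def matrix_transpose_mul matrix_mul_assoc)

lemma sym_emb_conj: "sym_emb (sym_conj g c) = g ** sym_emb c ** transpose g"
  by (simp add: sym_conj_def sym_emb_coords conj_sym)

lemma linear_sym_conj: "linear (sym_conj g)"
  unfolding sym_conj_def
  by (rule linearI)
     (simp_all add: linear_add[OF linear_sym_emb] linear_scale[OF linear_sym_emb] matrix_ring_simps
        linear_add[OF linear_sym_coords] linear_scale[OF linear_sym_coords])

lemma sym_conj_mult: "sym_conj (g ** h) = sym_conj g \<circ> sym_conj h"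
proof
  fix c
  have "(g ** h) ** sym_emb c ** transpose (g ** h) = g ** (h ** sym_emb c ** transpose h) ** transpose g"
    by (simp only: matrix_transpose_mul matrix_mul_assoc)
  then show "sym_conj (g ** h) c = (sym_conj g \<circ> sym_conj h) c"
    by (simp only: o_apply sym_conj_def[of g] sym_conj_def[of "g ** h"] sym_emb_conj)
qed

lemma sym_conj_1: "sym_conj (mat 1) = id"
  by (auto simp: sym_conj_def)

lemma conj_jacobian_mult: "conj_jacobian (g ** h) = conj_jacobian g * conj_jacobian h"
  unfolding conj_jacobian_def sym_conj_mult matrix_compose[OF linear_sym_conj linear_sym_conj] det_mul abs_mult ..

lemma conj_jacobian_1: "conj_jacobian (mat 1) = 1"
  by (simp add: conj_jacobian_def sym_conj_1 matrix_id_mat_1)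

lemma conj_jacobian_pos:
  assumes "invertible g" shows "0 < conj_jacobian g"
proof -
  obtain h where "g ** h = mat 1" using assms unfolding invertible_def by blast
  then have "conj_jacobian g * conj_jacobian h = 1" using conj_jacobian_mult[of g h] by (simp add: conj_jacobian_1)
  then have "conj_jacobian g \<noteq> 0" by auto
  then show ?thesis by (simp add: conj_jacobian_def)
qed

lemma continuous_on_conj_jacobian [continuous_intros]:
  assumes "continuous_on S f" shows "continuous_on S (\<lambda>x. conj_jacobian (f x))"
proof -
  have "continuous_on S (\<lambda>x. matrix (sym_conj (f x)))"
    unfolding matrix_def sym_conj_def
    by (intro continuous_on_vec_lambda continuous_on_component continuous_on_sym_coords
        continuous_on_matrix_mult continuous_on_transpose continuous_on_const assms)
  then show ?thesis unfolding conj_jacobian_def by (intro continuous_on_rabs continuous_on_det)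
qed

lemma nn_integral_conj:
  assumes g: "invertible g" and h: "h \<in> borel_measurable borel"
  shows "(\<integral>\<^sup>+x. h x \<partial>sym_lborel) = ennreal (conj_jacobian g) * (\<integral>\<^sup>+x. h (g ** x ** transpose g) \<partial>sym_lborel)"
proof -
  obtain k where k: "g ** k = mat 1" "k ** g = mat 1" using g unfolding invertible_def by blast
  have gk: "sym_conj g \<circ> sym_conj k = id" "sym_conj k \<circ> sym_conj g = id"
    by (simp_all only: sym_conj_mult[symmetric] k sym_conj_1)
  have [measurable]: "sym_conj g \<in> borel_measurable borel"
    using linear_sym_conj[of g] by (intro borel_measurable_continuous_onI linear_continuous_on)
      (simp add: linear_conv_bounded_linear[symmetric])
  have c: "(\<lambda>x. g ** x ** transpose g) \<in> borel_measurable borel"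
    by (intro borel_measurable_continuous_onI continuous_intros)
  note h [measurable]
  have "(\<integral>\<^sup>+x. h x \<partial>sym_lborel) = (\<integral>\<^sup>+c. h (sym_emb c) \<partial>lborel)"
    by (rule nn_integral_sym_lborel[OF h])
  also have "\<dots> = (\<integral>\<^sup>+c. h (sym_emb c) \<partial>density (distr lborel borel (sym_conj g)) (\<lambda>_. ennreal (conj_jacobian g)))"
    using lborel_linear[OF linear_sym_conj linear_sym_conj gk] by (simp add: conj_jacobian_def)
  also have "\<dots> = ennreal (conj_jacobian g) * (\<integral>\<^sup>+c. h (sym_emb (sym_conj g c)) \<partial>lborel)"
    by (simp add: nn_integral_density nn_integral_cmult nn_integral_distr)
  also have "\<dots> = ennreal (conj_jacobian g) * (\<integral>\<^sup>+x. h (g ** x ** transpose g) \<partial>sym_lborel)"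
    unfolding sym_emb_conj by (subst nn_integral_sym_lborel) (use h c in measurable)
  finally show ?thesis .
qed

lemma conj_jacobian_scalar:
  assumes t: "0 < t"
  shows "conj_jacobian (sqrt t *\<^sub>R (mat 1 :: real^'n^'n)) = t ^ CARD('n uprod)"
proof -
  have "sym_conj (sqrt t *\<^sub>R (mat 1 :: real^'n^'n)) = (*\<^sub>R) t"
  proof
    fix c show "sym_conj (sqrt t *\<^sub>R (mat 1 :: real^'n^'n)) c = t *\<^sub>R c"
      using t by (simp add: sym_conj_def transpose_scalar matrix_ring_simps linear_scale[OF linear_sym_coords])
  qed
  moreover have "matrix ((*\<^sub>R) t) = t *\<^sub>R (mat 1 :: real^('n uprod ordered_copy)^('n uprod ordered_copy))"
    by (auto simp: matrix_scaleR vec_eq_iff mat_def)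
  moreover have "CARD('n uprod ordered_copy) = CARD('n uprod)"
    by (rule bij_betw_same_card[OF bij_Abs_ordered_copy, symmetric])
  ultimately show ?thesis using t by (simp add: conj_jacobian_def det_scaleR)
qed

text \<open>The logarithm of this Jacobian is a logarithmic Cauchy function, hence a multiple of
  \<open>ln (det w)\<close>. The factor is found at a scalar matrix: for size r, multiplication by t
  scales volume by t to the power r(r + 1)/2 and the determinant by t to the power r.\<close>

theorem conj_jacobian_mat_sqrt:
  fixes w :: "real^'n^'n"
  assumes w: "w \<in> pos_def_cone"
  shows "conj_jacobian (mat_sqrt w) = det w powr ((real CARD('n) + 1) / 2)"
    (is "_ = _ powr ?k")
proof -
  define l where "l x = ln (conj_jacobian (mat_sqrt x))" for x :: "real^'n^'n"
  have J_pos: "0 < conj_jacobian (mat_sqrt x)" if "x \<in> pos_def_cone" for x :: "real^'n^'n"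
    by (intro conj_jacobian_pos pos_def_invertible mat_sqrt_pos_def that)
  have J_sq: "conj_jacobian x = conj_jacobian (mat_sqrt x) * conj_jacobian (mat_sqrt x)"
    if "x \<in> pos_def_cone" for x :: "real^'n^'n"
    using conj_jacobian_mult[of "mat_sqrt x" "mat_sqrt x"] by (simp add: mat_sqrt_square[OF that])
  have "log_cauchy l"
  proof
    show "continuous_on pos_def_cone l"
      unfolding l_def using J_pos
      by (intro continuous_on_ln continuous_on_conj_jacobian continuous_on_mat_sqrt) force
    fix x y :: "real^'n^'n" assume x: "x \<in> pos_def_cone" and y: "y \<in> pos_def_cone"
    let ?z = "mat_sqrt y ** x ** mat_sqrt y"
    have z: "?z \<in> pos_def_cone" by (rule pos_def_conj_sqrt[OF y x])
    \<comment> \<open>The root of \<open>?z\<close> is not a product of the roots of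
      \<open>x\<close> and \<open>y\<close>, but its square is \<open>?z\<close>. So
      multiplicativity gives the squared identity, and positivity removes the squares.\<close>
    have "(conj_jacobian (mat_sqrt ?z))\<^sup>2 = (conj_jacobian (mat_sqrt x) * conj_jacobian (mat_sqrt y))\<^sup>2"
      using J_sq[OF z] J_sq[OF x] by (simp add: conj_jacobian_mult power2_eq_square mult_ac)
    then have "conj_jacobian (mat_sqrt ?z) = conj_jacobian (mat_sqrt x) * conj_jacobian (mat_sqrt y)"
      using J_pos[OF x] J_pos[OF y] J_pos[OF z] by - (rule power2_eq_imp_eq, auto)
    then show "l ?z = l x + l y"
      using J_pos[OF x] J_pos[OF y] by (simp add: l_def ln_mult_pos)
  qed
  then obtain p where p: "\<And>x. x \<in> pos_def_cone \<Longrightarrow> l x = p * ln (det x)"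
    by (rule log_cauchy.l_eq_ln_det) blast
  have "exp 1 *\<^sub>R (mat 1 :: real^'n^'n) \<in> pos_def_cone" by (simp add: pos_def_scaleR)
  from p[OF this] have "real CARD('n uprod) = p * real CARD('n)"
    using mat_sqrt_scaleR[OF pos_def_mat_1[where 'a='n], of "exp 1"]
    by (simp add: l_def conj_jacobian_scalar det_scaleR ln_realpow)
  moreover have "real CARD('n uprod) = real CARD('n) * ?k"
    unfolding card_UNIV_uprod by (simp add: real_of_nat_div algebra_simps)
  ultimately have "p = ?k" by simp
  then have "ln (conj_jacobian (mat_sqrt w)) = ?k * ln (det w)" using p[OF w] by (simp add: l_def)
  then have "exp (ln (conj_jacobian (mat_sqrt w))) = det w powr ?k"
    using det_pos_def[OF w] by (simp add: powr_def)
  then show ?thesis using J_pos[OF w] by simp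
qed

section \<open>The joint density of the transformed matrices\<close>

lemma pos_def_cone_open_Int:
  obtains T where "open T" "(pos_def_cone :: (real^'n^'n) set) = sym_matrices \<inter> T"
  using openin_pos_def_cone unfolding openin_open by auto

lemma borel_pos_def_cone [measurable]: "(pos_def_cone :: (real^'n^'n) set) \<in> sets borel"
proof -
  obtain T where T: "open T" "(pos_def_cone :: (real^'n^'n) set) = sym_matrices \<inter> T"
    by (rule pos_def_cone_open_Int)
  show ?thesis
    unfolding T(2) by (intro sets.Int borel_closed borel_open closed_sym_matrices T(1))
qed

text \<open>By Cramer's rule the entries are quotients of determinants with denominator
  \<open>det a\<close>.\<close>

lemma continuous_on_matrix_inv: "continuous_on pos_def_cone (matrix_inv :: real^'n^'n \<Rightarrow> _)"
proof (subst continuous_on_cong[OF refl])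
  fix a :: "real^'n^'n" assume a: "a \<in> pos_def_cone"
  have "matrix_inv a $ i $ k = det (\<chi> p q. if q = i then axis k 1 $ p else a $ p $ q) / det a" for i k
  proof -
    have "a *v (matrix_inv a *v axis k 1) = axis k 1"
      by (simp add: matrix_vector_mul_assoc matrix_inv_right_pos_def[OF a])
    then have "matrix_inv a *v axis k 1 = (\<chi> i. det (\<chi> p q. if q = i then axis k 1 $ p else a $ p $ q) / det a)"
      using cramer[of a] det_pos_def[OF a] by simp
    then show ?thesis by (simp add: matrix_vector_mult_basis column_def vec_eq_iff)
  qed
  then show "matrix_inv a = (\<chi> i k. det (\<chi> p q. if q = i then axis k 1 $ p else a $ p $ q) / det a)"
    by (simp add: vec_eq_iff)
next
  show "continuous_on pos_def_cone (\<lambda>a :: real^'n^'n.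
      \<chi> i k. det (\<chi> p q. if q = i then axis k 1 $ p else a $ p $ q) / det a)"
  proof (intro continuous_on_vec_lambda continuous_on_divide continuous_on_det continuous_on_id ballI)
    fix i k p q :: 'n
    show "continuous_on pos_def_cone (\<lambda>a. if q = i then axis k 1 $ p else a $ p $ q)"
      by (cases "q = i") (auto intro!: continuous_intros)
  qed (use det_pos_def in force)
qed

section \<open>The transformation of the pair and its Jacobian\<close>

definition kummer_inv :: "real^'n^'n \<Rightarrow> real^'n^'n \<Rightarrow> real^'n^'n" where
  "kummer_inv x y = quad_rep (matrix_inv (mat_sqrt (mat 1 + x))) y"

lemma kummer_inv_pos_def [simp]:
  assumes x: "x \<in> pos_def_cone" and y: "y \<in> pos_def_cone"
  shows "kummer_inv x y \<in> pos_def_cone"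
proof -
  have i: "matrix_inv (mat_sqrt (mat 1 + x)) \<in> pos_def_cone"
    using x by (intro matrix_inv_pos_def mat_sqrt_pos_def) simp
  from pos_def_conj[OF pos_def_invertible[OF i] y] show ?thesis
    by (simp add: kummer_inv_def quad_rep_def pos_def_sym[OF i])
qed

lemma kummer_inv_map [simp]:
  assumes x: "x \<in> pos_def_cone"
  shows "kummer_inv x (kummer_map x u) = u"
proof -
  note s = mat_sqrt_pos_def[OF pos_def_1_add[OF x]]
  have "kummer_inv x (kummer_map x u) = (matrix_inv (mat_sqrt (mat 1 + x)) ** mat_sqrt (mat 1 + x)) ** u **
      (mat_sqrt (mat 1 + x) ** matrix_inv (mat_sqrt (mat 1 + x)))"
    unfolding kummer_inv_def kummer_map_def quad_rep_def by (simp only: matrix_mul_assoc)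
  then show ?thesis by (simp add: matrix_inv_pos_def[OF s])
qed

lemma kummer_map_inv [simp]:
  assumes x: "x \<in> pos_def_cone"
  shows "kummer_map x (kummer_inv x y) = y"
proof -
  note s = mat_sqrt_pos_def[OF pos_def_1_add[OF x]]
  have "kummer_map x (kummer_inv x y) = (mat_sqrt (mat 1 + x) ** matrix_inv (mat_sqrt (mat 1 + x))) ** y **
      (matrix_inv (mat_sqrt (mat 1 + x)) ** mat_sqrt (mat 1 + x))"
    unfolding kummer_inv_def kummer_map_def quad_rep_def by (simp only: matrix_mul_assoc)
  then show ?thesis by (simp add: matrix_inv_pos_def[OF s])
qed

lemma continuous_on_sqrt_1_add [continuous_intros]:
  assumes "continuous_on S f" "\<And>w. w \<in> S \<Longrightarrow> f w \<in> pos_def_cone"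
  shows "continuous_on S (\<lambda>w. mat_sqrt (mat 1 + f w))"
  by (rule continuous_on_compose2[OF continuous_on_mat_sqrt])
     (use assms in \<open>auto intro!: continuous_intros\<close>)

lemma continuous_on_kummer_map [continuous_intros]:
  assumes "continuous_on S f" "continuous_on S h" "\<And>w. w \<in> S \<Longrightarrow> f w \<in> pos_def_cone"
  shows "continuous_on S (\<lambda>w. kummer_map (f w) (h w))"
  unfolding kummer_map_def
  by (intro continuous_on_matrix_mult continuous_on_sqrt_1_add assms)

lemma continuous_on_kummer_inv [continuous_intros]:
  assumes "continuous_on S f" "continuous_on S h" "\<And>w. w \<in> S \<Longrightarrow> f w \<in> pos_def_cone"
  shows "continuous_on S (\<lambda>w. kummer_inv (f w) (h w))"
proof -
  have "continuous_on S (\<lambda>w. matrix_inv (mat_sqrt (mat 1 + f w)))"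
    by (rule continuous_on_compose2[OF continuous_on_matrix_inv continuous_on_sqrt_1_add[OF assms(1,3)]])
       (use assms(3) in \<open>auto intro!: mat_sqrt_pos_def\<close>)
  then show ?thesis unfolding kummer_inv_def quad_rep_def
    by (intro continuous_on_matrix_mult assms)
qed

text \<open>
  The square root and the inverse are only controlled on the cone, so measurability is stated for
  maps that are continuous on products of the cone.
\<close>

lemma measurable_on_cone:
  fixes h :: "(real^'n^'n) \<times> (real^'n^'n) \<Rightarrow> 'b::real_normed_vector"
  assumes "continuous_on (pos_def_cone \<times> pos_def_cone) h"
  shows "(\<lambda>p. indicator (pos_def_cone \<times> pos_def_cone) p *\<^sub>R h p) \<in> borel_measurable (borel \<Otimes>\<^sub>M borel)"
proof -
  have "(pos_def_cone \<times> pos_def_cone :: ((real^'n^'n) \<times> (real^'n^'n)) set) \<in> sets (borel \<Otimes>\<^sub>M borel)"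
    by (intro pair_measureI borel_pos_def_cone)
  then show ?thesis unfolding borel_prod by (intro borel_measurable_continuous_on_indicator assms)
qed

lemma sets_on_cone:
  fixes h :: "(real^'n^'n) \<times> (real^'n^'n) \<Rightarrow> 'b::real_normed_vector"
  assumes h: "continuous_on (pos_def_cone \<times> pos_def_cone) h" and A: "A \<in> sets borel"
  shows "{p \<in> pos_def_cone \<times> pos_def_cone. h p \<in> A} \<in> sets (borel \<Otimes>\<^sub>M borel)"
proof -
  let ?C = "pos_def_cone \<times> pos_def_cone :: ((real^'n^'n) \<times> (real^'n^'n)) set"
  have C: "?C \<in> sets (borel \<Otimes>\<^sub>M borel)" by (intro pair_measureI borel_pos_def_cone)
  have "(\<lambda>p. indicator ?C p *\<^sub>R h p) -` A \<inter> space (borel \<Otimes>\<^sub>M borel) \<in> sets (borel \<Otimes>\<^sub>M borel)"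
    by (rule measurable_sets[OF measurable_on_cone[OF h] A])
  then have "(\<lambda>p. indicator ?C p *\<^sub>R h p) -` A \<inter> space (borel \<Otimes>\<^sub>M borel) \<inter> ?C \<in> sets (borel \<Otimes>\<^sub>M borel)"
    using C by (rule sets.Int)
  moreover have "(\<lambda>p. indicator ?C p *\<^sub>R h p) -` A \<inter> space (borel \<Otimes>\<^sub>M borel) \<inter> ?C = {p \<in> ?C. h p \<in> A}"
    by (auto simp: space_pair_measure)
  ultimately show ?thesis by simp
qed

lemma nn_integral_kummer_map:
  assumes x: "x \<in> pos_def_cone" and h: "h \<in> borel_measurable borel"
  shows "(\<integral>\<^sup>+y. h y \<partial>sym_lborel) =
    ennreal (conj_jacobian (mat_sqrt (mat 1 + x))) * (\<integral>\<^sup>+u. h (kummer_map x u) \<partial>sym_lborel)"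
proof -
  have s: "mat_sqrt (mat 1 + x) \<in> pos_def_cone" using x by (simp add: mat_sqrt_pos_def)
  from nn_integral_conj[OF pos_def_invertible[OF s] h] show ?thesis
    by (simp only: kummer_map_def pos_def_sym[OF s])
qed

definition jac :: "real^'n^'n \<Rightarrow> real" where
  "jac x = conj_jacobian (mat_sqrt (mat 1 + x))"

lemma jac_pos: "x \<in> pos_def_cone \<Longrightarrow> 0 < jac x"
  unfolding jac_def by (intro conj_jacobian_pos pos_def_invertible mat_sqrt_pos_def) simp

lemma continuous_on_jac [continuous_intros]:
  "continuous_on S f \<Longrightarrow> (\<And>w. w \<in> S \<Longrightarrow> f w \<in> pos_def_cone) \<Longrightarrow> continuous_on S (\<lambda>w. jac (f w))"
  unfolding jac_def by (intro continuous_on_conj_jacobian continuous_on_sqrt_1_add)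

locale kummer_independence = prob_space M for M :: "'a measure" +
  fixes X Y U V :: "'a \<Rightarrow> real^'n^'n" and f g :: "real^'n^'n \<Rightarrow> real"
  assumes X_pos: "\<And>\<omega>. \<omega> \<in> space M \<Longrightarrow> X \<omega> \<in> pos_def_cone"
    and Y_pos: "\<And>\<omega>. \<omega> \<in> space M \<Longrightarrow> Y \<omega> \<in> pos_def_cone"
    and XY: "indep_var borel X borel Y"
    and f_pos: "\<And>x. x \<in> pos_def_cone \<Longrightarrow> 0 < f x" and f_cont: "continuous_on pos_def_cone f"
    and g_pos: "\<And>x. x \<in> pos_def_cone \<Longrightarrow> 0 < g x" and g_cont: "continuous_on pos_def_cone g"
    and X_dist: "distributed M sym_lborel X (\<lambda>x. ennreal (f x * indicator pos_def_cone x))"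
    and Y_dist: "distributed M sym_lborel Y (\<lambda>x. ennreal (g x * indicator pos_def_cone x))"
    and U_eq: "U = (\<lambda>\<omega>. kummer_inv (X \<omega>) (Y \<omega>))"
    and V_eq: "V = (\<lambda>\<omega>. kummer_map (U \<omega>) (X \<omega>))"
    and UV: "indep_var borel U borel V"
begin

text \<open>The density of \<open>(U, V)\<close>. With \<open>x = kummer_inv u v\<close> and
  \<open>y = kummer_map x u\<close>, the factor \<open>jac x\<close> comes from passing from
  \<open>y\<close> to \<open>u\<close> at fixed \<open>x\<close>, and the division by
  \<open>jac u\<close> from passing from \<open>x\<close> to \<open>v\<close> at fixed
  \<open>u\<close>.\<close>

definition joint :: "real^'n^'n \<Rightarrow> real^'n^'n \<Rightarrow> real" where
  "joint u v = f (kummer_inv u v) * jac (kummer_inv u v) * g (kummer_map (kummer_inv u v) u) / jac u"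

lemma joint_pos: "u \<in> pos_def_cone \<Longrightarrow> v \<in> pos_def_cone \<Longrightarrow> 0 < joint u v"
  by (simp add: joint_def f_pos g_pos jac_pos)

lemma continuous_on_joint: "continuous_on (pos_def_cone \<times> pos_def_cone) (\<lambda>(u, v). joint u v)"
  unfolding joint_def split_beta
  by (intro continuous_intros continuous_on_compose2[OF f_cont] continuous_on_compose2[OF g_cont])
     (auto dest: jac_pos)

text \<open>The nonlinear change from \<open>(x, y)\<close> to \<open>(u, v)\<close> passes through
  \<open>(x, u)\<close>: at fixed \<open>x\<close> the matrix \<open>y\<close> is linear in
  \<open>u\<close>, and at fixed \<open>u\<close> the matrix \<open>v\<close> is linear in
  \<open>x\<close>. With the order of integration exchanged in between, only Jacobians of linear
  congruences occur.\<close>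

lemma emeasure_UV:
  assumes A: "A \<in> sets borel" "A \<subseteq> pos_def_cone" and B: "B \<in> sets borel" "B \<subseteq> pos_def_cone"
  shows "emeasure M ((\<lambda>\<omega>. (U \<omega>, V \<omega>)) -` (A \<times> B) \<inter> space M) =
    (\<integral>\<^sup>+u. \<integral>\<^sup>+v. indicator A u * indicator B v * ennreal (joint u v) \<partial>sym_lborel \<partial>sym_lborel)"
proof -
  let ?\<mu> = "sym_lborel :: (real^'n^'n) measure"
  let ?C = "pos_def_cone \<times> pos_def_cone :: ((real^'n^'n) \<times> (real^'n^'n)) set"
  interpret S: sigma_finite_measure ?\<mu> by (rule sigma_finite_sym_lborel)
  interpret P: pair_sigma_finite ?\<mu> ?\<mu> ..
  have sets_pair: "sets (?\<mu> \<Otimes>\<^sub>M ?\<mu>) = sets (borel \<Otimes>\<^sub>M borel)"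
    by (intro sets_pair_measure_cong) simp_all
  have meas_eq: "borel_measurable (?\<mu> \<Otimes>\<^sub>M ?\<mu>) = (borel_measurable (borel \<Otimes>\<^sub>M borel) :: (_ \<Rightarrow> ennreal) set)"
    by (rule measurable_cong_sets[OF sets_pair refl])
  define \<phi> where "\<phi> x = ennreal (f x * indicator pos_def_cone x)" for x
  define \<gamma> where "\<gamma> x = ennreal (g x * indicator pos_def_cone x)" for x
  have \<phi>[measurable]: "\<phi> \<in> borel_measurable borel"
    using distributed_borel_measurable[OF X_dist] by (simp add: \<phi>_def[abs_def])
  have \<gamma>[measurable]: "\<gamma> \<in> borel_measurable borel"
    using distributed_borel_measurable[OF Y_dist] by (simp add: \<gamma>_def[abs_def])
  \<comment> \<open>The event in the coordinates \<open>(x, y)\<close>; \<open>H'\<close> is the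
    same event in the intermediate coordinates \<open>(x, u)\<close>, and \<open>\<theta>\<close> is
    the integrand there.\<close>
  define H where "H = {p \<in> ?C. (kummer_inv (fst p) (snd p), kummer_map (kummer_inv (fst p) (snd p)) (fst p)) \<in> A \<times> B}"
  define H' where "H' = {p \<in> ?C. (snd p, kummer_map (snd p) (fst p)) \<in> A \<times> B}"
  have AB: "A \<times> B \<in> sets borel" unfolding borel_prod[symmetric] using A B by (intro pair_measureI)
  have H: "H \<in> sets (borel \<Otimes>\<^sub>M borel)"
    unfolding H_def by (rule sets_on_cone[OF _ AB]) (auto intro!: continuous_intros)
  have H': "H' \<in> sets (borel \<Otimes>\<^sub>M borel)"
    unfolding H'_def by (rule sets_on_cone[OF _ AB]) (auto intro!: continuous_intros)
  define \<theta> where "\<theta> p = ennreal (indicator ?C p *\<^sub>R (f (fst p) * jac (fst p) * g (kummer_map (fst p) (snd p)))) * indicator H' p" for p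
  have \<theta>[measurable]: "\<theta> \<in> borel_measurable (borel \<Otimes>\<^sub>M borel)"
  proof -
    have "continuous_on ?C (\<lambda>p. f (fst p) * jac (fst p) * g (kummer_map (fst p) (snd p)))"
      by (intro continuous_intros continuous_on_compose2[OF f_cont] continuous_on_compose2[OF g_cont]) auto
    from measurable_on_cone[OF this] show ?thesis
      unfolding \<theta>_def using H' by (intro borel_measurable_times_ennreal measurable_compose[OF _ measurable_ennreal] borel_measurable_indicator)
  qed
  have "indep_var sym_lborel X sym_lborel Y"
    using XY unfolding indep_var_eq sets_sym_lborel measurable_cong_sets[OF refl sets_sym_lborel] .
  from distributed_joint_indep[OF sigma_finite_sym_lborel sigma_finite_sym_lborel X_dist Y_dist this]
  have joint: "distributed M (?\<mu> \<Otimes>\<^sub>M ?\<mu>) (\<lambda>\<omega>. (X \<omega>, Y \<omega>)) (\<lambda>(x, y). \<phi> x * \<gamma> y)"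
    unfolding \<phi>_def \<gamma>_def .
  have "(\<lambda>\<omega>. (U \<omega>, V \<omega>)) -` (A \<times> B) \<inter> space M = (\<lambda>\<omega>. (X \<omega>, Y \<omega>)) -` H \<inter> space M"
    using X_pos Y_pos by (auto simp: H_def V_eq U_eq)
  then have "emeasure M ((\<lambda>\<omega>. (U \<omega>, V \<omega>)) -` (A \<times> B) \<inter> space M) =
      (\<integral>\<^sup>+p. (case p of (x, y) \<Rightarrow> \<phi> x * \<gamma> y) * indicator H p \<partial>(?\<mu> \<Otimes>\<^sub>M ?\<mu>))"
    using distributed_emeasure[OF joint, of H] H sets_pair by simp
  also have "\<dots> = (\<integral>\<^sup>+x. \<integral>\<^sup>+y. \<phi> x * \<gamma> y * indicator H (x, y) \<partial>?\<mu> \<partial>?\<mu>)"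
  proof (subst S.nn_integral_fst[symmetric])
    show "(\<lambda>p. (case p of (x, y) \<Rightarrow> \<phi> x * \<gamma> y) * indicator H p) \<in> borel_measurable (?\<mu> \<Otimes>\<^sub>M ?\<mu>)"
      unfolding meas_eq using H by measurable
  qed simp
  also have "\<dots> = (\<integral>\<^sup>+x. \<integral>\<^sup>+u. \<theta> (x, u) \<partial>?\<mu> \<partial>?\<mu>)"
  proof (rule nn_integral_cong)
    fix x :: "real^'n^'n"
    show "(\<integral>\<^sup>+y. \<phi> x * \<gamma> y * indicator H (x, y) \<partial>?\<mu>) = (\<integral>\<^sup>+u. \<theta> (x, u) \<partial>?\<mu>)"
    proof (cases "x \<in> pos_def_cone")
      case False
      then show ?thesis by (simp add: \<phi>_def \<theta>_def)
    next
      case x: True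
      have "Pair x -` H \<in> sets borel" using sets_Pair1[OF H] .
      then have "(\<lambda>y. \<phi> x * \<gamma> y * indicator (Pair x -` H) y) \<in> borel_measurable borel" by measurable
      moreover have ind: "indicator H (x, y) = (indicator (Pair x -` H) y :: ennreal)" for y
        by (simp add: indicator_def)
      ultimately have "(\<integral>\<^sup>+y. \<phi> x * \<gamma> y * indicator H (x, y) \<partial>?\<mu>) =
          ennreal (jac x) * (\<integral>\<^sup>+u. \<phi> x * \<gamma> (kummer_map x u) * indicator H (x, kummer_map x u) \<partial>?\<mu>)"
        unfolding ind using nn_integral_kummer_map[OF x] by (simp add: jac_def)
      also have "\<dots> = (\<integral>\<^sup>+u. ennreal (jac x) * (\<phi> x * \<gamma> (kummer_map x u) * indicator H (x, kummer_map x u)) \<partial>?\<mu>)"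
      proof (rule nn_integral_cmult[symmetric])
        have "(\<lambda>u. kummer_map x u) \<in> borel_measurable borel"
          unfolding kummer_map_def by (intro borel_measurable_continuous_onI continuous_intros)
        from measurable_compose[OF this \<open>(\<lambda>y. \<phi> x * \<gamma> y * indicator (Pair x -` H) y) \<in> borel_measurable borel\<close>]
        show "(\<lambda>u. \<phi> x * \<gamma> (kummer_map x u) * indicator H (x, kummer_map x u)) \<in> borel_measurable ?\<mu>"
          by (simp add: ind)
      qed
      also have "\<dots> = (\<integral>\<^sup>+u. \<theta> (x, u) \<partial>?\<mu>)"
      proof (rule nn_integral_cong)
        fix u :: "real^'n^'n"
        show "ennreal (jac x) * (\<phi> x * \<gamma> (kummer_map x u) * indicator H (x, kummer_map x u)) = \<theta> (x, u)"
        proof (cases "u \<in> A")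
          case True
          then have u: "u \<in> pos_def_cone" using A by blast
          have "(x, kummer_map x u) \<in> H \<longleftrightarrow> (x, u) \<in> H'"
            using x u by (simp add: H_def H'_def)
          then show ?thesis
            using x u f_pos[OF x] g_pos[OF kummer_map_pos_def[OF x u]] jac_pos[OF x]
            by (simp add: \<theta>_def \<phi>_def \<gamma>_def indicator_def ennreal_mult less_imp_le mult_ac)
        next
          case False
          then show ?thesis using x by (simp add: H_def H'_def \<theta>_def)
        qed
      qed
      finally show ?thesis .
    qed
  qed
  also have "\<dots> = (\<integral>\<^sup>+u. \<integral>\<^sup>+x. \<theta> (x, u) \<partial>?\<mu> \<partial>?\<mu>)"
    using P.Fubini[of \<theta>] \<theta> unfolding meas_eq by simp
  also have "\<dots> = (\<integral>\<^sup>+u. \<integral>\<^sup>+v. indicator A u * indicator B v * ennreal (joint u v) \<partial>?\<mu> \<partial>?\<mu>)"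
  proof (rule nn_integral_cong)
    fix u :: "real^'n^'n"
    show "(\<integral>\<^sup>+x. \<theta> (x, u) \<partial>?\<mu>) = (\<integral>\<^sup>+v. indicator A u * indicator B v * ennreal (joint u v) \<partial>?\<mu>)"
    proof (cases "u \<in> A")
      case False
      then show ?thesis by (simp add: \<theta>_def H'_def)
    next
      case uA: True
      then have u: "u \<in> pos_def_cone" using A by blast
      have t: "(\<lambda>x. \<theta> (x, u)) \<in> borel_measurable borel" by measurable
      have i: "(\<lambda>v. kummer_inv u v) \<in> borel_measurable borel"
        unfolding kummer_inv_def quad_rep_def by (intro borel_measurable_continuous_onI continuous_intros)
      have m: "(\<lambda>v. \<theta> (kummer_inv u v, u)) \<in> borel_measurable borel"
        by (rule measurable_compose[OF i t])
      \<comment> \<open>The substitution is applied to the composite with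
        \<open>kummer_inv u\<close>, which cancels against \<open>kummer_map u\<close>; this leaves
        \<open>jac u\<close> to be divided out.\<close>
      have "(\<integral>\<^sup>+v. \<theta> (kummer_inv u v, u) \<partial>?\<mu>) = ennreal (jac u) * (\<integral>\<^sup>+x. \<theta> (x, u) \<partial>?\<mu>)"
        using nn_integral_kummer_map[OF u m] by (simp add: jac_def kummer_inv_map[OF u])
      then have "ennreal (1 / jac u) * (\<integral>\<^sup>+v. \<theta> (kummer_inv u v, u) \<partial>?\<mu>) =
          ennreal (1 / jac u) * ennreal (jac u) * (\<integral>\<^sup>+x. \<theta> (x, u) \<partial>?\<mu>)"
        by (simp add: mult.assoc)
      also have "ennreal (1 / jac u) * ennreal (jac u) = 1"
        using jac_pos[OF u] by (simp add: ennreal_mult[symmetric])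
      finally have "(\<integral>\<^sup>+x. \<theta> (x, u) \<partial>?\<mu>) = (\<integral>\<^sup>+v. ennreal (1 / jac u) * \<theta> (kummer_inv u v, u) \<partial>?\<mu>)"
        using m by (subst nn_integral_cmult) auto
      also have "\<dots> = (\<integral>\<^sup>+v. indicator A u * indicator B v * ennreal (joint u v) \<partial>?\<mu>)"
      proof (rule nn_integral_cong)
        fix v :: "real^'n^'n"
        show "ennreal (1 / jac u) * \<theta> (kummer_inv u v, u) = indicator A u * indicator B v * ennreal (joint u v)"
        proof (cases "v \<in> B")
          case True
          then have v: "v \<in> pos_def_cone" using B by blast
          have x: "kummer_inv u v \<in> pos_def_cone" using u v by simp
          show ?thesis
            using uA True u v x jac_pos[OF u] jac_pos[OF x] f_pos[OF x] g_pos[OF kummer_map_pos_def[OF x u]]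
            by (simp add: \<theta>_def H'_def joint_def ennreal_mult[symmetric] less_imp_le)
        next
          case False
          then show ?thesis using u by (simp add: \<theta>_def H'_def)
        qed
      qed
      finally show ?thesis .
    qed
  qed
  finally show ?thesis .
qed

end

section \<open>Separation of the joint density\<close>

lemma emeasure_lborel_open_pos:
  assumes "open S" "S \<noteq> {}" shows "emeasure lborel S \<noteq> (0 :: ennreal)"
proof
  assume "emeasure lborel S = 0"
  then have "S \<in> null_sets lebesgue"
    using assms by (intro null_sets_completionI) (simp add: null_sets_def)
  then have "negligible S" by (simp add: negligible_iff_null_sets)
  then show False using open_not_negligible[OF assms] by simp
qed

definition cone_ball :: "real^'n^'n \<Rightarrow> real \<Rightarrow> (real^'n^'n) set" where
  "cone_ball a e = ball a e \<inter> pos_def_cone"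

lemma sets_cone_ball [measurable]: "cone_ball a e \<in> sets borel"
  unfolding cone_ball_def by (intro sets.Int borel_open open_ball borel_pos_def_cone)

lemma emeasure_sym_lborel_open_pos:
  assumes a: "a \<in> T" "a \<in> sym_matrices" and T: "open T"
  shows "emeasure sym_lborel T \<noteq> 0"
proof -
  have "sym_coords a \<in> sym_emb -` T" using a by (simp add: sym_emb_coords)
  then have "sym_emb -` T \<noteq> {}" by blast
  moreover have "open (sym_emb -` T)"
    by (intro open_vimage T continuous_on_sym_emb continuous_on_id)
  ultimately have "emeasure lborel (sym_emb -` T) \<noteq> 0" by (intro emeasure_lborel_open_pos)
  then show ?thesis using T by (simp add: emeasure_sym_lborel)
qed

text \<open>The measure charges symmetric matrices only, and among these the cone is cut out by an
  open set, so the ball may be replaced by an open one.\<close>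

lemma emeasure_cone_ball:
  fixes a :: "real^'n^'n"
  assumes a: "a \<in> pos_def_cone" and e: "0 < e"
  obtains m where "0 < m" "emeasure sym_lborel (cone_ball a e) = ennreal m"
proof -
  obtain T where T: "open T" "(pos_def_cone :: (real^'n^'n) set) = sym_matrices \<inter> T"
    by (rule pos_def_cone_open_Int)
  have "sym_emb -` cone_ball a e = sym_emb -` (ball a e \<inter> T)"
    unfolding cone_ball_def T(2) by auto
  then have "emeasure sym_lborel (cone_ball a e) = emeasure sym_lborel (ball a e \<inter> T)"
    using T(1) by (simp add: emeasure_sym_lborel)
  also have "\<dots> \<noteq> 0"
    using a e T by (intro emeasure_sym_lborel_open_pos[of a]) auto
  finally have "emeasure sym_lborel (cone_ball a e) \<noteq> 0" .
  moreover have "emeasure sym_lborel (cone_ball a e) < \<infinity>"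
    by (rule emeasure_sym_lborel_finite) (auto simp: cone_ball_def intro: bounded_subset[OF bounded_ball])
  ultimately show thesis
    by (intro that[of "measure sym_lborel (cone_ball a e)"])
       (auto simp: measure_def enn2real_positive_iff less_top zero_less_iff_neq_zero)
qed

context kummer_independence begin

definition prob_box :: "(real^'n^'n) set \<Rightarrow> (real^'n^'n) set \<Rightarrow> real" where
  "prob_box A B = prob ((\<lambda>\<omega>. (U \<omega>, V \<omega>)) -` (A \<times> B) \<inter> space M)"

text \<open>By independence both sides are the product of the same four marginal
  probabilities.\<close>

lemma prob_box_mult:
  assumes "A \<in> sets borel" "B \<in> sets borel" "A' \<in> sets borel" "B' \<in> sets borel"
  shows "prob_box A B * prob_box A' B' = prob_box A B' * prob_box A' B"
  unfolding prob_box_def by (simp add: indep_varD[OF UV] assms)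

text \<open>Says that the mean of \<open>joint\<close> over the box around \<open>(a, b)\<close> is
  within \<open>\<eta>\<close> of \<open>joint a b\<close>. The volumes are real numbers
  \<open>m\<close> and \<open>n\<close>, so that later estimates stay within the reals.\<close>

definition box_bounds :: "real \<Rightarrow> real^'n^'n \<Rightarrow> real^'n^'n \<Rightarrow> real \<Rightarrow> bool" where
  "box_bounds \<eta> a b e \<longleftrightarrow> (\<forall>m>0. \<forall>n>0. emeasure sym_lborel (cone_ball a e) = ennreal m \<longrightarrow>
     emeasure sym_lborel (cone_ball b e) = ennreal n \<longrightarrow>
     (joint a b - \<eta>) * (m * n) \<le> prob_box (cone_ball a e) (cone_ball b e) \<and>
     prob_box (cone_ball a e) (cone_ball b e) \<le> (joint a b + \<eta>) * (m * n))"

lemma eventually_box_bounds: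
  assumes a: "a \<in> pos_def_cone" and b: "b \<in> pos_def_cone" and \<eta>: "0 < \<eta>" "\<eta> < joint a b"
  shows "eventually (box_bounds \<eta> a b) (at_right 0)"
proof -
  obtain d where d: "0 < d" "\<And>p. p \<in> pos_def_cone \<times> pos_def_cone \<Longrightarrow> dist p (a, b) < d \<Longrightarrow>
      dist (case p of (u, v) \<Rightarrow> joint u v) (joint a b) < \<eta>"
    using continuous_on_joint a b \<eta>(1) unfolding continuous_on_iff by fastforce
  have "eventually (\<lambda>e. e \<in> {0<..<d / 2}) (at_right 0)"
    using d(1) by (intro eventually_at_right_real) simp
  then show ?thesis
    unfolding box_bounds_def
  proof (rule eventually_mono, intro allI impI)
    fix e m n :: real assume e: "e \<in> {0<..<d / 2}" and mn: "0 < m" "0 < n"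
      and m: "emeasure sym_lborel (cone_ball a e) = ennreal m"
      and n: "emeasure sym_lborel (cone_ball b e) = ennreal n"
    let ?A = "cone_ball a e" and ?B = "cone_ball b e"
    have near: "\<bar>joint u v - joint a b\<bar> < \<eta>" if "u \<in> ?A" "v \<in> ?B" for u v
    proof -
      have "dist (u, v) (a, b) \<le> dist u a + dist v b"
        unfolding dist_Pair_Pair by (rule sqrt_sum_squares_le_sum) auto
      also have "\<dots> < e + e" using that by (auto simp: cone_ball_def dist_commute)
      finally have "dist (u, v) (a, b) < d" using e by simp
      then show ?thesis using d(2)[of "(u, v)"] that by (simp add: cone_ball_def dist_real_def)
    qed
    have const: "(\<integral>\<^sup>+u. \<integral>\<^sup>+v. indicator ?A u * indicator ?B v * ennreal c \<partial>sym_lborel \<partial>sym_lborel)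
        = ennreal (c * (m * n))" if "0 \<le> c" for c
    proof -
      have "(\<integral>\<^sup>+v. indicator ?A u * indicator ?B v * ennreal c \<partial>sym_lborel) = indicator ?A u * (ennreal n * ennreal c)" for u
      proof -
        have "(\<integral>\<^sup>+v. indicator ?A u * indicator ?B v * ennreal c \<partial>sym_lborel) =
            (\<integral>\<^sup>+v. (indicator ?A u * ennreal c) * indicator ?B v \<partial>sym_lborel)"
          by (simp add: mult_ac)
        also have "\<dots> = (indicator ?A u * ennreal c) * emeasure sym_lborel ?B"
          by (rule nn_integral_cmult_indicator) simp
        finally show ?thesis by (simp add: n mult_ac)
      qed
      then have "(\<integral>\<^sup>+u. \<integral>\<^sup>+v. indicator ?A u * indicator ?B v * ennreal c \<partial>sym_lborel \<partial>sym_lborel) =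
          (\<integral>\<^sup>+u. (ennreal n * ennreal c) * indicator ?A u \<partial>sym_lborel)" by (simp add: mult_ac)
      also have "\<dots> = (ennreal n * ennreal c) * emeasure sym_lborel ?A"
        by (rule nn_integral_cmult_indicator) simp
      also have "\<dots> = ennreal (c * (m * n))"
        unfolding m using mn that by (simp add: ennreal_mult[symmetric] mult_ac)
      finally show ?thesis .
    qed
    have box: "ennreal (prob_box ?A ?B) =
        (\<integral>\<^sup>+u. \<integral>\<^sup>+v. indicator ?A u * indicator ?B v * ennreal (joint u v) \<partial>sym_lborel \<partial>sym_lborel)"
      unfolding prob_box_def emeasure_eq_measure[symmetric]
      by (intro emeasure_UV sets_cone_ball) (auto simp: cone_ball_def)
    have lo: "ennreal (joint a b - \<eta>) \<le> ennreal (joint u v)"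
      and hi: "ennreal (joint u v) \<le> ennreal (joint a b + \<eta>)" if "u \<in> ?A" "v \<in> ?B" for u v
      using near[OF that] by (auto intro!: ennreal_leI simp del: ennreal_plus)
    have "ennreal ((joint a b - \<eta>) * (m * n)) =
        (\<integral>\<^sup>+u. \<integral>\<^sup>+v. indicator ?A u * indicator ?B v * ennreal (joint a b - \<eta>) \<partial>sym_lborel \<partial>sym_lborel)"
      using \<eta>(2) by (intro const[symmetric]) simp
    also have "\<dots> \<le> ennreal (prob_box ?A ?B)"
      unfolding box by (intro nn_integral_mono) (simp add: indicator_def lo)
    finally have "ennreal ((joint a b - \<eta>) * (m * n)) \<le> ennreal (prob_box ?A ?B)" .
    moreover have "ennreal (prob_box ?A ?B) \<le>
        (\<integral>\<^sup>+u. \<integral>\<^sup>+v. indicator ?A u * indicator ?B v * ennreal (joint a b + \<eta>) \<partial>sym_lborel \<partial>sym_lborel)"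
      unfolding box by (intro nn_integral_mono) (simp add: indicator_def hi del: ennreal_plus)
    then have "ennreal (prob_box ?A ?B) \<le> ennreal ((joint a b + \<eta>) * (m * n))"
      using \<eta> const[of "joint a b + \<eta>"] by (simp del: ennreal_plus)
    ultimately show "(joint a b - \<eta>) * (m * n) \<le> prob_box ?A ?B \<and>
        prob_box ?A ?B \<le> (joint a b + \<eta>) * (m * n)"
      using \<eta> mn by (auto simp: prob_box_def ennreal_le_iff)
  qed
qed

text \<open>For given \<open>\<eta>\<close>, sufficiently small boxes give the inequality up to
  \<open>\<eta>\<close>: the same four volumes occur on both sides of \<open>prob_box_mult\<close>
  and cancel. Then \<open>\<eta>\<close> tends to 0. Exchanging \<open>b\<close> and
  \<open>b'\<close> later gives equality.\<close>

lemma joint_rectangle_le: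
  assumes a: "a \<in> pos_def_cone" "a' \<in> pos_def_cone" and b: "b \<in> pos_def_cone" "b' \<in> pos_def_cone"
  shows "joint a b * joint a' b' \<le> joint a b' * joint a' b"
proof -
  \<comment> \<open>For \<open>\<eta>\<close> below this minimum the lower bounds
    \<open>joint a b - \<eta>\<close> and \<open>joint a' b' - \<eta>\<close> are positive, as is
    needed to multiply inequalities.\<close>
  define c where "c = Min {joint a b, joint a' b', joint a b', joint a' b}"
  have c: "0 < c" "c \<le> joint a b" "c \<le> joint a' b'" "c \<le> joint a b'" "c \<le> joint a' b"
    using a b by (auto simp: c_def joint_pos)
  have "(joint a b - \<eta>) * (joint a' b' - \<eta>) \<le> (joint a b' + \<eta>) * (joint a' b + \<eta>)" if \<eta>: "0 < \<eta>" "\<eta> < c" for \<eta>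
  proof -
    have "eventually (\<lambda>e. 0 < e \<and> box_bounds \<eta> a b e \<and> box_bounds \<eta> a' b' e \<and>
        box_bounds \<eta> a b' e \<and> box_bounds \<eta> a' b e) (at_right 0)"
      using \<eta> c by (intro eventually_conj eventually_at_right_less eventually_box_bounds a b) auto
    from eventually_happens'[OF trivial_limit_at_right_real this] obtain e where e: "0 < e"
      "box_bounds \<eta> a b e" "box_bounds \<eta> a' b' e" "box_bounds \<eta> a b' e" "box_bounds \<eta> a' b e"
      by blast
    obtain m m' n n' where
      m: "0 < m" "emeasure sym_lborel (cone_ball a e) = ennreal m" and
      m': "0 < m'" "emeasure sym_lborel (cone_ball a' e) = ennreal m'" and
      n: "0 < n" "emeasure sym_lborel (cone_ball b e) = ennreal n" and
      n': "0 < n'" "emeasure sym_lborel (cone_ball b' e) = ennreal n'"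
      using emeasure_cone_ball[OF a(1) e(1)] emeasure_cone_ball[OF a(2) e(1)]
        emeasure_cone_ball[OF b(1) e(1)] emeasure_cone_ball[OF b(2) e(1)] by metis
    have "((joint a b - \<eta>) * (m * n)) * ((joint a' b' - \<eta>) * (m' * n')) \<le>
        prob_box (cone_ball a e) (cone_ball b e) * prob_box (cone_ball a' e) (cone_ball b' e)"
      using e(2,3) c \<eta> m n m' n' by (intro mult_mono) (auto simp: box_bounds_def prob_box_def)
    also have "\<dots> = prob_box (cone_ball a e) (cone_ball b' e) * prob_box (cone_ball a' e) (cone_ball b e)"
      by (intro prob_box_mult) auto
    also have "\<dots> \<le> ((joint a b' + \<eta>) * (m * n')) * ((joint a' b + \<eta>) * (m' * n))"
      using e(4,5) c \<eta> m n m' n' by (intro mult_mono) (auto simp: box_bounds_def prob_box_def)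
    finally have "(joint a b - \<eta>) * (joint a' b' - \<eta>) * (m * n * m' * n') \<le>
        (joint a b' + \<eta>) * (joint a' b + \<eta>) * (m * n * m' * n')"
      by (simp only: mult_ac)
    then show ?thesis using m n m' n' by (simp add: mult_le_cancel_right)
  qed
  then have ev: "eventually (\<lambda>\<eta>. (joint a b - \<eta>) * (joint a' b' - \<eta>) \<le> (joint a b' + \<eta>) * (joint a' b + \<eta>)) (at_right 0)"
    using eventually_at_right_real[OF c(1)] by (auto elim!: eventually_mono)
  have "((\<lambda>\<eta>. (joint a b - \<eta>) * (joint a' b' - \<eta>)) \<longlongrightarrow> (joint a b - 0) * (joint a' b' - 0)) (at_right 0)"
    "((\<lambda>\<eta>. (joint a b' + \<eta>) * (joint a' b + \<eta>)) \<longlongrightarrow> (joint a b' + 0) * (joint a' b + 0)) (at_right 0)"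
    by (intro tendsto_intros)+
  from tendsto_le[OF trivial_limit_at_right_real this(2) this(1) ev] show ?thesis by simp
qed

lemma joint_rectangle:
  assumes "a \<in> pos_def_cone" "a' \<in> pos_def_cone" "b \<in> pos_def_cone" "b' \<in> pos_def_cone"
  shows "joint a b * joint a' b' = joint a b' * joint a' b"
  using joint_rectangle_le[of a a' b b'] joint_rectangle_le[of a a' b' b] assms by simp

text \<open>The rectangle identity with base point \<open>(mat 1, mat 1)\<close> splits
  \<open>joint\<close> into a function of \<open>u\<close> times a function of \<open>v\<close>. At
  \<open>v = kummer_map u x\<close> one has \<open>kummer_inv u v = x\<close>, so logarithms give
  the equation.\<close>

lemma kummer_equation_densities:
  "kummer_equation (\<lambda>x. ln (f x) + ln (jac x)) (\<lambda>y. ln (g y))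
     (\<lambda>u. ln (joint u (mat 1)) + ln (jac u)) (\<lambda>v. ln (joint (mat 1) v) - ln (joint (mat 1) (mat 1)))"
proof
  show "continuous_on pos_def_cone (\<lambda>y. ln (g y))"
    using g_cont g_pos by (intro continuous_on_ln) force+
  have "continuous_on pos_def_cone (\<lambda>v. case (mat 1, v) of (u, v) \<Rightarrow> joint u v)"
    by (rule continuous_on_compose2[OF continuous_on_joint]) (auto intro!: continuous_intros)
  then show "continuous_on pos_def_cone (\<lambda>v. ln (joint (mat 1) v) - ln (joint (mat 1) (mat 1)))"
    using joint_pos[of "mat 1"] by (intro continuous_on_diff continuous_on_ln continuous_on_const) force+
  fix x u :: "real^'n^'n" assume x: "x \<in> pos_def_cone" and u: "u \<in> pos_def_cone"
  let ?v = "kummer_map u x"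
  have v: "?v \<in> pos_def_cone" using x u by simp
  have "joint u ?v = f x * jac x * g (kummer_map x u) / jac u"
    by (simp add: joint_def u)
  then have "ln (joint u ?v) = ln (f x) + ln (jac x) + ln (g (kummer_map x u)) - ln (jac u)"
    using f_pos[OF x] jac_pos[OF x] jac_pos[OF u] g_pos[OF kummer_map_pos_def[OF x u]]
    by (simp add: ln_div ln_mult_pos)
  moreover have "ln (joint u ?v) + ln (joint (mat 1) (mat 1)) = ln (joint u (mat 1)) + ln (joint (mat 1) ?v)"
    using joint_rectangle[OF u pos_def_mat_1 v pos_def_mat_1] u v
    by (simp add: ln_mult_pos[symmetric] joint_pos)
  ultimately show "ln (f x) + ln (jac x) + ln (g (kummer_map x u)) =
      ln (joint u (mat 1)) + ln (jac u) + (ln (joint (mat 1) ?v) - ln (joint (mat 1) (mat 1)))"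
    by linarith
qed

text \<open>The equation determines \<open>ln (f x) + ln (jac x)\<close>, so the exponent of
  \<open>det (mat 1 + x)\<close> in \<open>f\<close> is \<open>- p\<close> diminished by the
  exponent of the Jacobian.\<close>

lemma densities:
  obtains p q c cF cG where
    "\<And>y. y \<in> pos_def_cone \<Longrightarrow> g y = exp cG * (det y powr p * exp (c * trace y))"
    "\<And>x. x \<in> pos_def_cone \<Longrightarrow> f x = exp cF * (det x powr q *
       det (mat 1 + x) powr (- (p + (real CARD('n) + 1) / 2)) * exp (c * trace x))"
proof -
  obtain p q c cF cG where
    G: "\<And>x. x \<in> pos_def_cone \<Longrightarrow> ln (g x) = cG + p * ln (det x) + c * trace x" and
    F: "\<And>x. x \<in> pos_def_cone \<Longrightarrow> ln (f x) + ln (jac x) =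
      cF + q * ln (det x) - p * ln (det (mat 1 + x)) + c * trace x"
    by (rule kummer_equation.solution[OF kummer_equation_densities]) blast
  show thesis
  proof (rule that[of cG p c cF q])
    fix x :: "real^'n^'n" assume x: "x \<in> pos_def_cone"
    note d = det_pos_def[OF x] det_pos_def[OF pos_def_1_add[OF x]]
    have "g x = exp (cG + p * ln (det x) + c * trace x)"
      using exp_ln[OF g_pos[OF x]] by (simp only: G[OF x])
    then show "g x = exp cG * (det x powr p * exp (c * trace x))"
      using d by (simp add: powr_def exp_add)
    have neg: "- (p + k) * L = - (p * L) - k * L" for k L :: real by (simp add: algebra_simps)
    have "ln (jac x) = (real CARD('n) + 1) / 2 * ln (det (mat 1 + x))"
      using d by (simp add: jac_def conj_jacobian_mat_sqrt[OF pos_def_1_add[OF x]] ln_powr)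
    then have "ln (f x) = cF + (q * ln (det x) + - (p + (real CARD('n) + 1) / 2) * ln (det (mat 1 + x)) + c * trace x)"
      using F[OF x] neg[of "(real CARD('n) + 1) / 2" "ln (det (mat 1 + x))"] by linarith
    then have "exp (ln (f x)) = exp cF * (exp (q * ln (det x)) *
        exp (- (p + (real CARD('n) + 1) / 2) * ln (det (mat 1 + x))) * exp (c * trace x))"
      by (simp only: exp_add)
    then show "f x = exp cF * (det x powr q *
       det (mat 1 + x) powr (- (p + (real CARD('n) + 1) / 2)) * exp (c * trace x))"
      using d f_pos[OF x] by (simp add: powr_def)
  qed
qed

end

section \<open>Integrability and parameters\<close>

text \<open>As \<open>q + 1 \<le> 0\<close>, the integrand is at least \<open>C / (t - t0)\<close>,
  whose integral diverges logarithmically at \<open>t0\<close>.\<close>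

lemma nn_integral_powr_infinite:
  assumes k: "0 < k" and q: "q \<le> -1" and t0: "t0 < (1::real)"
  shows "(\<integral>\<^sup>+t. ennreal ((k * (t - t0)) powr q) * indicator {t0<..<1} t \<partial>lborel) = \<infinity>"
    (is "?I = _")
proof -
  define d where "d = 1 - t0"
  have d: "0 < d" using t0 by (simp add: d_def)
  define C where "C = k powr q * (d powr (q + 1))"
  have C: "0 < C" using k d by (simp add: C_def)
  have lower: "C * (1 / (t - t0)) \<le> (k * (t - t0)) powr q" if "t0 < t" "t < 1" for t
  proof -
    have t: "0 < t - t0" "t - t0 \<le> d" using that by (simp_all add: d_def)
    have "d powr (q + 1) \<le> (t - t0) powr (q + 1)" using t q by (intro powr_mono2') auto
    then have "C * (1 / (t - t0)) \<le> k powr q * ((t - t0) powr (q + 1) * (1 / (t - t0)))"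
      using t k unfolding C_def mult.assoc by (intro mult_left_mono mult_right_mono) auto
    also have "(t - t0) powr (q + 1) * (1 / (t - t0)) = (t - t0) powr q"
      using t by (simp add: powr_add)
    finally show ?thesis using k t by (simp add: powr_mult)
  qed
  have bound: "ennreal (C * real n) \<le> ?I" for n
  proof -
    \<comment> \<open>With these endpoints the integral of \<open>1 / (t - t0)\<close> is
      \<open>n + ln 2\<close>; the division by 2 keeps \<open>t0 + e\<close> below \<open>b\<close>
      also for \<open>n = 0\<close>.\<close>
    define e where "e = d * exp (- (real n + 1)) / 2"
    define b where "b = t0 + d * exp (- 1) "
    have e: "0 < e" "e < d * exp (-1)" "d * exp (-1) < d"
    proof -
      show "0 < e" using d by (simp add: e_def)
      have "exp (- (real n + 1)) \<le> exp (- 1)" by simp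
      then have "exp (- (real n + 1)) / 2 < exp (- 1)" using exp_gt_zero[of "-1::real"] by linarith
      then show "e < d * exp (-1)" using d by (simp add: e_def)
      show "d * exp (-1) < d" using d by simp
    qed
    have "(\<integral>\<^sup>+t. ennreal (C * (1 / (t - t0))) * indicator {t0 + e .. b} t \<partial>lborel) =
        ennreal (C * ln (b - t0) - C * ln (t0 + e - t0))"
    proof (rule nn_integral_FTC_Icc)
      show "DERIV (\<lambda>t. C * ln (t - t0)) t :> C * (1 / (t - t0))" if "t \<in> {t0 + e..b}" for t
        using that e by (auto intro!: derivative_eq_intros)
      show "0 \<le> C * (1 / (t - t0))" if "t \<in> {t0 + e..b}" for t
        using that e C by auto
      show "t0 + e \<le> b" using e by (simp add: b_def)
    qed measurable
    also have "C * ln (b - t0) - C * ln (t0 + e - t0) = C * (real n + ln 2)"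
      using d by (simp add: b_def e_def ln_div ln_mult_pos algebra_simps)
    finally have 1: "(\<integral>\<^sup>+t. ennreal (C * (1 / (t - t0))) * indicator {t0 + e .. b} t \<partial>lborel) =
        ennreal (C * (real n + ln 2))" .
    have "ennreal (C * real n) \<le> ennreal (C * (real n + ln 2))"
      using C by (intro ennreal_leI mult_left_mono) auto
    also have "\<dots> \<le> ?I"
      unfolding 1[symmetric] using e lower
      by (intro nn_integral_mono) (auto simp: indicator_def b_def d_def intro!: ennreal_leI)
    finally show ?thesis .
  qed
  show ?thesis
  proof (rule ccontr)
    assume "?I \<noteq> \<infinity>"
    then obtain r where r: "?I = ennreal r" "0 \<le> r" by (cases ?I) auto
    obtain n where "r / C < real n" using reals_Archimedean2 by blast
    then have "r < C * real n" using C by (simp add: field_simps)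
    then show False using bound[of n] r by (simp add: ennreal_le_iff)
  qed
qed

lemma nn_integral_sym_translate:
  assumes E: "E \<in> sym_matrices" and h: "h \<in> borel_measurable borel"
  shows "(\<integral>\<^sup>+x. h (x + E) \<partial>sym_lborel) = (\<integral>\<^sup>+x. h x \<partial>sym_lborel)"
proof -
  have [measurable]: "(\<lambda>x. h (x + E)) \<in> borel_measurable borel" using h by measurable
  note h [measurable]
  have "(\<integral>\<^sup>+x. h (x + E) \<partial>sym_lborel) = (\<integral>\<^sup>+c. h (sym_emb (sym_coords E + c)) \<partial>lborel)"
    by (simp add: nn_integral_sym_lborel linear_add[OF linear_sym_emb] sym_emb_coords[OF E] add.commute)
  also have "\<dots> = (\<integral>\<^sup>+c. h (sym_emb c) \<partial>distr lborel borel ((+) (sym_coords E)))"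
    by (subst nn_integral_distr) auto
  finally show ?thesis by (simp add: lborel_distr_plus nn_integral_sym_lborel)
qed

lemma matrix_unit_vec: "matrix_unit i i *v v = (v $ i) *\<^sub>R axis i (1::real)"
proof -
  have "(\<Sum>l\<in>UNIV. (if k = i \<and> l = i then 1 else 0) * v $ l) =
      (\<Sum>l\<in>UNIV. if l = i then (if k = i then v $ i else 0) else 0)" for k
    by (intro sum.cong) auto
  then show ?thesis by (auto simp: matrix_vector_mult_def matrix_unit_def vec_eq_iff axis_def)
qed

lemma matrix_unit_sym: "matrix_unit i i \<in> sym_matrices"
  by (simp add: sym_matrices_def transpose_matrix_unit)

text \<open>Here \<open>\<theta>\<close> is the diagonal entry \<open>(y\<^sup>-\<^sup>1)\<^sub>i\<^sub>i\<close>.\<close>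

lemma pos_def_rank_one:
  assumes y: "y \<in> pos_def_cone"
  obtains \<theta> where "0 < \<theta>" "\<And>s. det (y - s *\<^sub>R matrix_unit i i) = det y * (1 - s * \<theta>)"
    "\<And>s. 0 \<le> s \<Longrightarrow> s * \<theta> < 1 \<Longrightarrow> y - s *\<^sub>R matrix_unit i i \<in> pos_def_cone"
proof -
  define v where "v = matrix_inv y *v axis i 1"
  define \<theta> where "\<theta> = v $ i"
  have yv: "y *v v = axis i 1"
    by (simp add: v_def matrix_vector_mul_assoc matrix_inv_right_pos_def[OF y])
  have v0: "v \<noteq> 0" using yv by (auto simp: axis_eq_0_iff)
  have vyv: "v \<bullet> (y *v v) = \<theta>" by (simp add: yv \<theta>_def inner_axis)
  have \<theta>: "0 < \<theta>" using pos_defD[OF y v0] vyv by simp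
  have row: "y - s *\<^sub>R matrix_unit i i = (\<chi> k. if k = i then y $ i + (- s) *s axis i 1 else y $ k)" for s
    by (auto simp: vec_eq_iff matrix_unit_def axis_def)
  define \<beta> where "\<beta> = det (\<chi> k. if k = i then axis i 1 else y $ k)"
  have y_row: "(\<chi> k. if k = i then y $ i else y $ k) = y" by (simp add: vec_eq_iff)
  have affine: "det (y - s *\<^sub>R matrix_unit i i) = det y - s * \<beta>" for s
    unfolding row det_row_add det_row_mul y_row by (simp add: \<beta>_def)
  \<comment> \<open>A zero of the affine function \<open>det\<close> determines its slope. At
    \<open>s = 1 / \<theta>\<close> the vector \<open>v\<close> lies in the kernel.\<close>
  have "(y - (1 / \<theta>) *\<^sub>R matrix_unit i i) *v v = 0"
    using \<theta> by (simp add: matrix_vector_mult_diff_rdistrib scaleR_matrix_vector_assoc[symmetric]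
        matrix_unit_vec yv \<theta>_def)
  then have "\<not> invertible (y - (1 / \<theta>) *\<^sub>R matrix_unit i i)"
    using invertible_mult_vector_nonzero[OF _ v0] by blast
  then have "det (y - (1 / \<theta>) *\<^sub>R matrix_unit i i) = 0" by (simp add: invertible_det_nz)
  then have "det y - (1 / \<theta>) * \<beta> = 0" by (simp only: affine)
  then have \<beta>: "\<beta> = det y * \<theta>" using \<theta> by (simp add: field_simps)
  have det: "det (y - s *\<^sub>R matrix_unit i i) = det y * (1 - s * \<theta>)" for s
    unfolding affine \<beta> by (simp add: algebra_simps)
  have pd: "y - s *\<^sub>R matrix_unit i i \<in> pos_def_cone" if s: "0 \<le> s" "s * \<theta> < 1" for s
  proof (rule pos_def_coneI)
    show "transpose (y - s *\<^sub>R matrix_unit i i) = y - s *\<^sub>R matrix_unit i i"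
      by (simp add: transpose_diff transpose_scalar transpose_matrix_unit pos_def_sym[OF y])
    fix u :: "real^'a" assume u: "u \<noteq> 0"
    define a where "a = u \<bullet> (y *v u)"
    have a: "0 < a" using pos_defD[OF y u] by (simp add: a_def)
    have uyv: "u \<bullet> (y *v v) = u $ i" by (simp add: yv inner_axis)
    have "v v* y = axis i 1" using transpose_matrix_vector[of y v] pos_def_sym[OF y] yv by simp
    then have vyu: "v \<bullet> (y *v u) = u $ i"
      using dot_lmul_matrix[of v y u] by (simp add: inner_axis')
    \<comment> \<open>Nonnegativity of the form at this combination is Cauchy-Schwarz for the form
      of \<open>y\<close>, here \<open>(u $ i)\<^sup>2 \<le> \<theta> * a\<close>.\<close>
    have "(\<theta> *\<^sub>R u - (u $ i) *\<^sub>R v) \<bullet> (y *v (\<theta> *\<^sub>R u - (u $ i) *\<^sub>R v)) = \<theta> * (\<theta> * a - (u $ i)\<^sup>2)"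
      by (simp add: matrix_vector_mult_diff_distrib matrix_vector_mult_scaleR inner_diff_left inner_diff_right
          uyv vyu vyv a_def[symmetric] power2_eq_square algebra_simps)
    then have "0 \<le> \<theta> * (\<theta> * a - (u $ i)\<^sup>2)" using pos_def_nonneg[OF y] by metis
    then have "(u $ i)\<^sup>2 \<le> \<theta> * a" using \<theta> by (simp add: zero_le_mult_iff)
    then have "s * (u $ i)\<^sup>2 \<le> s * (\<theta> * a)" using s by (intro mult_left_mono) auto
    also have "\<dots> < a" using s a by (simp add: mult.assoc[symmetric])
    finally show "0 < u \<bullet> ((y - s *\<^sub>R matrix_unit i i) *v u)"
      by (simp add: matrix_vector_mult_diff_rdistrib scaleR_matrix_vector_assoc[symmetric] matrix_unit_vec
          inner_diff_right inner_axis a_def power2_eq_square)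
  qed
  from \<theta> det pd show thesis by (rule that)
qed

text \<open>
  Averaging over translations along one diagonal direction, in which the determinant is affine,
  reduces the claim to the divergence of the integral of \<open>t powr q\<close> at \<open>0\<close>.
\<close>

lemma det_powr_integrable_imp:
  fixes w :: "real^'n^'n \<Rightarrow> real"
  assumes lower: "\<And>R. \<exists>\<delta>>0. \<forall>x\<in>pos_def_cone. norm x \<le> R \<longrightarrow> \<delta> \<le> w x"
    and fin: "(\<integral>\<^sup>+x. ennreal (det x powr q * w x * indicator pos_def_cone x) \<partial>sym_lborel) < \<infinity>"
  shows "-1 < q"
proof (rule ccontr)
  assume "\<not> -1 < q"
  then have q: "q \<le> -1" by simp
  let ?\<mu> = "sym_lborel :: (real^'n^'n) measure"
  interpret S: sigma_finite_measure ?\<mu> by (rule sigma_finite_sym_lborel)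
  interpret P: pair_sigma_finite ?\<mu> "lborel :: real measure" ..
  define i :: 'n where "i = undefined"
  define E where "E = (matrix_unit i i :: real^'n^'n)"
  have E: "t *\<^sub>R E \<in> sym_matrices" for t
    unfolding E_def by (intro subspace_scale[OF subspace_sym_matrices] matrix_unit_sym)
  \<comment> \<open>A point of the cone for which \<open>y0 - E\<close> has the diagonal entry -1/4
    and so lies outside. Segments in direction \<open>E\<close> that start near
    \<open>y0 - E\<close> therefore enter the cone before \<open>t = 1\<close>.\<close>
  define y0 :: "real^'n^'n" where "y0 = mat 1 - (1/4) *\<^sub>R E"
  have "y0 = diag_matrix (\<lambda>k. if k = i then 3/4 else 1)"
    by (auto simp: y0_def E_def diag_matrix_def vec_eq_iff matrix_unit_def mat_def)
  then have y0: "y0 \<in> pos_def_cone" by (simp add: diag_matrix_pos_def)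
  define R where "R = norm y0 + 2 * norm E + 1"
  obtain \<delta> where \<delta>: "0 < \<delta>" "\<And>x. x \<in> pos_def_cone \<Longrightarrow> norm x \<le> R \<Longrightarrow> \<delta> \<le> w x"
    using lower[of R] by blast
  define \<phi> where "\<phi> x = ennreal (det x powr q) * indicator (pos_def_cone \<inter> cball 0 R) x" for x :: "real^'n^'n"
  have "(\<lambda>x :: real^'n^'n. det x) \<in> borel_measurable borel"
    by (intro borel_measurable_continuous_onI continuous_on_det continuous_on_id)
  then have \<phi>[measurable]: "\<phi> \<in> borel_measurable borel"
    unfolding \<phi>_def
    by (intro borel_measurable_times_ennreal borel_measurable_indicator sets.Int borel_pos_def_cone
        borel_closed closed_cball) measurable
  have "ennreal \<delta> * (\<integral>\<^sup>+x. \<phi> x \<partial>?\<mu>) = (\<integral>\<^sup>+x. ennreal \<delta> * \<phi> x \<partial>?\<mu>)"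
    by (intro nn_integral_cmult[symmetric]) measurable
  also have "\<dots> \<le> (\<integral>\<^sup>+x. ennreal (det x powr q * w x * indicator pos_def_cone x) \<partial>?\<mu>)"
  proof (rule nn_integral_mono)
    fix x :: "real^'n^'n"
    show "ennreal \<delta> * \<phi> x \<le> ennreal (det x powr q * w x * indicator pos_def_cone x)"
    proof (cases "x \<in> pos_def_cone \<inter> cball 0 R")
      case True
      then have "\<delta> * det x powr q \<le> w x * det x powr q" using \<delta>(2) by (intro mult_right_mono) auto
      then show ?thesis using True \<delta>(1)
        by (simp add: \<phi>_def ennreal_mult[symmetric] ennreal_leI mult.commute)
    qed (simp add: \<phi>_def)
  qed
  finally have "ennreal \<delta> * (\<integral>\<^sup>+x. \<phi> x \<partial>?\<mu>) < \<infinity>" using fin by (rule le_less_trans)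
  then have fin': "(\<integral>\<^sup>+x. \<phi> x \<partial>?\<mu>) < \<infinity>"
    using \<delta>(1) by (auto simp: ennreal_mult_less_top less_top)
  have m2: "(\<lambda>(x, t). \<phi> (x + t *\<^sub>R E) * indicator {0<..<1} t) \<in> borel_measurable (?\<mu> \<Otimes>\<^sub>M (lborel :: real measure))"
    by measurable
  have inner_inf: "(\<integral>\<^sup>+t. \<phi> (x + t *\<^sub>R E) * indicator {0<..<1} t \<partial>lborel) = \<infinity>"
    if x: "x \<in> sym_matrices" "x + E \<in> pos_def_cone" "x $ i $ i < 0" "norm (x + E) \<le> norm y0 + 1" for x
  proof -
    obtain \<theta> where \<theta>: "0 < \<theta>" "\<And>s. det (x + E - s *\<^sub>R E) = det (x + E) * (1 - s * \<theta>)"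
      "\<And>s. 0 \<le> s \<Longrightarrow> s * \<theta> < 1 \<Longrightarrow> x + E - s *\<^sub>R E \<in> pos_def_cone"
      using pos_def_rank_one[OF x(2), of i] unfolding E_def by blast
    have "x \<notin> pos_def_cone"
      using pos_defD[of x "axis i 1"] x(3) by (auto simp: matrix_vector_mult_basis inner_axis' column_def)
    \<comment> \<open>Otherwise subtracting all of \<open>E\<close> would stay in the cone. Hence
      the zero \<open>1 - 1 / \<theta>\<close> of the determinant along the segment is not
      negative.\<close>
    then have "1 \<le> \<theta>" using \<theta>(3)[of 1] by force
    define t0 where "t0 = 1 - 1 / \<theta>"
    have t0: "0 \<le> t0" "t0 < 1" using \<open>1 \<le> \<theta>\<close> by (auto simp: t0_def)
    have eq: "x + t *\<^sub>R E = x + E - (1 - t) *\<^sub>R E" for t by (simp add: algebra_simps)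
    have d: "0 < det (x + E) * \<theta>" using det_pos_def[OF x(2)] \<theta>(1) by simp
    have "(\<integral>\<^sup>+t. ennreal ((det (x + E) * \<theta> * (t - t0)) powr q) * indicator {t0<..<1} t \<partial>lborel) \<le>
        (\<integral>\<^sup>+t. \<phi> (x + t *\<^sub>R E) * indicator {0<..<1} t \<partial>lborel)"
    proof (rule nn_integral_mono)
      fix t :: real
      show "ennreal ((det (x + E) * \<theta> * (t - t0)) powr q) * indicator {t0<..<1} t \<le>
          \<phi> (x + t *\<^sub>R E) * indicator {0<..<1} t"
      proof (cases "t \<in> {t0<..<1}")
        case True
        have "(1 - t) * \<theta> < (1 - t0) * \<theta>" using True \<theta>(1) by simp
        then have lt: "(1 - t) * \<theta> < 1" using \<theta>(1) by (simp add: t0_def)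
        have pd: "x + t *\<^sub>R E \<in> pos_def_cone" unfolding eq using True lt by (intro \<theta>(3)) auto
        have det: "det (x + t *\<^sub>R E) = det (x + E) * \<theta> * (t - t0)"
          unfolding eq \<theta>(2) using \<theta>(1) by (simp add: t0_def field_simps)
        have "norm (x + t *\<^sub>R E) \<le> norm (x + E) + norm ((1 - t) *\<^sub>R E)"
          unfolding eq by (rule norm_triangle_ineq4)
        also have "norm ((1 - t) *\<^sub>R E) \<le> 1 * norm E"
          unfolding norm_scaleR using True t0 by (intro mult_right_mono) auto
        finally have "norm (x + t *\<^sub>R E) \<le> R" using x(4) norm_ge_zero[of E] unfolding R_def by linarith
        then show ?thesis using True t0 pd by (simp add: \<phi>_def det)
      qed simp
    qed
    then show ?thesis using nn_integral_powr_infinite[OF d q t0(2)] by (simp add: top_unique)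
  qed
  obtain e where e: "0 < e" "\<And>z. z \<in> sym_matrices \<Longrightarrow> dist z y0 < e \<Longrightarrow> z \<in> pos_def_cone"
    using openin_pos_def_cone y0 unfolding openin_euclidean_subtopology_iff by blast
  \<comment> \<open>The radius 1/8 keeps the entry at \<open>(i, i)\<close> below -1/4 + 1/8
    throughout \<open>N\<close>, hence negative.\<close>
  define e' where "e' = min e (1/8)"
  have e': "0 < e'" "e' \<le> e" "e' \<le> 1/8" using e(1) by (auto simp: e'_def)
  define N where "N = ball (y0 - E) e'"
  have N: "N \<in> sets borel" by (simp add: N_def)
  have "y0 - E \<in> sym_matrices"
    using y0 pos_def_subset_sym E[of 1] by (intro subspace_diff[OF subspace_sym_matrices]) auto
  then have N0: "emeasure ?\<mu> N \<noteq> 0"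
    unfolding N_def using e'(1) by (intro emeasure_sym_lborel_open_pos[of "y0 - E"]) auto
  have "(\<integral>\<^sup>+x. \<phi> x \<partial>?\<mu>) = (\<integral>\<^sup>+t. (\<integral>\<^sup>+x. \<phi> x \<partial>?\<mu>) * indicator {0<..<(1::real)} t \<partial>lborel)"
    by (subst nn_integral_cmult_indicator) auto
  also have "\<dots> = (\<integral>\<^sup>+t. (\<integral>\<^sup>+x. \<phi> (x + t *\<^sub>R E) * indicator {0<..<1} t \<partial>?\<mu>) \<partial>lborel)"
  proof (rule nn_integral_cong)
    fix t :: real
    have "(\<lambda>x. \<phi> (x + t *\<^sub>R E)) \<in> borel_measurable ?\<mu>" by measurable
    then show "(\<integral>\<^sup>+x. \<phi> x \<partial>?\<mu>) * indicator {0<..<1} t = (\<integral>\<^sup>+x. \<phi> (x + t *\<^sub>R E) * indicator {0<..<1} t \<partial>?\<mu>)"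
      by (simp add: nn_integral_multc nn_integral_sym_translate[OF E \<phi>])
  qed
  also have "\<dots> = (\<integral>\<^sup>+x. (\<integral>\<^sup>+t. \<phi> (x + t *\<^sub>R E) * indicator {0<..<1} t \<partial>lborel) \<partial>?\<mu>)"
    using P.Fubini[OF m2] by simp
  also have "\<dots> = (\<integral>\<^sup>+c. (\<integral>\<^sup>+t. \<phi> (sym_emb c + t *\<^sub>R E) * indicator {0<..<1} t \<partial>lborel) \<partial>lborel)"
  proof (rule nn_integral_sym_lborel)
    have "(\<lambda>x. \<integral>\<^sup>+t. \<phi> (x + t *\<^sub>R E) * indicator {0<..<1} t \<partial>lborel) \<in> borel_measurable ?\<mu>"
      using lborel.borel_measurable_nn_integral_fst[OF m2] by simp
    then show "(\<lambda>x. \<integral>\<^sup>+t. \<phi> (x + t *\<^sub>R E) * indicator {0<..<1} t \<partial>lborel) \<in> borel_measurable borel"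
      by simp
  qed
  also have "\<dots> \<ge> (\<integral>\<^sup>+c. \<infinity> * indicator (sym_emb -` N) c \<partial>lborel)"
  proof (rule nn_integral_mono)
    fix c :: "real^('n uprod ordered_copy)"
    show "\<infinity> * indicator (sym_emb -` N) c \<le>
        (\<integral>\<^sup>+t. \<phi> (sym_emb c + t *\<^sub>R E) * indicator {0<..<1} t \<partial>lborel)"
    proof (cases "sym_emb c \<in> N")
      case True
      let ?x = "sym_emb c :: real^'n^'n"
      have near: "dist (?x + E) y0 < e'"
        using True by (simp add: N_def dist_norm norm_minus_commute algebra_simps)
      have "?x + E \<in> sym_matrices" using E[of 1] by (intro subspace_add[OF subspace_sym_matrices]) auto
      then have 1: "?x + E \<in> pos_def_cone" using e(2) near e'(2) by force
      have "\<bar>(?x + E - y0) $ i $ i\<bar> \<le> norm (?x + E - y0)"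
        by (rule order_trans[OF component_le_norm_cart Finite_Cartesian_Product.norm_nth_le])
      then have "?x $ i $ i + 1 - 3/4 < 1/8"
        using near e'(3) by (simp add: dist_norm y0_def E_def matrix_unit_def mat_def)
      then have 2: "?x $ i $ i < 0" by linarith
      have "norm (?x + E) \<le> norm y0 + dist (?x + E) y0"
        using norm_triangle_sub[of "?x + E" y0] by (simp add: dist_norm)
      then have 3: "norm (?x + E) \<le> norm y0 + 1" using near e'(3) by linarith
      show ?thesis using inner_inf[OF sym_emb_sym 1 2 3] by simp
    qed simp
  qed
  finally have "(\<integral>\<^sup>+c. \<infinity> * indicator (sym_emb -` N) c \<partial>lborel) \<le> (\<integral>\<^sup>+x. \<phi> x \<partial>?\<mu>)" .
  moreover have "(\<integral>\<^sup>+c. \<infinity> * indicator (sym_emb -` N) c \<partial>lborel) = \<infinity> * emeasure ?\<mu> N"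
    unfolding emeasure_sym_lborel[OF N]
    by (rule nn_integral_cmult_indicator) (use measurable_sets[OF measurable_sym_emb N] in simp)
  ultimately show False
    using fin' N0 by (simp add: ennreal_top_mult top_unique)
qed

lemma trace_pos_def: "x \<in> pos_def_cone \<Longrightarrow> 0 \<le> trace x"
  using inner_ge_zero[of "mat_sqrt x"] mat_sqrt_square[of x] pos_def_sym[OF mat_sqrt_pos_def[of x]]
  by (simp add: inner_matrix_eq_trace)

text \<open>If \<open>0 \<le> c\<close>, the exponential is at least 1 on the cone, so
  \<open>det x powr p\<close> alone would be integrable. Dilation by 2 multiplies its integral by a
  factor \<open>a\<close>, which exceeds 1 for \<open>p > -1\<close>; the integral would then be 0,
  although the integrand is positive on the cone.\<close>

lemma wishart_rate_pos:
  fixes c p :: real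
  assumes p: "-1 < p"
    and fin: "(\<integral>\<^sup>+x. ennreal (det x powr p * exp (c * trace x) * indicator pos_def_cone x)
        \<partial>(sym_lborel :: (real^'n^'n) measure)) < \<infinity>"
  shows "c < 0"
proof (rule ccontr)
  assume "\<not> c < 0"
  then have c: "0 \<le> c" by simp
  let ?\<mu> = "sym_lborel :: (real^'n^'n) measure"
  define h where "h x = ennreal (det x powr p * indicator pos_def_cone x)" for x :: "real^'n^'n"
  have "(\<lambda>x :: real^'n^'n. det x) \<in> borel_measurable borel"
    by (intro borel_measurable_continuous_onI continuous_on_det continuous_on_id)
  then have h[measurable]: "h \<in> borel_measurable borel" unfolding h_def by measurable
  have "(\<integral>\<^sup>+x. h x \<partial>?\<mu>) \<le> (\<integral>\<^sup>+x. ennreal (det x powr p * exp (c * trace x) * indicator pos_def_cone x) \<partial>?\<mu>)"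
  proof (rule nn_integral_mono)
    fix x :: "real^'n^'n"
    show "h x \<le> ennreal (det x powr p * exp (c * trace x) * indicator pos_def_cone x)"
    proof (cases "x \<in> pos_def_cone")
      case True
      then have "1 \<le> exp (c * trace x)" using c trace_pos_def[OF True] by (simp add: mult_nonneg_nonneg)
      then have "det x powr p * 1 \<le> det x powr p * exp (c * trace x)" by (intro mult_left_mono) auto
      then show ?thesis using True by (simp add: h_def ennreal_leI)
    qed (simp add: h_def)
  qed
  then have fin': "(\<integral>\<^sup>+x. h x \<partial>?\<mu>) < \<infinity>" using fin by (rule le_less_trans)
  define g where "g = sqrt 2 *\<^sub>R (mat 1 :: real^'n^'n)"
  have "g \<in> pos_def_cone" by (simp add: g_def pos_def_scaleR)
  note g = pos_def_invertible[OF this] pos_def_sym[OF this]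
  have conj: "g ** x ** transpose g = 2 *\<^sub>R x" for x
    unfolding g(2) by (simp add: g_def matrix_ring_simps)
  define a where "a = 2 powr (real CARD('n uprod) + real CARD('n) * p)"
  have pd2: "2 *\<^sub>R x \<in> pos_def_cone \<longleftrightarrow> x \<in> pos_def_cone" for x :: "real^'n^'n"
    using pos_def_scaleR[of x 2] pos_def_scaleR[of "2 *\<^sub>R x" "1/2"] by auto
  have h2: "h (2 *\<^sub>R x) = ennreal (2 powr (real CARD('n) * p)) * h x" for x
  proof (cases "x \<in> pos_def_cone")
    case True
    then show ?thesis using det_pos_def[OF True]
      by (simp add: h_def pd2 det_scaleR powr_mult powr_powr[symmetric] powr_realpow ennreal_mult)
  qed (simp add: h_def pd2)
  have "(\<integral>\<^sup>+x. h x \<partial>?\<mu>) = ennreal (2 ^ CARD('n uprod)) * (\<integral>\<^sup>+x. ennreal (2 powr (real CARD('n) * p)) * h x \<partial>?\<mu>)"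
    using nn_integral_conj[OF g(1) h] unfolding conj h2 by (simp add: g_def conj_jacobian_scalar)
  also have "\<dots> = ennreal (2 ^ CARD('n uprod)) * (ennreal (2 powr (real CARD('n) * p)) * (\<integral>\<^sup>+x. h x \<partial>?\<mu>))"
    by (subst nn_integral_cmult) auto
  also have "\<dots> = ennreal a * (\<integral>\<^sup>+x. h x \<partial>?\<mu>)"
    by (simp add: a_def mult.assoc[symmetric] ennreal_mult[symmetric] powr_add powr_realpow)
  finally have inv: "(\<integral>\<^sup>+x. h x \<partial>?\<mu>) = ennreal a * (\<integral>\<^sup>+x. h x \<partial>?\<mu>)" .
  have "real CARD('n uprod) = real CARD('n) * (real CARD('n) + 1) / 2"
    unfolding card_UNIV_uprod by (simp add: real_of_nat_div algebra_simps)
  then have "real CARD('n uprod) + real CARD('n) * p = real CARD('n) * ((real CARD('n) + 1) / 2 + p)"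
    by (simp add: algebra_simps)
  moreover have "2 \<le> real CARD('n) + 1" by (simp add: Suc_leI)
  then have "1 \<le> (real CARD('n) + 1) / 2" by (subst le_divide_eq_numeral1(1)) simp
  then have "0 < real CARD('n) * ((real CARD('n) + 1) / 2 + p)"
    using p by (intro mult_pos_pos) (simp, linarith)
  ultimately have a: "1 < a" unfolding a_def by simp
  obtain r where r: "(\<integral>\<^sup>+x. h x \<partial>?\<mu>) = ennreal r" "0 \<le> r"
    using fin' by (cases "\<integral>\<^sup>+x. h x \<partial>?\<mu>") auto
  have "r = a * r" using inv a r by (simp add: ennreal_mult[symmetric])
  then have "(\<integral>\<^sup>+x. h x \<partial>?\<mu>) = 0" using a r by simp
  then have ae: "AE x in ?\<mu>. h x = 0" by (subst (asm) nn_integral_0_iff_AE) auto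
  have "cone_ball (mat 1) 1 \<in> null_sets ?\<mu>"
  proof (rule AE_iff_null_sets[THEN iffD2])
    show "cone_ball (mat 1) 1 \<in> sets ?\<mu>" by simp
    show "AE x in ?\<mu>. x \<notin> cone_ball (mat 1) 1"
      using ae
    proof eventually_elim
      case (elim x)
      show ?case
      proof
        assume "x \<in> cone_ball (mat 1) 1"
        then have "x \<in> pos_def_cone" by (simp add: cone_ball_def)
        with elim det_pos_def[OF this] show False by (simp add: h_def)
      qed
    qed
  qed
  moreover obtain m where "0 < m" "emeasure ?\<mu> (cone_ball (mat 1) 1) = ennreal m"
    by (rule emeasure_cone_ball[OF pos_def_mat_1, of 1]) auto
  ultimately show False by (simp add: null_sets_def)
qed

text \<open>Normalisation absorbs the unknown constant \<open>exp C\<close>, so the shape of the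
  density identifies the law. The first conclusion supplies the finiteness from which the parameter
  bounds are deduced.\<close>

lemma distr_eq_law_proportional_to:
  assumes "prob_space M" and X: "distributed M sym_lborel X (\<lambda>x. ennreal (f x * indicator pos_def_cone x))"
    and f: "\<And>x. x \<in> pos_def_cone \<Longrightarrow> f x = exp C * h x" and h: "\<And>x. 0 \<le> h x"
  shows "(\<integral>\<^sup>+x. ennreal (h x * indicator pos_def_cone x) \<partial>sym_lborel) = ennreal (exp (- C))"
    and "distr M borel X = law_proportional_to (\<lambda>x. h x * indicator pos_def_cone x)"
proof -
  interpret prob_space M by fact
  let ?k = "\<lambda>x. h x * indicator pos_def_cone x"
  have fk: "f x * indicator pos_def_cone x = exp C * ?k x" for x
    using f by (simp add: indicator_def)
  have k: "ennreal (?k x) = ennreal (exp (- C)) * ennreal (f x * indicator pos_def_cone x)" for x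
    unfolding fk using h by (simp add: ennreal_mult[symmetric] exp_minus indicator_def)
  have "(\<integral>\<^sup>+x. ennreal (f x * indicator pos_def_cone x) \<partial>sym_lborel) = emeasure M (X -` UNIV \<inter> space M)"
    by (subst distributed_emeasure[OF X]) auto
  then have "(\<integral>\<^sup>+x. ennreal (f x * indicator pos_def_cone x) \<partial>sym_lborel) = 1"
    by (simp add: emeasure_space_1)
  then show int: "(\<integral>\<^sup>+x. ennreal (?k x) \<partial>sym_lborel) = ennreal (exp (- C))"
    unfolding k using distributed_borel_measurable[OF X] by (subst nn_integral_cmult) auto
  have "ennreal (?k x) / ennreal (exp (- C)) = ennreal (f x * indicator pos_def_cone x)" for x
    unfolding fk using h by (simp add: divide_ennreal exp_minus indicator_def field_simps)
  then have "law_proportional_to ?k = density sym_lborel (\<lambda>x. ennreal (f x * indicator pos_def_cone x))"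
    unfolding law_proportional_to_def int by simp
  also have "\<dots> = distr M sym_lborel X" by (rule distributed_distr_eq_density[OF X, symmetric])
  also have "\<dots> = distr M borel X" by (rule distr_cong) auto
  finally show "distr M borel X = law_proportional_to ?k" ..
qed

theorem theorem5p1:
  fixes M :: "'a measure" and X Y U V :: "'a \<Rightarrow> real^'n^'n"
  assumes "prob_space M"
    and "\<forall>\<omega>\<in>space M. X \<omega> \<in> pos_def_cone"
    and "\<forall>\<omega>\<in>space M. Y \<omega> \<in> pos_def_cone"
    and "prob_space.indep_var M borel X borel Y"
    and "has_pos_cont_density M X"
    and "has_pos_cont_density M Y"
    and "U = (\<lambda>\<omega>. quad_rep (matrix_inv (mat_sqrt (mat 1 + X \<omega>))) (Y \<omega>))"
    and "V = (\<lambda>\<omega>. quad_rep (mat_sqrt (mat 1 + U \<omega>)) (X \<omega>))"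
    and "prob_space.indep_var M borel U borel V"
  shows "\<exists>a b lam :: real.
           a > (real CARD('n) - 1) / 2 \<and>
           b > (real CARD('n) - 1) / 2 - a \<and>
           lam > 0 \<and>
           distr M borel X = matrix_kummer a b (lam *\<^sub>R mat 1) \<and>
           distr M borel Y = wishart (a + b) (lam *\<^sub>R mat 1)"
proof -
  obtain f where f: "\<forall>x\<in>pos_def_cone. 0 < f x" "continuous_on pos_def_cone f"
    "distributed M sym_lborel X (\<lambda>x. ennreal (f x * indicator pos_def_cone x))"
    using assms(5) unfolding has_pos_cont_density_def by blast
  obtain g where g: "\<forall>x\<in>pos_def_cone. 0 < g x" "continuous_on pos_def_cone g"
    "distributed M sym_lborel Y (\<lambda>x. ennreal (g x * indicator pos_def_cone x))"
    using assms(6) unfolding has_pos_cont_density_def by blast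
  interpret prob_space M by (rule assms(1))
  interpret kummer_independence M X Y U V f g
    by unfold_locales
       (use assms f g in \<open>auto simp: kummer_inv_def[abs_def] kummer_map_def[abs_def] quad_rep_def\<close>)
  define K where "K = (real CARD('n) + 1) / 2"
  obtain p q c cF cG where
    G: "\<And>y. y \<in> pos_def_cone \<Longrightarrow> g y = exp cG * (det y powr p * exp (c * trace y))" and
    F: "\<And>x. x \<in> pos_def_cone \<Longrightarrow> f x = exp cF * (det x powr q *
       det (mat 1 + x) powr (- (p + K)) * exp (c * trace x))"
    unfolding K_def by (rule densities) blast
  note Y_law = distr_eq_law_proportional_to[OF assms(1) g(3) G]
  note X_law = distr_eq_law_proportional_to[OF assms(1) f(3) F]
  have exp_lower: "\<exists>\<delta>>0. \<forall>x. norm x \<le> R \<longrightarrow> \<delta> \<le> exp (c * trace (x :: real^'n^'n))" for R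
  proof -
    \<comment> \<open>The absolute value keeps the ball nonempty, so that a minimum exists for every
      \<open>R\<close>.\<close>
    have ne: "cball (0 :: real^'n^'n) \<bar>R\<bar> \<noteq> {}" by simp
    have cont: "continuous_on (cball (0 :: real^'n^'n) \<bar>R\<bar>) (\<lambda>x. exp (c * trace x))"
      by (intro continuous_intros)
    from continuous_attains_inf[OF compact_cball ne cont] obtain z :: "real^'n^'n"
      where z: "\<forall>x\<in>cball 0 \<bar>R\<bar>. exp (c * trace z) \<le> exp (c * trace (x :: real^'n^'n))" by blast
    show ?thesis
      by (intro exI[of _ "exp (c * trace z)"] conjI allI impI bspec[OF z]) auto
  qed
  have p: "-1 < p"
  proof (rule det_powr_integrable_imp)
    show "\<exists>\<delta>>0. \<forall>x\<in>pos_def_cone. norm x \<le> R \<longrightarrow> \<delta> \<le> exp (c * trace (x :: real^'n^'n))" for R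
      using exp_lower[of R] by blast
    show "(\<integral>\<^sup>+x. ennreal (det x powr p * exp (c * trace x) * indicator pos_def_cone x)
        \<partial>(sym_lborel :: (real^'n^'n) measure)) < \<infinity>"
      using Y_law(1) by simp
  qed
  have c: "c < 0"
    by (rule wishart_rate_pos[where 'n = 'n, OF p]) (use Y_law(1) in simp)
  have "2 \<le> real CARD('n) + 1" by (simp add: Suc_leI)
  then have "1 \<le> K" unfolding K_def by (subst le_divide_eq_numeral1(1)) simp
  then have pK: "0 < p + K" using p by linarith
  have q: "-1 < q"
  proof (rule det_powr_integrable_imp)
    show "\<exists>\<delta>>0. \<forall>x\<in>pos_def_cone. norm x \<le> R \<longrightarrow>
        \<delta> \<le> det (mat 1 + x) powr (- (p + K)) * exp (c * trace (x :: real^'n^'n))" for R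
    proof -
      obtain \<delta> where \<delta>: "0 < \<delta>" "\<And>x :: real^'n^'n. norm x \<le> R \<Longrightarrow> \<delta> \<le> exp (c * trace x)"
        using exp_lower[of R] by blast
      have "compact ((\<lambda>x :: real^'n^'n. det (mat 1 + x)) ` cball 0 R)"
        by (intro compact_continuous_image continuous_on_det continuous_intros) auto
      then obtain D where D: "\<And>x :: real^'n^'n. norm x \<le> R \<Longrightarrow> \<bar>det (mat 1 + x)\<bar> \<le> D"
        using compact_imp_bounded bounded_iff by (force simp: bounded_iff)
      show ?thesis
      proof (intro exI[of _ "max D 1 powr (- (p + K)) * \<delta>"] conjI ballI impI)
        show "0 < max D 1 powr (- (p + K)) * \<delta>" using \<delta>(1) by (simp add: max_def)
        fix x :: "real^'n^'n" assume x: "x \<in> pos_def_cone" "norm x \<le> R"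
        \<comment> \<open>The power is decreasing because \<open>p + K\<close> is positive, which is
          why \<open>p\<close> is bounded before \<open>q\<close>.\<close>
        have "max D 1 powr (- (p + K)) \<le> det (mat 1 + x) powr (- (p + K))"
          using det_pos_def[OF pos_def_1_add[OF x(1)]] D[OF x(2)] pK by (intro powr_mono2') auto
        then show "max D 1 powr (- (p + K)) * \<delta> \<le> det (mat 1 + x) powr (- (p + K)) * exp (c * trace x)"
          using \<delta>(1) \<delta>(2)[OF x(2)] by (intro mult_mono) auto
      qed
    qed
    show "(\<integral>\<^sup>+x. ennreal (det x powr q * (det (mat 1 + x) powr (- (p + K)) * exp (c * trace x)) *
        indicator pos_def_cone x) \<partial>(sym_lborel :: (real^'n^'n) measure)) < \<infinity>"
      using X_law(1) by (simp add: mult.assoc)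
  qed
  \<comment> \<open>Solves \<open>a - K = q\<close> and \<open>a + b - K = p\<close>. Since
    \<open>K - 1 = (real CARD('n) - 1) / 2\<close>, the bounds \<open>-1 < q\<close> and
    \<open>-1 < p\<close> are the required ones for \<open>a\<close> and
    \<open>a + b\<close>.\<close>
  define a b where "a = q + K" and "b = p - q"
  have ab: "a - K = q" "a + b = p + K" "a + b - K = p" by (simp_all add: a_def b_def)
  have tr: "- trace ((- c) *\<^sub>R mat 1 ** x) = c * trace x" for x :: "real^'n^'n"
    unfolding matrix_mult.scaleR_left trace_scaleR matrix_mul_lid by simp
  have "distr M borel X = matrix_kummer a b ((- c) *\<^sub>R mat 1)"
    unfolding matrix_kummer_def K_def[symmetric] ab tr by (rule X_law(2)) (auto intro!: mult_nonneg_nonneg)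
  moreover have "distr M borel Y = wishart (a + b) ((- c) *\<^sub>R mat 1)"
    unfolding wishart_def K_def[symmetric] ab(3) tr by (rule Y_law(2)) (auto intro!: mult_nonneg_nonneg)
  moreover have "a > (real CARD('n) - 1) / 2" "b > (real CARD('n) - 1) / 2 - a"
    using p q by (simp_all add: a_def b_def K_def field_simps)
  ultimately show ?thesis using c by (intro exI[of _ a] exI[of _ b] exI[of _ "- c"]) simp
qed

end
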